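(* Let $n\ge 1$, let $m_1,\dots,m_n\in\mathbb{Z}_{\ge 0}$ and $\lambda=m_1\omega_1+\dots+m_n\omega_n$. Then the set of vectors $$f^{\mathbf s}v_\lambda,\qquad \mathbf s\in FFLV^{\mathbb Z}_{2n+1}(\lambda),$$ is a basis of the trace-free representation $\mathcal V_0(\lambda)$ of $\mathfrak{sp}_{2n+1}$, and (the corresponding set of elements $f^{\mathbf s}v_\lambda$, with $f^{\mathbf s}$ regarded as a monomial in $S(\tilde{\mathfrak n}^-)$) is a basis of the associated graded space $\operatorname{gr}\mathcal V_0(\lambda)$ with respect to the PBW filtration.
   Context: **Odd symplectic Lie algebra.** Let $V=\mathbb C^{2n+1}$ with basis $e_1,\dots,e_{2n+1}$ and coordinates $x_1,\dots,x_{2n+1}$, and let $\omega=\sum_{i=1}^n dx_i\wedge dx_{n+i}$, a skew-symmetric form of maximal rank $2n$. $\mathfrak{sp}_{2n+1}$ is the Lie algebra of the subgroup of $GL(V)$ preserving $\omega$. In the basis above it consists of block matrices $\begin{bmatrix} A&0\\ b&z\end{bmatrix}$ with $A\in\mathfrak{sp}_{2n}$, $b\in\mathbb C^{2n}$ a row, $z\in\mathbb C$. Let $E_{i,j}$ be matrix units. Let $\mathfrak h\subset\mathfrak{sp}_{2n}$ be the diagonal Cartan subalgebra, spanned by $E_{i,i}-E_{n+i,n+i}$, with $\varepsilon_1,\dots,\varepsilon_n$ the dual basis. Simple roots of $\mathfrak{sp}_{2n}$: $\alpha_i=\varepsilon_i-\varepsilon_{i+1}$ ($i<n$), $\alpha_n=2\varepsilon_n$;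 fundamental weights $\omega_i=\varepsilon_1+\dots+\varepsilon_i$. Positive roots $R^+$: $\alpha_{i,j}=\alpha_i+\dots+\alpha_j$ ($1\le i\le j\le n-1$) and $\alpha_{i,\overline j}=\alpha_i+\alpha_{i+1}+\dots+\alpha_n+\alpha_{n-1}+\dots+\alpha_j$ ($1\le i\le j\le n$). Let $\mathfrak{sp}_{2n}=\mathfrak n^+\oplus\mathfrak h\oplus\mathfrak n^-$ be the corresponding Cartan decomposition and let $f_\alpha\in\mathfrak n^-$ be a nonzero root vector of weight $-\alpha$; write $f_{i,j}=f_{\alpha_{i,j}}$, $f_{i,\overline j}=f_{\alpha_{i,\overline j}}$. Set $f_{i,n}=f_{\alpha_{i,n}}=E_{2n+1,i}$ for $1\le i\le n$, where $\alpha_{i,n}$ denotes an additional root (the negative of the weight of $E_{2n+1,i}$; it is distinct from $\alpha_{i,\overline n}$). Put $F^+=\bigoplus_{i=1}^n\mathbb C E_{2n+1,n+i}$, $F^-=\bigoplus_{i=1}^n\mathbb C E_{2n+1,i}$, $\tilde{\mathfrak n}^\pm=\mathfrak n^\pm\oplus F^\pm$, $\tilde{\mathfrak h}=\mathfrak h\oplus\mathbb C E_{2n+1,2n+1}$, so $\mathfrak{sp}_{2n+1}=\tilde{\mathfrak n}^-\oplus\tilde{\mathfrak h}\oplus\tilde{\mathfrak n}^+$. **The representation $\mathcal V_0(\lambda)$.** Identify $\lambda=\sum m_i\omega_i$ with the Young diagram $(\lambda_1\ge\dots\ge\lambda_n\ge0)$, $\lambda_i=m_i+\dots+m_n$, $|\lambda|=\sum\lambda_i$.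 Let $V^\lambda\subset V^{\otimes|\lambda|}$ be the irreducible $GL(V)$-subrepresentation of highest weight $\lambda$ given as the image of the Young symmetrizer $c_\lambda$. A tensor in $V^{\otimes k}$ is trace-free if all its $k(k-1)/2$ contractions with $\omega$ (in pairs of tensor positions) vanish. $\mathcal V_0(\lambda)$ is the subspace of trace-free tensors in $V^\lambda$; it is a representation of $\mathfrak{sp}_{2n+1}$. The highest weight vector $v_\lambda\in V^\lambda$ (nonzero, of $GL(V)$-weight $(\lambda_1,\dots,\lambda_n,0,\dots,0)$) lies in $\mathcal V_0(\lambda)$. **PBW filtration.** $U^s(\mathfrak g)\subset U(\mathfrak g)$ is the span of products of at most $s$ elements of $\mathfrak g$. The PBW filtration on $\mathcal V_0(\lambda)$ is $\mathcal V_0(\lambda)^s=U^s(\tilde{\mathfrak n}^-)v_\lambda$, and $\operatorname{gr}\mathcal V_0(\lambda)=\bigoplus_s\mathcal V_0(\lambda)^s/\mathcal V_0(\lambda)^{s-1}$ is a module over the symmetric algebra $S(\tilde{\mathfrak n}^-)$. **Polytope.** Consider the poset whose elements are $\alpha_{i,j}$ ($1\le i\le j\le n$) and $\alpha_{i,\overline j}$ ($1\le i\le j\le n$), arranged in rows $i=1,\dots,n$, with arrows $\alpha_{i,i}\to\alpha_{i,i+1}\to\dots\to\alpha_{i,n}\to\alpha_{i,\overline n}\to\alpha_{i,\overline{n-1}}\to\dots\to\alpha_{i,\overline i}$ along each row and vertical arrows $\alpha_{i,j}\to\alpha_{i+1,j}$, $\alpha_{i,\overline j}\to\alpha_{i+1,\overline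 j}$ for $i+1\le j\le n$. A symplectic Dyck path is a sequence $p=(p(0),\dots,p(k))$ ($k\ge0$), each $p(t)\to p(t+1)$ being an arrow, with $p(0)=\alpha_{i,i}$ for some $i$ and $p(k)=\alpha_{j,j}$ or $p(k)=\alpha_{j,\overline j}$ for some $j\ge i$. $FFLV_{2n+1}(\lambda)\subset\mathbb R_{\ge0}^{n(n+1)}$ is the set of $\mathbf s=(s_\alpha)$, indexed by the elements of the poset, such that for each symplectic Dyck path $p$: $\sum_{\alpha\in p}s_\alpha\le m_i+\dots+m_j$ if $p(0)=\alpha_{i,i},p(k)=\alpha_{j,j}$; and $\sum_{\alpha\in p}s_\alpha\le m_i+\dots+m_n$ if $p(0)=\alpha_{i,i},p(k)=\alpha_{j,\overline j}$. $FFLV^{\mathbb Z}_{2n+1}(\lambda)$ is its set of integral points. For such $\mathbf s$, $f^{\mathbf s}=\prod_\alpha f_\alpha^{s_\alpha}\in U(\tilde{\mathfrak n}^-)$, the product taken in an arbitrary fixed order of the $\alpha$'s; in $\operatorname{gr}\mathcal V_0(\lambda)$, $f^{\mathbf s}v_\lambda$ denotes the action of the corresponding monomial of $S(\tilde{\mathfrak n}^-)$ on the class of $v_\lambda$. *)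

theory Defs
  imports "Jordan_Normal_Form.VS_Connect" "HOL-Algebra.AbelCoset"
begin

section \<open>The odd symplectic Lie algebra\<close>

text \<open>
  \<open>V = \<complex>\<^sup>N\<close> with \<open>N = 2 n + 1\<close>. Matrices act on column vectors.
  Rows and columns of the library's matrices are numbered from 0, so the basis vector
  \<open>e\<^sub>i\<close> (\<open>1 \<le> i \<le> N\<close>) has index \<open>i - 1\<close>; the arguments of \<open>matrix_unit\<close> and of all weights and
  roots are numbered from 1.
\<close>

abbreviation (input) odd_dim :: "nat \<Rightarrow> nat" where
  "odd_dim n \<equiv> 2 * n + 1"

definition matrix_unit :: "nat \<Rightarrow> nat \<Rightarrow> nat \<Rightarrow> complex mat" where
  "matrix_unit N i j = mat N N (\<lambda>(a, b). if a + 1 = i \<and> b + 1 = j then 1 else 0)"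

text \<open>The Gram matrix of \<open>\<omega> = \<Sum>\<^sub>i dx\<^sub>i \<and> dx\<^bsub>n+i\<^esub>\<close>.\<close>

definition omega :: "nat \<Rightarrow> complex mat" where
  "omega n = mat (odd_dim n) (odd_dim n)
     (\<lambda>(a, b). if a < n \<and> b = n + a then 1 else if b < n \<and> a = n + b then - 1 else 0)"

text \<open>The condition is \<open>\<omega>(X u, v) + \<omega>(u, X v) = 0\<close> for all \<open>u\<close>, \<open>v\<close>.\<close>

definition sp_odd :: "nat \<Rightarrow> complex mat set" where
  "sp_odd n = {X \<in> carrier_mat (odd_dim n) (odd_dim n).
     transpose_mat X * omega n + omega n * X = 0\<^sub>m (odd_dim n) (odd_dim n)}"

text \<open>\<open>sp\<^bsub>2n\<^esub>\<close>, embedded as the upper left block.\<close>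

definition sp_even :: "nat \<Rightarrow> complex mat set" where
  "sp_even n = {X \<in> sp_odd n. \<forall>a < odd_dim n. X $$ (2 * n, a) = 0 \<and> X $$ (a, 2 * n) = 0}"

text \<open>\<open>cartan n h = \<Sum>\<^sub>i h\<^sub>i (E\<^bsub>i,i\<^esub> - E\<^bsub>n+i,n+i\<^esub>)\<close>, the general element of the Cartan subalgebra.\<close>

definition cartan :: "nat \<Rightarrow> (nat \<Rightarrow> complex) \<Rightarrow> complex mat" where
  "cartan n h = mat (odd_dim n) (odd_dim n) (\<lambda>ab. \<Sum>i = 1..n. h i *
     (matrix_unit (odd_dim n) i i - matrix_unit (odd_dim n) (n + i) (n + i)) $$ ab)"

text \<open>\<open>Rt i j\<close> is \<open>\<alpha>\<^bsub>i,j\<^esub>\<close> and \<open>Rtb i j\<close> is \<open>\<alpha>\<close> with index \<open>i, j-bar\<close>.\<close>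

datatype root = Rt nat nat | Rtb nat nat

definition poset :: "nat \<Rightarrow> root set" where
  "poset n = {Rt i j | i j. 1 \<le> i \<and> i \<le> j \<and> j \<le> n} \<union> {Rtb i j | i j. 1 \<le> i \<and> i \<le> j \<and> j \<le> n}"

text \<open>The roots of \<open>sp\<^bsub>2n\<^esub>\<close> among them; \<open>Rt i n\<close> is the additional root belonging to
  \<open>E\<^bsub>2n+1,i\<^esub>\<close>.\<close>

definition pos_roots :: "nat \<Rightarrow> root set" where
  "pos_roots n = {Rt i j | i j. 1 \<le> i \<and> i \<le> j \<and> j \<le> n - 1} \<union> {Rtb i j | i j. 1 \<le> i \<and> i \<le> j \<and> j \<le> n}"

text \<open>Weights of the Cartan subalgebra are given by their coordinates with respect to
  \<open>\<epsilon>\<^sub>1, \<dots>, \<epsilon>\<^sub>n\<close>.\<close>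

definition eps :: "nat \<Rightarrow> nat \<Rightarrow> int" where
  "eps i = (\<lambda>l. if l = i then 1 else 0)"

definition simple_root :: "nat \<Rightarrow> nat \<Rightarrow> nat \<Rightarrow> int" where
  "simple_root n i = (\<lambda>l. if i < n then eps i l - eps (i + 1) l else 2 * eps n l)"

fun root_weight :: "nat \<Rightarrow> root \<Rightarrow> nat \<Rightarrow> int" where
  "root_weight n (Rt i j) =
     (\<lambda>l. if j < n then (\<Sum>r = i..j. simple_root n r l) else eps i l)"
| "root_weight n (Rtb i j) =
     (\<lambda>l. (\<Sum>r = i..n. simple_root n r l) + (\<Sum>r = j..<n. simple_root n r l))"

definition neg_root_space :: "nat \<Rightarrow> root \<Rightarrow> complex mat set" where
  "neg_root_space n \<alpha> = {X \<in> sp_even n. \<forall>h.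
     cartan n h * X - X * cartan n h = (- (\<Sum>l = 1..n. of_int (root_weight n \<alpha> l) * h l)) \<cdot>\<^sub>m X}"

definition mat_span :: "nat \<Rightarrow> complex mat set \<Rightarrow> complex mat set" where
  "mat_span N = LinearCombinations.module.span class_ring (module_mat TYPE(complex) N N)"

definition n_minus :: "nat \<Rightarrow> complex mat set" where
  "n_minus n = mat_span (odd_dim n) (\<Union>\<alpha> \<in> pos_roots n. neg_root_space n \<alpha>)"

definition F_minus :: "nat \<Rightarrow> complex mat set" where
  "F_minus n = mat_span (odd_dim n) {matrix_unit (odd_dim n) (odd_dim n) i | i. 1 \<le> i \<and> i \<le> n}"

definition n_tilde_minus :: "nat \<Rightarrow> complex mat set" where
  "n_tilde_minus n = {X + Y | X Y. X \<in> n_minus n \<and> Y \<in> F_minus n}"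

definition is_root_vectors :: "nat \<Rightarrow> (root \<Rightarrow> complex mat) \<Rightarrow> bool" where
  "is_root_vectors n f \<longleftrightarrow>
     (\<forall>\<alpha> \<in> pos_roots n. f \<alpha> \<in> neg_root_space n \<alpha> \<and> f \<alpha> \<noteq> 0\<^sub>m (odd_dim n) (odd_dim n)) \<and>
     (\<forall>i. 1 \<le> i \<and> i \<le> n \<longrightarrow> f (Rt i n) = matrix_unit (odd_dim n) (odd_dim n) i)"


section \<open>Tensors\<close>

text \<open>A tensor in \<open>(\<complex>\<^sup>N)\<^bsup>\<otimes>k\<^esup>\<close> is given by its coordinates: \<open>t [a\<^sub>1, \<dots>, a\<^sub>k]\<close> is the coefficient of
  the tensor product of the basis vectors with (0-based) indices \<open>a\<^sub>1, \<dots>, a\<^sub>k\<close>.\<close>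

type_synonym tensor = "nat list \<Rightarrow> complex"

definition words :: "nat \<Rightarrow> nat \<Rightarrow> nat list set" where
  "words N k = {w. length w = k \<and> set w \<subseteq> {..<N}}"

definition tensor_space :: "nat \<Rightarrow> nat \<Rightarrow> (complex, tensor) module" where
  "tensor_space N k = \<lparr>
     carrier = {t. \<forall>w. w \<notin> words N k \<longrightarrow> t w = 0},
     mult = undefined,
     one = undefined,
     zero = (\<lambda>w. 0),
     add = (\<lambda>s t w. s w + t w),
     smult = (\<lambda>c t w. c * t w)\<rparr>"

definition group_act :: "nat \<Rightarrow> complex mat \<Rightarrow> tensor \<Rightarrow> tensor" where
  "group_act N g t = (\<lambda>w. if set w \<subseteq> {..<N}
     then \<Sum>u \<in> words N (length w). (\<Prod>p < length w. g $$ (w ! p, u ! p)) * t u else 0)"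

text \<open>\<open>X\<close> acts by \<open>X (v\<^sub>1 \<otimes> \<dots> \<otimes> v\<^sub>k) = \<Sum>\<^sub>p v\<^sub>1 \<otimes> \<dots> \<otimes> X v\<^sub>p \<otimes> \<dots> \<otimes> v\<^sub>k\<close>.\<close>

definition lie_act :: "nat \<Rightarrow> complex mat \<Rightarrow> tensor \<Rightarrow> tensor" where
  "lie_act N X t = (\<lambda>w. if set w \<subseteq> {..<N}
     then \<Sum>p < length w. \<Sum>a < N. X $$ (w ! p, a) * t (w[p := a]) else 0)"

text \<open>The right action \<open>(v\<^sub>1 \<otimes> \<dots> \<otimes> v\<^sub>k) \<cdot> \<sigma> = v\<^bsub>\<sigma>(1)\<^esub> \<otimes> \<dots> \<otimes> v\<^bsub>\<sigma>(k)\<^esub>\<close> of the symmetric group: it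
  sends the basis word \<open>u\<close> to \<open>permute_list \<sigma> u\<close>.\<close>

definition perm_act :: "(nat \<Rightarrow> nat) \<Rightarrow> tensor \<Rightarrow> tensor" where
  "perm_act \<sigma> t = (\<lambda>w. t (permute_list (inv_into UNIV \<sigma>) w))"

text \<open>The contraction \<open>V\<^bsup>\<otimes>k\<^esup> \<rightarrow> V\<^bsup>\<otimes>(k-2)\<^esup>\<close> of the tensor positions \<open>p < q\<close> (numbered from 0)
  with \<open>\<omega>\<close>.\<close>

definition insert_at :: "nat \<Rightarrow> nat \<Rightarrow> nat list \<Rightarrow> nat list" where
  "insert_at p a w = take p w @ a # drop p w"

definition contraction :: "nat \<Rightarrow> nat \<Rightarrow> nat \<Rightarrow> tensor \<Rightarrow> tensor" where
  "contraction n p q t = (\<lambda>w. \<Sum>a < odd_dim n. \<Sum>b < odd_dim n.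
     omega n $$ (a, b) * t (insert_at q b (insert_at p a w)))"

definition trace_free :: "nat \<Rightarrow> nat \<Rightarrow> tensor \<Rightarrow> bool" where
  "trace_free n k t \<longleftrightarrow> (\<forall>p q. p < q \<and> q < k \<longrightarrow> contraction n p q t = (\<lambda>w. 0))"


section \<open>The representation\<close>

text \<open>\<open>\<lambda>\<^sub>i = m\<^sub>i + \<dots> + m\<^sub>n\<close> (which is 0 for \<open>i > n\<close>) and \<open>|\<lambda>|\<close>.\<close>

definition part :: "nat \<Rightarrow> (nat \<Rightarrow> nat) \<Rightarrow> nat \<Rightarrow> nat" where
  "part n m i = (\<Sum>l = i..n. m l)"

definition part_size :: "nat \<Rightarrow> (nat \<Rightarrow> nat) \<Rightarrow> nat" where
  "part_size n m = (\<Sum>i = 1..n. part n m i)"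

text \<open>The boxes (row, column) of the Young diagram in the order of the canonical tableau, i.e.
  row by row; the \<open>p\<close>-th box carries the tensor position \<open>p\<close>.\<close>

definition boxes :: "nat \<Rightarrow> (nat \<Rightarrow> nat) \<Rightarrow> (nat \<times> nat) list" where
  "boxes n m = concat (map (\<lambda>i. map (\<lambda>c. (i, c)) [0..<part n m i]) [1..<n + 1])"

definition row_group :: "nat \<Rightarrow> (nat \<Rightarrow> nat) \<Rightarrow> (nat \<Rightarrow> nat) set" where
  "row_group n m = {\<sigma>. \<sigma> permutes {..<part_size n m} \<and>
     (\<forall>p < part_size n m. fst (boxes n m ! \<sigma> p) = fst (boxes n m ! p))}"

definition column_group :: "nat \<Rightarrow> (nat \<Rightarrow> nat) \<Rightarrow> (nat \<Rightarrow> nat) set" where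
  "column_group n m = {\<sigma>. \<sigma> permutes {..<part_size n m} \<and>
     (\<forall>p < part_size n m. snd (boxes n m ! \<sigma> p) = snd (boxes n m ! p))}"

text \<open>\<open>t \<cdot> c\<^sub>\<lambda>\<close>, where \<open>c\<^sub>\<lambda> = a\<^sub>\<lambda> b\<^sub>\<lambda>\<close> is the product of row symmetrizer and column
  antisymmetrizer in the group algebra.\<close>

definition young_symmetrizer :: "nat \<Rightarrow> (nat \<Rightarrow> nat) \<Rightarrow> tensor \<Rightarrow> tensor" where
  "young_symmetrizer n m t = (\<lambda>w. \<Sum>\<sigma> \<in> row_group n m. \<Sum>\<tau> \<in> column_group n m.
     of_int (sign \<tau>) * perm_act (\<sigma> \<circ> \<tau>) t w)"

abbreviation lambda_tensors :: "nat \<Rightarrow> (nat \<Rightarrow> nat) \<Rightarrow> (complex, tensor) module" where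
  "lambda_tensors n m \<equiv> tensor_space (odd_dim n) (part_size n m)"

definition GL_rep :: "nat \<Rightarrow> (nat \<Rightarrow> nat) \<Rightarrow> tensor set" where
  "GL_rep n m = young_symmetrizer n m ` carrier (lambda_tensors n m)"

definition trace_free_rep :: "nat \<Rightarrow> (nat \<Rightarrow> nat) \<Rightarrow> (complex, tensor) module" where
  "trace_free_rep n m = (lambda_tensors n m)
     \<lparr>carrier := {t \<in> GL_rep n m. trace_free n (part_size n m) t}\<rparr>"

text \<open>The weight condition refers to the diagonal torus of \<open>GL(V)\<close>.\<close>

definition is_highest_weight_vector :: "nat \<Rightarrow> (nat \<Rightarrow> nat) \<Rightarrow> tensor \<Rightarrow> bool" where
  "is_highest_weight_vector n m v \<longleftrightarrow> v \<in> GL_rep n m \<and> v \<noteq> (\<lambda>w. 0) \<and>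
     (\<forall>d. (\<forall>i \<in> {1..odd_dim n}. d i \<noteq> 0) \<longrightarrow>
        group_act (odd_dim n) (mat_diag (odd_dim n) (\<lambda>a. d (a + 1))) v =
        (\<Prod>i = 1..odd_dim n. d i ^ part n m i) \<odot>\<^bsub>lambda_tensors n m\<^esub> v)"


section \<open>The PBW filtration and the associated graded space\<close>

text \<open>Quotient of a vector space by a subspace and direct sum of a sequence of vector spaces;
  in the definition of \<open>smult\<close> all cosets in the union coincide.\<close>

definition quotient_space :: "(complex, 'a) module \<Rightarrow> 'a set \<Rightarrow> (complex, 'a set) module" where
  "quotient_space M W = \<lparr>
     carrier = A_RCOSETS M W,
     mult = undefined,
     one = undefined,
     zero = W,
     add = set_add M,
     smult = (\<lambda>c A. \<Union>x \<in> A. a_r_coset M W (c \<odot>\<^bsub>M\<^esub> x))\<rparr>"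

definition direct_sum_seq :: "(nat \<Rightarrow> (complex, 'a) module) \<Rightarrow> (complex, nat \<Rightarrow> 'a) module" where
  "direct_sum_seq M = \<lparr>
     carrier = {G. (\<forall>s. G s \<in> carrier (M s)) \<and> finite {s. G s \<noteq> \<zero>\<^bsub>M s\<^esub>}},
     mult = undefined,
     one = undefined,
     zero = (\<lambda>s. \<zero>\<^bsub>M s\<^esub>),
     add = (\<lambda>G H s. G s \<oplus>\<^bsub>M s\<^esub> H s),
     smult = (\<lambda>c G s. c \<odot>\<^bsub>M s\<^esub> G s)\<rparr>"

text \<open>\<open>PBW_filt n m v s\<close> is \<open>U\<^sup>s v\<close>, where \<open>U\<^sup>s\<close> is the span of the products of at most \<open>s\<close> elements
  of the Lie algebra \<open>n_tilde_minus n\<close> in its enveloping algebra; \<open>PBW_filt_pred n m v s\<close> is the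
  step with number \<open>s - 1\<close>, which is 0 for \<open>s = 0\<close>.\<close>

definition PBW_filt :: "nat \<Rightarrow> (nat \<Rightarrow> nat) \<Rightarrow> tensor \<Rightarrow> nat \<Rightarrow> tensor set" where
  "PBW_filt n m v s = LinearCombinations.module.span class_ring (lambda_tensors n m)
     {foldr (lie_act (odd_dim n)) Xs v | Xs. length Xs \<le> s \<and> set Xs \<subseteq> n_tilde_minus n}"

fun PBW_filt_pred :: "nat \<Rightarrow> (nat \<Rightarrow> nat) \<Rightarrow> tensor \<Rightarrow> nat \<Rightarrow> tensor set" where
  "PBW_filt_pred n m v 0 = {\<zero>\<^bsub>lambda_tensors n m\<^esub>}"
| "PBW_filt_pred n m v (Suc s) = PBW_filt n m v s"

definition gr_rep :: "nat \<Rightarrow> (nat \<Rightarrow> nat) \<Rightarrow> tensor \<Rightarrow> (complex, nat \<Rightarrow> tensor set) module" where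
  "gr_rep n m v = direct_sum_seq (\<lambda>s. quotient_space
     ((lambda_tensors n m)\<lparr>carrier := PBW_filt n m v s\<rparr>) (PBW_filt_pred n m v s))"

text \<open>The class of \<open>v\<close> in degree 0.\<close>

definition gr_vector :: "nat \<Rightarrow> (nat \<Rightarrow> nat) \<Rightarrow> tensor \<Rightarrow> nat \<Rightarrow> tensor set" where
  "gr_vector n m v = (\<lambda>s. if s = 0 then a_r_coset (lambda_tensors n m) (PBW_filt_pred n m v 0) v
     else PBW_filt_pred n m v s)"

text \<open>The action on the graded space of a degree 1 generator \<open>X\<close> of the symmetric algebra: the
  class of \<open>x\<close> in degree \<open>s\<close> is sent to the class of \<open>X x\<close> in degree \<open>s + 1\<close>.\<close>

definition gr_act :: "nat \<Rightarrow> (nat \<Rightarrow> nat) \<Rightarrow> tensor \<Rightarrow> complex mat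
    \<Rightarrow> (nat \<Rightarrow> tensor set) \<Rightarrow> nat \<Rightarrow> tensor set" where
  "gr_act n m v X G = (\<lambda>s. case s of 0 \<Rightarrow> PBW_filt_pred n m v 0
     | Suc r \<Rightarrow> \<Union>x \<in> G r. a_r_coset (lambda_tensors n m) (PBW_filt_pred n m v s)
         (lie_act (odd_dim n) X x))"

text \<open>The action of the monomial \<open>\<Prod>\<^sub>\<alpha> f\<^sub>\<alpha>\<^bsup>s(\<alpha>)\<^esup>\<close>, factors in the order of the list, given the
  action of the single elements.\<close>

definition monomial_act :: "(complex mat \<Rightarrow> 'v \<Rightarrow> 'v) \<Rightarrow> (root \<Rightarrow> complex mat) \<Rightarrow> root list
    \<Rightarrow> (root \<Rightarrow> nat) \<Rightarrow> 'v \<Rightarrow> 'v" where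
  "monomial_act act f rs s = foldr (\<lambda>\<alpha>. act (f \<alpha>) ^^ s \<alpha>) rs"


section \<open>The polytope\<close>

inductive arrow :: "nat \<Rightarrow> root \<Rightarrow> root \<Rightarrow> bool" for n where
  "1 \<le> i \<Longrightarrow> i \<le> j \<Longrightarrow> j < n \<Longrightarrow> arrow n (Rt i j) (Rt i (j + 1))"
| "1 \<le> i \<Longrightarrow> i \<le> n \<Longrightarrow> arrow n (Rt i n) (Rtb i n)"
| "1 \<le> i \<Longrightarrow> i \<le> j \<Longrightarrow> j < n \<Longrightarrow> arrow n (Rtb i (j + 1)) (Rtb i j)"
| "1 \<le> i \<Longrightarrow> i + 1 \<le> j \<Longrightarrow> j \<le> n \<Longrightarrow> arrow n (Rt i j) (Rt (i + 1) j)"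
| "1 \<le> i \<Longrightarrow> i + 1 \<le> j \<Longrightarrow> j \<le> n \<Longrightarrow> arrow n (Rtb i j) (Rtb (i + 1) j)"

definition dyck_path :: "nat \<Rightarrow> root list \<Rightarrow> bool" where
  "dyck_path n p \<longleftrightarrow> p \<noteq> [] \<and> set p \<subseteq> poset n \<and> successively (arrow n) p \<and>
     (\<exists>i j. i \<le> j \<and> hd p = Rt i i \<and> (last p = Rt j j \<or> last p = Rtb j j))"

definition FFLV :: "nat \<Rightarrow> (nat \<Rightarrow> nat) \<Rightarrow> (root \<Rightarrow> real) set" where
  "FFLV n m = {s. (\<forall>\<alpha>. 0 \<le> s \<alpha>) \<and> (\<forall>\<alpha>. \<alpha> \<notin> poset n \<longrightarrow> s \<alpha> = 0) \<and>
     (\<forall>p i j. dyck_path n p \<and> hd p = Rt i i \<longrightarrow>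
        (last p = Rt j j \<longrightarrow> (\<Sum>\<alpha> \<in> set p. s \<alpha>) \<le> real (\<Sum>l = i..j. m l)) \<and>
        (last p = Rtb j j \<longrightarrow> (\<Sum>\<alpha> \<in> set p. s \<alpha>) \<le> real (\<Sum>l = i..n. m l)))}"

definition FFLV_int :: "nat \<Rightarrow> (nat \<Rightarrow> nat) \<Rightarrow> (root \<Rightarrow> nat) set" where
  "FFLV_int n m = {s. (\<lambda>\<alpha>. real (s \<alpha>)) \<in> FFLV n m}"

text \<open>The vectors \<open>b x\<close>, \<open>x \<in> I\<close>, are pairwise distinct and form a basis.\<close>

definition basis_family :: "(complex, 'a) module \<Rightarrow> 'i set \<Rightarrow> ('i \<Rightarrow> 'a) \<Rightarrow> bool" where
  "basis_family M I b \<longleftrightarrow> vectorspace class_ring M \<and> inj_on b I \<and>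
     vectorspace.basis class_ring M (b ` I)"

end

theory Submission
  imports Defs
begin

text \<open>
  Let \<open>v\<close> be the highest weight vector, the product over the columns of the diagram of
  \<open>e\<^sub>1 \<and> \<dots> \<and> e\<^sub>l\<close>.

  Independence. The integral points of the polytope correspond to Gelfand-Tsetlin patterns \<open>X\<close>, and the
  level sets of \<open>X\<close> split a point into antichains, one for each column. Replacing in every column the
  letters \<open>i\<close> that occur in the antichain gives a word. A product of \<open>d\<close> elements of the Lie algebra
  changes at most \<open>d\<close> letters of \<open>v\<close>, so the coordinates with exactly \<open>d\<close> changed letters vanish on
  lower filtration steps, and on them the order of the factors does not matter. For the weight
  \<open>i (k + 1 - i)\<close> of the root in row \<open>i\<close> and level \<open>k\<close>, which depends only on the two letters exchanged by
  the root, the rearrangement inequality shows that the matrix between monomials and words is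
  triangular.

  Spanning. A trace-free tensor in the image of the Young symmetrizer is determined by its coordinates
  at King's symplectic tableaux: Garnir relations and contractions inside one column express all other
  coordinates through these. King's tableaux are again Gelfand-Tsetlin patterns, so the
  dimension is at most the number of integral points. Applied to the elements of a filtration
  step, the independence also gives the graded statement.
\<close>

section \<open>Positions, boxes and fillings\<close>

text \<open>One root vector moves letters in two ways: the one with index \<open>i, j-bar\<close>
  sends i to n + j and also j to n + i. A leading term order must not depend on which of the two was
  used. The weight i (k + 1 - i) equals i j there, which is symmetric, and for every root it is the
  product of the source letter and a number attached to the target letter. In the word of a pattern
  these numbers increase down each column, so any other distribution of the sources within the
  columns has smaller total weight.

  Spanning never rewrites monomials. King's tableaux are only injected into the integral points; the
  reverse inequality, and the finiteness of the set of points, come from the independence.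

  Independence carries a threshold e: vanishing at the words with at least e changed letters kills
  the coefficients of degree at least e. The thresholds 0, d + 1 and d give the basis, the absence
  of monomials of degree above d in the elements of step d, and the independence in the quotient of
  degree d.\<close>

locale diagram =
  fixes n :: nat and m :: "nat \<Rightarrow> nat"
begin

abbreviation (input) invf :: "(nat \<Rightarrow> nat) \<Rightarrow> nat \<Rightarrow> nat" where "invf \<equiv> inv_into UNIV"
abbreviation (input) swap :: "nat \<Rightarrow> nat \<Rightarrow> nat \<Rightarrow> nat" where "swap \<equiv> Transposition.transpose"
abbreviation K where "K \<equiv> part_size n m"

text \<open>Not an abbreviation, because the simplifier splits sums over \<open>{..<2 * n + 1}\<close>.\<close>

definition N where "N = 2 * n + 1"

abbreviation L where "L \<equiv> tensor_space N K"
abbreviation lam where "lam \<equiv> part n m"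

definition row :: "nat \<Rightarrow> nat" where "row p = fst (boxes n m ! p)"
definition col :: "nat \<Rightarrow> nat" where "col p = snd (boxes n m ! p)"

lemma lam_antimono: "i \<le> j \<Longrightarrow> lam j \<le> lam i"
  unfolding part_def by (rule sum_mono2) auto

lemma lam_beyond: "i > n \<Longrightarrow> lam i = 0"
  by (simp add: part_def)

lemma length_boxes: "length (boxes n m) = K"
proof -
  have "length (boxes n m) = sum_list (map lam [1..<n + 1])"
    by (simp add: boxes_def length_concat comp_def)
  also have "\<dots> = sum lam {1..<n + 1}"
    by (metis interv_sum_list_conv_sum_set_nat set_upt)
  finally show ?thesis
    by (simp add: part_size_def atLeastLessThanSuc_atLeastAtMost)
qed

lemma set_boxes: "set (boxes n m) = {(i, c). 1 \<le> i \<and> i \<le> n \<and> c < lam i}"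
  by (auto simp: boxes_def)

lemma distinct_boxes: "distinct (boxes n m)"
proof -
  have "distinct (concat (map (\<lambda>i. map (Pair i) [0..<lam i]) xs))" if "distinct xs" for xs :: "nat list"
    using that by (induction xs) (auto simp: distinct_map inj_on_def)
  then show ?thesis by (simp add: boxes_def)
qed

lemma box_nth: "p < K \<Longrightarrow> boxes n m ! p = (row p, col p)"
  by (simp add: row_def col_def)

lemma box_bounds:
  assumes "p < K"
  shows "1 \<le> row p" "row p \<le> n" "col p < lam (row p)"
proof -
  have "(row p, col p) \<in> set (boxes n m)"
    using assms length_boxes box_nth nth_mem by metis
  then show "1 \<le> row p" "row p \<le> n" "col p < lam (row p)" by (auto simp: set_boxes)
qed

lemma box_inj:
  assumes "p < K" "q < K" "row p = row q" "col p = col q"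
  shows "p = q"
  using assms distinct_boxes by (metis box_nth length_boxes nth_eq_iff_index_eq)

definition pos :: "nat \<Rightarrow> nat \<Rightarrow> nat" where
  "pos i c = (THE p. p < K \<and> row p = i \<and> col p = c)"

lemma pos:
  assumes "1 \<le> i" "c < lam i"
  shows "pos i c < K" "row (pos i c) = i" "col (pos i c) = c"
proof -
  have "i \<le> n" using assms(2) lam_beyond[of i] by (cases "i \<le> n") auto
  then have "(i, c) \<in> set (boxes n m)" using assms by (auto simp: set_boxes)
  then obtain p where "p < K" "boxes n m ! p = (i, c)"
    by (metis in_set_conv_nth length_boxes)
  then have "p < K \<and> row p = i \<and> col p = c" by (simp add: row_def col_def)
  then have "pos i c < K \<and> row (pos i c) = i \<and> col (pos i c) = c"
    unfolding pos_def by (rule theI) (auto intro: box_inj simp: \<open>p < K \<and> row p = i \<and> col p = c\<close>)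
  then show "pos i c < K" "row (pos i c) = i" "col (pos i c) = c" by auto
qed

lemma pos_row_col: "p < K \<Longrightarrow> pos (row p) (col p) = p"
  using pos[OF box_bounds(1,3)] box_inj by blast

lemma col_lt_lam: "p < K \<Longrightarrow> 1 \<le> i \<Longrightarrow> i \<le> row p \<Longrightarrow> col p < lam i"
  using box_bounds(3)[of p] lam_antimono[of i "row p"] by linarith

text \<open>Words are written as functions on positions, so that changing a letter is a function
  update and permuting positions is a composition; values outside \<open>{..<K}\<close> are
  irrelevant (\<open>fill_cong\<close>).\<close>

definition fill :: "(nat \<Rightarrow> nat) \<Rightarrow> nat list" where
  "fill x = map x [0..<K]"

lemma length_fill [simp]: "length (fill x) = K"
  by (simp add: fill_def)

lemma nth_fill [simp]: "p < K \<Longrightarrow> fill x ! p = x p"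
  by (simp add: fill_def)

lemma set_fill [simp]: "set (fill x) = x ` {..<K}"
  by (simp add: fill_def atLeast0LessThan)

lemma fill_nth: "length w = K \<Longrightarrow> fill ((!) w) = w"
  by (auto intro: nth_equalityI)

lemma fill_cong: "(\<And>p. p < K \<Longrightarrow> x p = y p) \<Longrightarrow> fill x = fill y"
  by (auto simp: fill_def)

lemma fill_update: "p < K \<Longrightarrow> (fill x)[p := a] = fill (x(p := a))"
  by (auto intro!: nth_equalityI simp: nth_list_update)

lemma permutes_below: "\<sigma> permutes {..<K} \<Longrightarrow> p < K \<Longrightarrow> \<sigma> p < K"
  using permutes_in_image[of \<sigma> "{..<K}" p] by simp

lemma permute_fill: "\<sigma> permutes {..<K} \<Longrightarrow> permute_list \<sigma> (fill x) = fill (x \<circ> \<sigma>)"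
  by (auto intro!: nth_equalityI simp: permute_list_nth permutes_below)

section \<open>The Young symmetrizer\<close>

text \<open>Row group and column group both consist of the permutations preserving a label of the
  positions, so the group theory is done once for an arbitrary label.\<close>

definition label_group :: "(nat \<Rightarrow> nat) \<Rightarrow> (nat \<Rightarrow> nat) set" where
  "label_group h = {\<sigma>. \<sigma> permutes {..<K} \<and> (\<forall>p < K. h (\<sigma> p) = h p)}"

lemma row_group_label: "row_group n m = label_group row"
  by (simp add: row_group_def label_group_def row_def)

lemma column_group_label: "column_group n m = label_group col"
  by (simp add: column_group_def label_group_def col_def)

lemma label_groupD: 
  assumes "\<sigma> \<in> label_group h"
  shows "\<sigma> permutes {..<K}" "p < K \<Longrightarrow> h (\<sigma> p) = h p" "p < K \<Longrightarrow> \<sigma> p < K"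
  using assms permutes_in_image[of \<sigma> "{..<K}" p] by (auto simp: label_group_def)

lemma finite_label_group: "finite (label_group h)"
  by (rule finite_subset[OF _ finite_permutations[of "{..<K}"]]) (auto simp: label_group_def)

lemma label_group_comp: "\<sigma> \<in> label_group h \<Longrightarrow> \<tau> \<in> label_group h \<Longrightarrow> \<sigma> \<circ> \<tau> \<in> label_group h"
  using permutes_compose[of \<tau> "{..<K}" \<sigma>]
  by (auto simp: label_group_def permutes_below)

lemma label_group_inv: 
  assumes "\<sigma> \<in> label_group h" shows "invf \<sigma> \<in> label_group h"
proof -
  have s: "\<sigma> permutes {..<K}" using assms by (simp add: label_group_def)
  have i: "invf \<sigma> permutes {..<K}" by (rule permutes_inv[OF s])
  have "h (invf \<sigma> p) = h p" if "p < K" for p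
  proof -
    have "invf \<sigma> p < K" using permutes_in_image[OF i, of p] that by simp
    then have "h (\<sigma> (invf \<sigma> p)) = h (invf \<sigma> p)" using assms by (simp add: label_group_def)
    then show ?thesis using permutes_inverses(1)[OF s] by simp
  qed
  then show ?thesis using i by (simp add: label_group_def)
qed

lemma label_group_inv_bij: "bij_betw invf (label_group h) (label_group h)"
  by (rule bij_betw_byWitness[of _ invf])
    (auto simp: label_group_inv permutes_inv_inv[OF label_groupD(1)])

lemma label_group_comp_left_bij:
  assumes "\<tau> \<in> label_group h"
  shows "bij_betw (\<lambda>\<sigma>. \<tau> \<circ> \<sigma>) (label_group h) (label_group h)"
  by (rule bij_betw_byWitness[of _ "\<lambda>\<sigma>. invf \<tau> \<circ> \<sigma>"])
    (auto simp: label_group_inv label_group_comp assms fun_eq_iff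
       permutes_inverses[OF label_groupD(1)[OF assms]])

lemma label_group_transpose:
  assumes "p < K" "q < K" "h p = h q" shows "swap p q \<in> label_group h"
  using assms by (auto simp: label_group_def Transposition.transpose_def intro!: permutes_swap_id)

lemma permutation_lessThan: "\<sigma> permutes {..<K} \<Longrightarrow> permutation \<sigma>"
  by (metis finite_lessThan permutation_permutes)

lemma sign_label: 
  "\<sigma> \<in> label_group h \<Longrightarrow> \<tau> \<in> label_group h' \<Longrightarrow> sign (\<sigma> \<circ> \<tau>) = sign \<sigma> * sign \<tau>"
  "\<sigma> \<in> label_group h \<Longrightarrow> sign (invf \<sigma>) = sign \<sigma>"
  by (auto intro!: sign_compose sign_inverse permutation_lessThan dest: label_groupD(1))

text \<open>Here \<open>u\<close> is \<open>t\<close> summed over the row group. An image of the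
  Young symmetrizer enters all later relations only as the column antisymmetrization of a
  row-symmetric function. The inverses coming from \<open>perm_act\<close> disappear by reindexing
  both groups.\<close>

lemma young_row_column:
  "\<exists>u. (\<forall>x. \<forall>\<rho> \<in> label_group row. u (x \<circ> \<rho>) = u x) \<and>
       (\<forall>x. young_symmetrizer n m t (fill x) = (\<Sum>\<tau> \<in> label_group col. of_int (sign \<tau>) * u (x \<circ> \<tau>)))"
proof -
  define u where "u = (\<lambda>x. \<Sum>\<sigma> \<in> label_group row. t (fill (x \<circ> \<sigma>)))"
  have "u (x \<circ> \<rho>) = u x" if "\<rho> \<in> label_group row" for x \<rho>
    unfolding u_def
    using sum.reindex_bij_betw[OF label_group_comp_left_bij[OF that], of "\<lambda>\<sigma>. t (fill (x \<circ> \<sigma>))"]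
    by (simp add: comp_assoc)
  moreover have "young_symmetrizer n m t (fill x) = (\<Sum>\<tau> \<in> label_group col. of_int (sign \<tau>) * u (x \<circ> \<tau>))" for x
  proof -
    have perm: "perm_act (\<sigma> \<circ> \<tau>) t (fill x) = t (fill (x \<circ> invf \<tau> \<circ> invf \<sigma>))"
      if "\<sigma> \<in> label_group row" "\<tau> \<in> label_group col" for \<sigma> \<tau>
    proof -
      have p: "\<sigma> permutes {..<K}" "\<tau> permutes {..<K}" using that by (auto dest: label_groupD(1))
      have "invf (\<sigma> \<circ> \<tau>) = invf \<tau> \<circ> invf \<sigma>"
        using p by (intro o_inv_distrib permutes_bij)
      moreover have "invf \<tau> \<circ> invf \<sigma> permutes {..<K}"
        using p by (intro permutes_compose permutes_inv)
      ultimately show ?thesis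
        by (simp add: perm_act_def permute_fill comp_assoc)
    qed
    have "young_symmetrizer n m t (fill x) =
       (\<Sum>\<sigma> \<in> label_group row. \<Sum>\<tau> \<in> label_group col. of_int (sign \<tau>) * t (fill (x \<circ> invf \<tau> \<circ> invf \<sigma>)))"
      by (simp add: young_symmetrizer_def row_group_label column_group_label perm)
    also have "\<dots> = (\<Sum>\<tau> \<in> label_group col. \<Sum>\<sigma> \<in> label_group row. of_int (sign \<tau>) * t (fill (x \<circ> invf \<tau> \<circ> invf \<sigma>)))"
      by (rule sum.swap)
    also have "\<dots> = (\<Sum>\<tau> \<in> label_group col. of_int (sign \<tau>) * u (x \<circ> invf \<tau>))"
    proof (rule sum.cong[OF refl])
      fix \<tau>
      show "(\<Sum>\<sigma> \<in> label_group row. of_int (sign \<tau>) * t (fill (x \<circ> invf \<tau> \<circ> invf \<sigma>))) = of_int (sign \<tau>) * u (x \<circ> invf \<tau>)"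
        using sum.reindex_bij_betw[OF label_group_inv_bij[of row], where g = "\<lambda>\<sigma>. t (fill (x \<circ> invf \<tau> \<circ> \<sigma>))"]
        by (simp add: u_def sum_distrib_left[symmetric])
    qed
    also have "\<dots> = (\<Sum>\<tau> \<in> label_group col. of_int (sign (invf \<tau>)) * u (x \<circ> invf \<tau>))"
      by (intro sum.cong refl) (simp add: sign_label)
    also have "\<dots> = (\<Sum>\<tau> \<in> label_group col. of_int (sign \<tau>) * u (x \<circ> \<tau>))"
      by (rule sum.reindex_bij_betw[OF label_group_inv_bij])
    finally show ?thesis .
  qed
  ultimately show ?thesis by blast
qed

lemma GL_rep_row_column:
  assumes "t \<in> GL_rep n m"
  shows "\<exists>u. (\<forall>x. \<forall>\<rho> \<in> label_group row. u (x \<circ> \<rho>) = u x) \<and>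
       (\<forall>x. t (fill x) = (\<Sum>\<tau> \<in> label_group col. of_int (sign \<tau>) * u (x \<circ> \<tau>)))"
  using assms young_row_column unfolding GL_rep_def by blast

lemma GL_rep_column_sign:
  assumes "t \<in> GL_rep n m" "\<pi> \<in> label_group col"
  shows "t (fill (x \<circ> \<pi>)) = of_int (sign \<pi>) * t (fill x)"
proof -
  obtain u where u: "\<And>x. t (fill x) = (\<Sum>\<tau> \<in> label_group col. of_int (sign \<tau>) * u (x \<circ> \<tau>))"
    using GL_rep_row_column[OF assms(1)] by blast
  have "of_int (sign \<pi>) * t (fill (x \<circ> \<pi>)) = (\<Sum>\<tau> \<in> label_group col. of_int (sign (\<pi> \<circ> \<tau>)) * u (x \<circ> (\<pi> \<circ> \<tau>)))"
    by (simp add: u sum_distrib_left comp_assoc sign_label[OF assms(2)] mult.assoc)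
  also have "\<dots> = t (fill x)"
    unfolding u by (rule sum.reindex_bij_betw[OF label_group_comp_left_bij[OF assms(2)]])
  finally have "of_int (sign \<pi>) * (of_int (sign \<pi>) * t (fill (x \<circ> \<pi>))) = of_int (sign \<pi>) * t (fill x)" by simp
  then show ?thesis by (simp add: mult.assoc[symmetric] flip: of_int_mult)
qed

lemma GL_rep_swap:
  assumes "t \<in> GL_rep n m" "p < K" "q < K" "p \<noteq> q" "col p = col q"
  shows "t (fill (x \<circ> swap p q)) = - t (fill x)"
  using GL_rep_column_sign[OF assms(1) label_group_transpose[OF assms(2,3,5)]] assms(4)
  by (simp add: sign_swap_id)

lemma GL_rep_repeat:
  assumes "t \<in> GL_rep n m" "p < K" "q < K" "p \<noteq> q" "col p = col q" "x p = x q"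
  shows "t (fill x) = 0"
proof -
  have "x \<circ> swap p q = x"
    using assms(6) by (auto simp: Transposition.transpose_def fun_eq_iff)
  then show ?thesis using GL_rep_swap[OF assms(1-5), of x] by simp
qed

text \<open>For every \<open>\<tau>\<close> in the column group, two elements of \<open>X\<close> come from the same row of \<open>\<tau>\<close>, so the
  transposition of these two cancels the terms of the sum in pairs.\<close>

lemma GL_rep_garnir:
  assumes "t \<in> GL_rep n m" "X \<subseteq> {..<K}"
    and rows: "\<And>\<tau>. \<tau> \<in> label_group col \<Longrightarrow> \<exists>a \<in> X. \<exists>b \<in> X. a \<noteq> b \<and> row (\<tau> a) = row (\<tau> b)"
  shows "(\<Sum>g | g permutes X. of_int (sign g) * t (fill (x \<circ> g))) = 0"
proof -
  obtain u where row: "\<And>x \<rho>. \<rho> \<in> label_group row \<Longrightarrow> u (x \<circ> \<rho>) = u x"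
    and u: "\<And>x. t (fill x) = (\<Sum>\<tau> \<in> label_group col. of_int (sign \<tau>) * u (x \<circ> \<tau>))"
    using GL_rep_row_column[OF assms(1)] by blast
  have fin: "finite X" using assms(2) finite_subset by blast
  have zero: "(\<Sum>g | g permutes X. of_int (sign g) * u (x \<circ> g \<circ> \<tau>)) = 0" (is "?S = 0")
    if tau: "\<tau> \<in> label_group col" for \<tau>
  proof -
    have p: "\<tau> permutes {..<K}" using tau by (rule label_groupD(1))
    obtain a b where ab: "a \<in> X" "b \<in> X" "a \<noteq> b" "row (invf \<tau> a) = row (invf \<tau> b)"
      using rows[OF label_group_inv[OF tau]] by blast
    define \<rho> where "\<rho> = swap (invf \<tau> a) (invf \<tau> b)"
    have "invf \<tau> a < K" "invf \<tau> b < K"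
      using ab assms(2) label_groupD(3)[OF label_group_inv[OF tau]] by blast+
    then have \<rho>: "\<rho> \<in> label_group row"
      unfolding \<rho>_def by (rule label_group_transpose) (rule ab)
    \<comment> \<open>A transposition of \<open>a\<close> and \<open>b\<close> on the left of
      \<open>\<tau>\<close> is a row transposition on its right, and \<open>u\<close> does not see
      the latter.\<close>
    have conj: "swap a b \<circ> \<tau> = \<tau> \<circ> \<rho>"
    proof
      fix y
      have "\<tau> y = a \<longleftrightarrow> y = invf \<tau> a" "\<tau> y = b \<longleftrightarrow> y = invf \<tau> b"
        using permutes_inverses[OF p] by metis+
      then show "(swap a b \<circ> \<tau>) y = (\<tau> \<circ> \<rho>) y"
        using permutes_inverses(1)[OF p] by (auto simp: \<rho>_def Transposition.transpose_def)
    qed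
    have "?S = (\<Sum>g | g permutes X. of_int (sign (g \<circ> swap a b)) * u (x \<circ> (g \<circ> swap a b) \<circ> \<tau>))"
      using sum_permutations_compose_right[OF permutes_swap_id[OF ab(1,2)]] by simp
    also have "\<dots> = (\<Sum>g | g permutes X. - (of_int (sign g) * u (x \<circ> g \<circ> \<tau>)))"
    proof (rule sum.cong[OF refl])
      fix g assume "g \<in> {g. g permutes X}"
      then have "permutation g" using fin permutation_permutes by auto
      then have "sign (g \<circ> swap a b) = - sign g"
        using ab by (simp add: sign_compose permutation_swap_id sign_swap_id)
      moreover have "u (x \<circ> (g \<circ> swap a b) \<circ> \<tau>) = u (x \<circ> g \<circ> \<tau>)"
        using row[OF \<rho>, of "x \<circ> g \<circ> \<tau>"] conj by (simp add: comp_assoc)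
      ultimately show "of_int (sign (g \<circ> swap a b)) * u (x \<circ> (g \<circ> swap a b) \<circ> \<tau>)
          = - (of_int (sign g) * u (x \<circ> g \<circ> \<tau>))" by simp
    qed
    finally have "?S = - ?S" by (simp add: sum_negf)
    then show ?thesis by simp
  qed
  have "(\<Sum>g | g permutes X. of_int (sign g) * t (fill (x \<circ> g))) =
    (\<Sum>g | g permutes X. \<Sum>\<tau> \<in> label_group col. of_int (sign \<tau>) * (of_int (sign g) * u (x \<circ> g \<circ> \<tau>)))"
    by (simp add: u sum_distrib_left mult.left_commute)
  also have "\<dots> = (\<Sum>\<tau> \<in> label_group col. of_int (sign \<tau>) * (\<Sum>g | g permutes X. of_int (sign g) * u (x \<circ> g \<circ> \<tau>)))"
    by (subst sum.swap) (simp add: sum_distrib_left)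
  also have "\<dots> = 0" by (simp add: zero)
  finally show ?thesis .
qed

section \<open>The Lie algebra action and the contractions\<close>

abbreviation lie where "lie \<equiv> lie_act N"

lemma lie_act_add: "lie X (\<lambda>w. s w + t w) = (\<lambda>w. lie X s w + lie X t w)"
  by (auto simp: lie_act_def fun_eq_iff sum.distrib distrib_left)

lemma lie_act_scale: "lie X (\<lambda>w. c * t w) = (\<lambda>w. c * lie X t w)"
  by (auto simp: lie_act_def fun_eq_iff sum_distrib_left mult.left_commute)

lemma lie_act_zero: "lie X (\<lambda>w. 0) = (\<lambda>w. 0)"
  by (simp add: lie_act_def fun_eq_iff)

lemma lie_act_sum: "lie X (\<lambda>w. \<Sum>i \<in> I. c i * t i w) = (\<lambda>w. \<Sum>i \<in> I. c i * lie X (t i) w)"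
  by (induction I rule: infinite_finite_induct) (simp_all add: lie_act_zero lie_act_add lie_act_scale)

definition letters :: "(nat \<Rightarrow> nat) \<Rightarrow> bool" where
  "letters x \<longleftrightarrow> (\<forall>p < K. x p < N)"

lemma letters_upd [simp]: "letters x \<Longrightarrow> a < N \<Longrightarrow> letters (x(p := a))"
  by (simp add: letters_def)

lemma letters_perm: "\<sigma> permutes {..<K} \<Longrightarrow> letters (x \<circ> \<sigma>) \<longleftrightarrow> letters x"
proof -
  assume s: "\<sigma> permutes {..<K}"
  have "(\<forall>p \<in> \<sigma> ` {..<K}. x p < N) \<longleftrightarrow> (\<forall>p < K. x p < N)"
    unfolding permutes_image[OF s] by auto
  then show ?thesis by (auto simp: letters_def)
qed

lemma fill_words: "fill x \<in> words N K \<longleftrightarrow> letters x"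
  by (auto simp: words_def letters_def)

lemma words_fill: "w \<in> words N K \<Longrightarrow> \<exists>x. letters x \<and> w = fill x"
  by (rule exI[of _ "(!) w"]) (auto simp: words_def letters_def fill_nth subset_iff)

lemma lie_fill:
  assumes "letters x"
  shows "lie X t (fill x) = (\<Sum>p<K. \<Sum>a<N. X $$ (x p, a) * t (fill (x(p := a))))"
proof -
  have "set (fill x) \<subseteq> {..<N}" using assms by (auto simp: letters_def)
  then show ?thesis by (simp add: lie_act_def fill_update)
qed

lemma lie_act_carrier: "t \<in> carrier (L) \<Longrightarrow> lie X t \<in> carrier (L)"
proof -
  assume t: "t \<in> carrier (L)"
  have "lie X t w = 0" if "w \<notin> words N K" for w
  proof (cases "set w \<subseteq> {..<N}")
    case True
    then have "w[p := a] \<notin> words N K" for p a using that by (auto simp: words_def)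
    then have "t (w[p := a]) = 0" for p a using t by (simp add: tensor_space_def)
    then show ?thesis by (simp add: lie_act_def)
  qed (simp add: lie_act_def)
  then show ?thesis by (simp add: tensor_space_def)
qed

lemma tensor_eqI:
  assumes "s \<in> carrier (L)" "t \<in> carrier (L)"
    and "\<And>x. letters x \<Longrightarrow> s (fill x) = t (fill x)"
  shows "s = t"
proof
  fix w show "s w = t w"
  proof (cases "w \<in> words N K")
    case True
    then show ?thesis using words_fill[OF True] assms(3) by auto
  qed (use assms(1,2) in \<open>simp add: tensor_space_def\<close>)
qed

lemma perm_act_fill: "\<sigma> permutes {..<K} \<Longrightarrow> perm_act \<sigma> t (fill x) = t (fill (x \<circ> invf \<sigma>))"
  by (simp add: perm_act_def permute_fill permutes_inv)

lemma perm_act_carrier: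
  assumes "\<sigma> permutes {..<K}" "t \<in> carrier (L)"
  shows "perm_act \<sigma> t \<in> carrier (L)"
proof -
  have "t (permute_list (invf \<sigma>) w) = 0" if "w \<notin> words N K" for w
  proof (cases "length w = K")
    case True
    then have "w = fill ((!) w)" by (simp add: fill_nth)
    then have "\<not> letters ((!) w)" using that fill_words by metis
    then have "\<not> letters ((!) w \<circ> invf \<sigma>)" using letters_perm[OF permutes_inv[OF assms(1)]] by simp
    then have "fill ((!) w \<circ> invf \<sigma>) \<notin> words N K" by (simp add: fill_words)
    then have "t (fill ((!) w \<circ> invf \<sigma>)) = 0" using assms(2) by (simp add: tensor_space_def)
    then show ?thesis using \<open>w = fill ((!) w)\<close> permute_fill[OF permutes_inv[OF assms(1)]] by metis
  next
    case False
    then have "permute_list (invf \<sigma>) w \<notin> words N K" by (auto simp: words_def)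
    then show ?thesis using assms(2) by (simp add: tensor_space_def)
  qed
  then show ?thesis by (simp add: tensor_space_def perm_act_def)
qed

text \<open>\<open>X\<close> acts in the same way at every position, so permuting the positions only
  reorders the sum over positions.\<close>

lemma lie_perm_act:
  assumes "\<sigma> permutes {..<K}" "t \<in> carrier (L)"
  shows "lie X (perm_act \<sigma> t) = perm_act \<sigma> (lie X t)"
proof (rule tensor_eqI)
  show "lie X (perm_act \<sigma> t) \<in> carrier (L)" "perm_act \<sigma> (lie X t) \<in> carrier (L)"
    using assms by (auto intro: lie_act_carrier perm_act_carrier)
  fix x assume x: "letters x"
  define \<tau> where "\<tau> = invf \<sigma>"
  have \<tau>: "\<tau> permutes {..<K}" using assms(1) by (simp add: \<tau>_def permutes_inv)
  have upd: "(x(\<tau> p := a)) \<circ> \<tau> = (x \<circ> \<tau>)(p := a)" for p a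
    using permutes_inj[OF \<tau>] by (auto simp: fun_eq_iff inj_def)
  have "perm_act \<sigma> (lie X t) (fill x) = lie X t (fill (x \<circ> \<tau>))"
    using perm_act_fill[OF assms(1)] by (simp add: \<tau>_def)
  also have "\<dots> = (\<Sum>p<K. \<Sum>a<N. X $$ (x (\<tau> p), a) * t (fill (x(\<tau> p := a) \<circ> \<tau>)))"
    using x \<tau> by (subst lie_fill) (auto simp: letters_perm upd)
  also have "\<dots> = (\<Sum>p<K. \<Sum>a<N. X $$ (x p, a) * t (fill (x(p := a) \<circ> \<tau>)))"
    by (rule sum.reindex_bij_betw[OF permutes_imp_bij[OF \<tau>]])
  also have "\<dots> = (\<Sum>p<K. \<Sum>a<N. X $$ (x p, a) * perm_act \<sigma> t (fill (x(p := a))))"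
    using perm_act_fill[OF assms(1)] by (simp add: \<tau>_def)
  also have "\<dots> = lie X (perm_act \<sigma> t) (fill x)"
    using x by (simp add: lie_fill)
  finally show "lie X (perm_act \<sigma> t) (fill x) = perm_act \<sigma> (lie X t) (fill x)" by simp
qed

lemma row_column_permutes: "\<sigma> \<in> row_group n m \<Longrightarrow> \<tau> \<in> column_group n m \<Longrightarrow> \<sigma> \<circ> \<tau> permutes {..<K}"
  unfolding row_group_label column_group_label by (intro permutes_compose label_groupD(1))

lemma young_carrier:
  assumes "t \<in> carrier (L)"
  shows "young_symmetrizer n m t \<in> carrier (L)"
proof -
  have "perm_act (\<sigma> \<circ> \<tau>) t w = 0"
    if "\<sigma> \<in> row_group n m" "\<tau> \<in> column_group n m" "w \<notin> words N K" for \<sigma> \<tau> w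
    using perm_act_carrier[OF row_column_permutes[OF that(1,2)] assms] that(3)
    by (simp add: tensor_space_def)
  then show ?thesis by (simp add: tensor_space_def young_symmetrizer_def)
qed

lemma lie_young:
  assumes "t \<in> carrier (L)"
  shows "lie X (young_symmetrizer n m t) = young_symmetrizer n m (lie X t)"
proof -
  have "lie X (young_symmetrizer n m t) =
    (\<lambda>w. \<Sum>\<sigma> \<in> row_group n m. lie X (\<lambda>w. \<Sum>\<tau> \<in> column_group n m. of_int (sign \<tau>) * perm_act (\<sigma> \<circ> \<tau>) t w) w)"
    using lie_act_sum[where I = "row_group n m" and c = "\<lambda>_. 1"] by (simp add: young_symmetrizer_def)
  also have "\<dots> = young_symmetrizer n m (lie X t)"
    by (auto simp: young_symmetrizer_def lie_act_sum lie_perm_act[OF row_column_permutes assms])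
  finally show ?thesis .
qed

lemma GL_rep_carrier: "t \<in> GL_rep n m \<Longrightarrow> t \<in> carrier (L)"
  using young_carrier by (auto simp: GL_rep_def N_def)

lemma GL_rep_lie: "t \<in> GL_rep n m \<Longrightarrow> lie X t \<in> GL_rep n m"
proof -
  assume "t \<in> GL_rep n m"
  then obtain t' where "t = young_symmetrizer n m t'" "t' \<in> carrier L"
    unfolding GL_rep_def N_def by blast
  then have "lie X t = young_symmetrizer n m (lie X t')" "lie X t' \<in> carrier L"
    by (simp_all add: lie_young lie_act_carrier)
  then show ?thesis unfolding GL_rep_def N_def[symmetric] by blast
qed

lemma GL_rep_comb:
  assumes "s \<in> GL_rep n m" "t \<in> GL_rep n m"
  shows "(\<lambda>w. c * s w + d * t w) \<in> GL_rep n m"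
proof -
  obtain s' t' where st: "s = young_symmetrizer n m s'" "t = young_symmetrizer n m t'"
    "s' \<in> carrier (L)" "t' \<in> carrier (L)"
    using assms unfolding GL_rep_def N_def by blast
  have "(\<lambda>w. c * s w + d * t w) = young_symmetrizer n m (\<lambda>w. c * s' w + d * t' w)"
    by (rule ext) (simp only: st young_symmetrizer_def perm_act_def sum.distrib sum_distrib_left distrib_left mult.left_commute[of "of_int _"])
  moreover have "(\<lambda>w. c * s' w + d * t' w) \<in> carrier (L)"
    using st by (simp add: tensor_space_def)
  ultimately show ?thesis unfolding GL_rep_def N_def by blast
qed

section \<open>Contractions and trace-free tensors\<close>

definition trace_at :: "tensor \<Rightarrow> (nat \<Rightarrow> nat) \<Rightarrow> nat \<Rightarrow> nat \<Rightarrow> complex" where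
  "trace_at t x p q = (\<Sum>a<N. \<Sum>b<N. omega n $$ (a, b) * t (fill (x(p := a, q := b))))"

lemma length_insert_at [simp]: "length (insert_at p a w) = Suc (length w)"
  by (simp add: insert_at_def)

lemma nth_insert_at:
  assumes "p \<le> length w" "i \<le> length w"
  shows "insert_at p a w ! i = (if i < p then w ! i else if i = p then a else w ! (i - 1))"
  using assms by (auto simp: insert_at_def nth_append min_def nth_Cons' diff_diff_left)

lemma insert_at_upd:
  assumes "p < q" "q \<le> Suc (length w)"
  shows "insert_at q b (insert_at p a w) = (insert_at q b' (insert_at p a' w))[p := a, q := b]"
  using assms by (intro nth_equalityI) (auto simp: nth_insert_at nth_list_update)

lemma insert_at_delete: "p < length l \<Longrightarrow> insert_at p (l ! p) (take p l @ drop (Suc p) l) = l"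
  by (simp add: insert_at_def id_take_nth_drop[symmetric])

lemma insert_at_surj:
  assumes "p < q" "q < length l"
  obtains w where "l = insert_at q (l ! q) (insert_at p (l ! p) w)" "length w + 2 = length l"
proof
  define l' where "l' = take q l @ drop (Suc q) l"
  define w where "w = take p l' @ drop (Suc p) l'"
  have len: "length l' + 1 = length l" using assms by (simp add: l'_def)
  have "l = insert_at q (l ! q) l'"
    using insert_at_delete[OF assms(2)] by (simp add: l'_def)
  moreover have "l' ! p = l ! p" using assms by (simp add: l'_def nth_append)
  ultimately show "l = insert_at q (l ! q) (insert_at p (l ! p) w)"
    using insert_at_delete[of p l'] len assms unfolding w_def by simp
  show "length w + 2 = length l" using len assms by (simp add: w_def)
qed

text \<open>\<open>trace_at\<close> lets a filling of all \<open>K\<close> positions stand for a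
  word of length K - 2, its values at p and q being overwritten. A contraction evaluated at a word
  of any other length vanishes, since it involves only coordinates of \<open>t\<close> at words of
  the wrong length.\<close>

lemma trace_free_iff:
  assumes "t \<in> carrier (L)"
  shows "trace_free n K t \<longleftrightarrow> (\<forall>x p q. p < q \<and> q < K \<longrightarrow> trace_at t x p q = 0)"
proof (intro iffI allI impI)
  fix x p q assume tf: "trace_free n K t" and pq: "p < q \<and> q < K"
  obtain w where w: "fill x = insert_at q (fill x ! q) (insert_at p (fill x ! p) w)" "length w + 2 = K"
    using insert_at_surj[of p q "fill x" thesis] pq by (metis length_fill)
  have "insert_at q b (insert_at p a w) = fill (x(p := a, q := b))" for a b
  proof -
    have "insert_at q b (insert_at p a w) = (fill x)[p := a, q := b]"
      by (subst w(1), rule insert_at_upd) (use pq w(2) in auto)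
    also have "\<dots> = fill (x(p := a, q := b))" using pq by (simp add: fill_update)
    finally show ?thesis .
  qed
  then have "trace_at t x p q = contraction n p q t w"
    unfolding trace_at_def contraction_def N_def[symmetric] by simp
  also have "\<dots> = 0" using tf pq by (simp add: trace_free_def)
  finally show "trace_at t x p q = 0" .
next
  assume tr: "\<forall>x p q. p < q \<and> q < K \<longrightarrow> trace_at t x p q = 0"
  have "contraction n p q t w = 0" if pq: "p < q" "q < K" for p q w
  proof (cases "length w + 2 = K")
    case True
    define x where "x = (!) (insert_at q 0 (insert_at p 0 w))"
    have x: "fill x = insert_at q 0 (insert_at p 0 w)" using True by (simp add: x_def fill_nth)
    have "insert_at q b (insert_at p a w) = fill (x(p := a, q := b))" for a b
    proof -
      have "insert_at q b (insert_at p a w) = (fill x)[p := a, q := b]"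
        using pq True x insert_at_upd[of p q w b a 0 0] by simp
      also have "\<dots> = fill (x(p := a, q := b))" using pq by (simp add: fill_update)
      finally show ?thesis .
    qed
    then have "contraction n p q t w = trace_at t x p q"
      unfolding trace_at_def contraction_def N_def[symmetric] by simp
    then show ?thesis using tr pq by simp
  next
    case False
    have "insert_at q b (insert_at p a w) \<notin> words N K" for a b
      using False by (auto simp: words_def)
    then show ?thesis using assms by (simp add: contraction_def tensor_space_def)
  qed
  then show "trace_free n K t" by (auto simp: trace_free_def)
qed

lemma sum_swap3:
  "(\<Sum>a\<in>A. \<Sum>b\<in>B. \<Sum>c\<in>C. f a b c) = (\<Sum>b\<in>B. \<Sum>c\<in>C. \<Sum>a\<in>A. f a b c)"
  by (subst sum.swap) (intro sum.cong refl sum.swap)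

text \<open>The terms in which \<open>X\<close> acts at p or q cancel because \<open>X\<close>
  preserves \<omega>; a term in which it acts elsewhere is a multiple of a trace of \<open>t\<close>
  at another filling.\<close>

lemma trace_at_lie:
  assumes X: "X \<in> sp_odd n" and pq: "p < K" "q < K" "p \<noteq> q"
    and tr: "\<And>x. trace_at t x p q = 0" and t: "t \<in> carrier (L)"
  shows "trace_at (lie X t) x p q = 0"
proof (cases "\<forall>r < K. r \<noteq> p \<and> r \<noteq> q \<longrightarrow> x r < N")
  case False
  then obtain r where r: "r < K" "r \<noteq> p" "r \<noteq> q" "\<not> x r < N" by blast
  have "lie X t (fill (x(p := a, q := b))) = 0" for a b
  proof -
    have "\<not> letters (x(p := a, q := b))" using r by (auto simp: letters_def)
    then have "fill (x(p := a, q := b)) \<notin> words N K" by (simp add: fill_words)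
    then show ?thesis using lie_act_carrier[OF t] by (simp add: tensor_space_def)
  qed
  then show ?thesis by (simp add: trace_at_def)
next
  case True
  define T where "T a b = t (fill (x(p := a, q := b)))" for a b
  define w where "w a b = omega n $$ (a, b)" for a b
  define R where "R = {..<K} - {p, q}"
  have K: "{..<K} = insert p (insert q R)" using pq by (auto simp: R_def)
  have R: "finite R" "p \<notin> R" "q \<notin> R" by (auto simp: R_def)
  have lie: "lie X t (fill (x(p := a, q := b))) =
      (\<Sum>c<N. X $$ (a, c) * T c b) + (\<Sum>c<N. X $$ (b, c) * T a c) +
      (\<Sum>r\<in>R. \<Sum>c<N. X $$ (x r, c) * t (fill (x(p := a, q := b, r := c))))"
    if "a < N" "b < N" for a b
  proof -
    have "letters (x(p := a, q := b))" using True that by (auto simp: letters_def)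
    moreover have "x(p := a, q := b, p := c) = x(p := c, q := b)" "x(p := a, q := b, q := c) = x(p := a, q := c)" for c
      using pq by (auto simp: fun_eq_iff)
    moreover have "(\<Sum>r\<in>R. \<Sum>c<N. X $$ ((x(p := a, q := b)) r, c) * t (fill (x(p := a, q := b, r := c)))) =
       (\<Sum>r\<in>R. \<Sum>c<N. X $$ (x r, c) * t (fill (x(p := a, q := b, r := c))))"
      using R by (intro sum.cong refl) auto
    ultimately show ?thesis
      using R pq unfolding lie_fill[OF \<open>letters _\<close>] K T_def by (simp add: add.assoc)
  qed
  have rest: "(\<Sum>a<N. \<Sum>b<N. w a b * (\<Sum>r\<in>R. \<Sum>c<N. X $$ (x r, c) * t (fill (x(p := a, q := b, r := c))))) = 0"
  proof -
    have "(\<Sum>a<N. \<Sum>b<N. w a b * (\<Sum>r\<in>R. \<Sum>c<N. X $$ (x r, c) * t (fill (x(p := a, q := b, r := c)))))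
      = (\<Sum>r\<in>R. \<Sum>c<N. X $$ (x r, c) * (\<Sum>a<N. \<Sum>b<N. w a b * t (fill (x(p := a, q := b, r := c)))))"
      unfolding sum_distrib_left sum_swap3[where B = R]
      by (simp only: mult.left_commute)
    also have "\<dots> = (\<Sum>r\<in>R. \<Sum>c<N. X $$ (x r, c) * trace_at t (x(r := c)) p q)"
      unfolding trace_at_def w_def
    proof (intro sum.cong refl arg_cong2[where f = "(*)"] arg_cong[where f = t] arg_cong[where f = fill])
      fix r c a b assume "r \<in> R"
      then show "x(p := a, q := b, r := c) = (x(r := c))(p := a, q := b)"
        using R by (auto simp: fun_eq_iff)
    qed
    finally show ?thesis by (simp add: tr)
  qed
  have "(\<Sum>a<N. \<Sum>b<N. w a b * (\<Sum>c<N. X $$ (a, c) * T c b)) + (\<Sum>a<N. \<Sum>b<N. w a b * (\<Sum>c<N. X $$ (b, c) * T a c)) = 0"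
  proof -
    have Xc: "X \<in> carrier_mat N N" and eq: "transpose_mat X * omega n + omega n * X = 0\<^sub>m N N"
      using X by (auto simp: sp_odd_def N_def)
    have om: "omega n \<in> carrier_mat N N" using N_def by (simp add: omega_def)
    have e: "(\<Sum>a<N. X $$ (a, c) * w a b) + (\<Sum>a<N. w c a * X $$ (a, b)) = 0" if "c < N" "b < N" for c b
    proof -
      have "(transpose_mat X * omega n + omega n * X) $$ (c, b) = 0" using eq that by simp
      then show ?thesis using Xc om that
        by (simp add: scalar_prod_def w_def atLeast0LessThan)
    qed
    have "(\<Sum>a<N. \<Sum>b<N. w a b * (\<Sum>c<N. X $$ (a, c) * T c b)) = (\<Sum>c<N. \<Sum>b<N. (\<Sum>a<N. X $$ (a, c) * w a b) * T c b)"
      unfolding sum_distrib_left sum_distrib_right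
      by (subst sum_swap3, subst sum.swap) (simp only: mult_ac)
    moreover have "(\<Sum>a<N. \<Sum>b<N. w a b * (\<Sum>c<N. X $$ (b, c) * T a c)) = (\<Sum>c<N. \<Sum>b<N. (\<Sum>a<N. w c a * X $$ (a, b)) * T c b)"
      unfolding sum_distrib_left sum_distrib_right
      by (rule sum.cong[OF refl], subst sum.swap) (simp only: mult_ac)
    moreover have "(\<Sum>c<N. \<Sum>b<N. (\<Sum>a<N. X $$ (a, c) * w a b) * T c b) + (\<Sum>c<N. \<Sum>b<N. (\<Sum>a<N. w c a * X $$ (a, b)) * T c b)
        = (\<Sum>c<N. \<Sum>b<N. ((\<Sum>a<N. X $$ (a, c) * w a b) + (\<Sum>a<N. w c a * X $$ (a, b))) * T c b)"
      by (simp add: sum.distrib distrib_right)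
    ultimately show ?thesis
      using e by simp
  qed
  moreover have "trace_at (lie X t) x p q = (\<Sum>a<N. \<Sum>b<N. w a b * ((\<Sum>c<N. X $$ (a, c) * T c b) + (\<Sum>c<N. X $$ (b, c) * T a c) +
      (\<Sum>r\<in>R. \<Sum>c<N. X $$ (x r, c) * t (fill (x(p := a, q := b, r := c))))))"
    unfolding trace_at_def w_def by (intro sum.cong refl arg_cong2[where f = "(*)"]) (rule lie; simp)
  ultimately show ?thesis using rest
    by (simp only: distrib_left sum.distrib) simp
qed

lemma trace_free_lie:
  assumes "X \<in> sp_odd n" "t \<in> carrier (L)" "trace_free n K t"
  shows "trace_free n K (lie X t)"
  using assms trace_at_lie[OF assms(1) _ _ _ _ assms(2)] lie_act_carrier[OF assms(2)]
  by (auto simp: trace_free_iff)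

text \<open>Within a column both \<omega> and \<open>t\<close> are antisymmetric under exchanging
  the two positions, so the entries 1 and the entries -1 of \<omega> contribute equally.\<close>

lemma trace_at_pairs:
  assumes "t \<in> GL_rep n m" "p < K" "q < K" "p \<noteq> q" "col p = col q"
  shows "trace_at t x p q = 2 * (\<Sum>j<n. t (fill (x(p := j, q := n + j))))"
proof -
  define T where "T a b = t (fill (x(p := a, q := b)))" for a b
  have anti: "T b a = - T a b" for a b
  proof -
    have "x(p := a, q := b) \<circ> swap p q = x(p := b, q := a)"
      using assms(4) by (auto simp: fun_eq_iff Transposition.transpose_def)
    then show ?thesis using GL_rep_swap[OF assms, of "x(p := a, q := b)"] by (simp add: T_def)
  qed
  have om: "omega n $$ (a, b) = (if a < n \<and> b = n + a then 1 else 0) - (if b < n \<and> a = n + b then 1 else 0)"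
    if "a < N" "b < N" for a b
    using that by (simp add: omega_def N_def)
  have 1: "(\<Sum>a<N. \<Sum>b<N. (if a < n \<and> b = n + a then 1 else 0) * T a b) = (\<Sum>j<n. T j (n + j))"
  proof -
    have "(\<Sum>b<N. (if a < n \<and> b = n + a then 1 else 0) * T a b) = (if a < n then T a (n + a) else 0)" for a
    proof (cases "a < n")
      case True
      then have "n + a < N" by (simp add: N_def)
      have "(\<Sum>b<N. (if a < n \<and> b = n + a then 1 else 0) * T a b) = (\<Sum>b<N. if b = n + a then T a b else 0)"
        using True by (intro sum.cong refl) auto
      also have "\<dots> = T a (n + a)" using \<open>n + a < N\<close> by (simp add: sum.delta)
      finally show ?thesis using True by simp
    qed simp
    then have "(\<Sum>a<N. \<Sum>b<N. (if a < n \<and> b = n + a then 1 else 0) * T a b) = (\<Sum>a<N. if a < n then T a (n + a) else 0)" by simp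
    also have "\<dots> = (\<Sum>a<n. T a (n + a))"
      by (rule sum.mono_neutral_cong_right) (auto simp: N_def)
    finally show ?thesis .
  qed
  have 2: "(\<Sum>a<N. \<Sum>b<N. (if b < n \<and> a = n + b then 1 else 0) * T a b) = - (\<Sum>j<n. T j (n + j))"
  proof -
    have "(\<Sum>a<N. \<Sum>b<N. (if b < n \<and> a = n + b then 1 else 0) * T a b) =
      (\<Sum>b<N. \<Sum>a<N. (if b < n \<and> a = n + b then 1 else 0) * - T b a)"
      by (subst sum.swap) (simp add: anti[symmetric])
    also have "\<dots> = - (\<Sum>b<N. \<Sum>a<N. (if b < n \<and> a = n + b then 1 else 0) * T b a)"
      by (simp add: sum_negf)
    finally show ?thesis using 1 by simp
  qed
  have "trace_at t x p q = (\<Sum>a<N. \<Sum>b<N. (if a < n \<and> b = n + a then 1 else 0) * T a b - (if b < n \<and> a = n + b then 1 else 0) * T a b)"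
    unfolding trace_at_def T_def[symmetric]
    by (intro sum.cong refl) (simp add: om left_diff_distrib)
  also have "\<dots> = 2 * (\<Sum>j<n. T j (n + j))"
    by (simp add: sum_subtractf 1 2)
  finally show ?thesis by (simp add: T_def)
qed

lemma trace_free_pairs:
  assumes "t \<in> GL_rep n m" "trace_free n K t" "p < K" "q < K" "p \<noteq> q" "col p = col q"
  shows "(\<Sum>j<n. t (fill (x(p := j, q := n + j)))) = 0"
proof -
  have tr: "\<And>x p q. p < q \<Longrightarrow> q < K \<Longrightarrow> trace_at t x p q = 0"
    using assms(2) trace_free_iff[OF GL_rep_carrier[OF assms(1)]] by blast
  show ?thesis
  proof (cases "p < q")
    case True
    then show ?thesis using tr[OF True assms(4), of x] trace_at_pairs[OF assms(1,3-6)] by simp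
  next
    case False
    then have "(\<Sum>j<n. t (fill (x(q := j, p := n + j)))) = 0"
      using tr[of q p x] assms trace_at_pairs[OF assms(1) assms(4,3), of x] by simp
    moreover have "t (fill (x(q := j, p := n + j))) = - t (fill (x(p := j, q := n + j)))" for j
    proof -
      have "x(p := j, q := n + j) \<circ> swap p q = x(q := j, p := n + j)"
        using assms(5) by (auto simp: fun_eq_iff Transposition.transpose_def)
      then show ?thesis using GL_rep_swap[OF assms(1,3-6), of "x(p := j, q := n + j)"] by simp
    qed
    ultimately show ?thesis by (simp add: sum_negf)
  qed
qed

definition V0 where "V0 = carrier (trace_free_rep n m)"

lemma V0_iff: "t \<in> V0 \<longleftrightarrow> t \<in> GL_rep n m \<and> trace_free n K t"
  by (simp add: V0_def trace_free_rep_def)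

lemma V0_carrier: "t \<in> V0 \<Longrightarrow> t \<in> carrier (L)"
  by (simp add: V0_iff GL_rep_carrier)

lemma V0_comb: "s \<in> V0 \<Longrightarrow> t \<in> V0 \<Longrightarrow> (\<lambda>w. c * s w + d * t w) \<in> V0"
proof -
  assume st: "s \<in> V0" "t \<in> V0"
  have "trace_at (\<lambda>w. c * s w + d * t w) x p q = c * trace_at s x p q + d * trace_at t x p q" for x p q
    by (simp add: trace_at_def sum.distrib sum_distrib_left distrib_left mult.left_commute)
  then show ?thesis
    using st GL_rep_comb[of s t c d] by (auto simp: V0_iff trace_free_iff GL_rep_carrier)
qed

lemma V0_zero: "t \<in> V0 \<Longrightarrow> (\<lambda>w. 0) \<in> V0"
  using V0_comb[of t t 0 0] by simp

lemma V0_lie: "X \<in> sp_odd n \<Longrightarrow> t \<in> V0 \<Longrightarrow> lie X t \<in> V0"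
  by (simp add: V0_iff GL_rep_lie trace_free_lie GL_rep_carrier)

section \<open>Straightening\<close>

text \<open>The numbering starts at 1 because ranks later become levels of patterns: the least
  letter allowed in row i of a King tableau, i itself, has rank 2 i - 1.\<close>

definition rank :: "nat \<Rightarrow> nat" where
  "rank a = (if a < n then 2 * a + 1 else if a < 2 * n then 2 * (a - n) + 2 else 2 * n + 1)"

lemma rank_inj: "a < N \<Longrightarrow> b < N \<Longrightarrow> rank a = rank b \<Longrightarrow> a = b"
  by (auto simp: rank_def N_def split: if_splits; presburger)

lemma rank_bounds: "1 \<le> rank a" "rank a \<le> 2 * n + 1"
  by (auto simp: rank_def)

definition column_strict :: "(nat \<Rightarrow> nat) \<Rightarrow> bool" where
  "column_strict x \<longleftrightarrow> (\<forall>p < K. \<forall>q < K. col p = col q \<and> row p < row q \<longrightarrow> rank (x p) < rank (x q))"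

text \<open>King's symplectic tableaux, with the letters ordered \<open>1 < n+1 < 2 < n+2 < \<dots> < n < 2n < 2n+1\<close>.\<close>

definition standard :: "(nat \<Rightarrow> nat) \<Rightarrow> bool" where
  "standard x \<longleftrightarrow> letters x \<and> column_strict x \<and>
     (\<forall>p < K. \<forall>q < K. row p = row q \<and> col p \<le> col q \<longrightarrow> rank (x p) \<le> rank (x q)) \<and>
     (\<forall>p < K. 2 * row p \<le> rank (x p) + 1)"

text \<open>Both straightening relations express a value through values of larger content: the Garnir
  relations move large letters to the right, and in the trace relations the weight of a pair exceeds
  the total weight of all smaller letters.\<close>

definition content :: "(nat \<Rightarrow> nat) \<Rightarrow> nat" where
  "content x = (\<Sum>p<K. (col p + 1) * 2 ^ rank (x p))"

lemma content_bound: "content x \<le> (\<Sum>p<K. (col p + 1) * 2 ^ (2 * n + 1))"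
  unfolding content_def by (intro sum_mono mult_left_mono power_increasing) (simp_all add: rank_bounds(2)[simplified])

lemma content_column_perm:
  assumes "\<pi> \<in> label_group col" shows "content (x \<circ> \<pi>) = content x"
proof -
  have "content (x \<circ> \<pi>) = (\<Sum>p<K. (col (\<pi> p) + 1) * 2 ^ rank (x (\<pi> p)))"
    unfolding content_def by (intro sum.cong refl) (simp add: label_groupD(2)[OF assms])
  also have "\<dots> = content x"
    unfolding content_def
    by (rule sum.reindex_bij_betw[OF permutes_imp_bij[OF label_groupD(1)[OF assms]]])
  finally show ?thesis .
qed

lemma column_strict_inj:
  assumes "column_strict x" "p < K" "q < K" "col p = col q" "x p = x q"
  shows "p = q"
  using assms box_inj[of p q] unfolding column_strict_def
  by (metis less_irrefl linorder_neqE_nat)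

text \<open>Sorting by an extremal choice: a column permutation that maximizes the sum of row number
  times rank leaves no descent in a column, since exchanging the two letters would raise the
  sum.\<close>

lemma exists_column_strict:
  assumes "letters x" "\<And>p q. p < K \<Longrightarrow> q < K \<Longrightarrow> col p = col q \<Longrightarrow> x p = x q \<Longrightarrow> p = q"
  shows "\<exists>\<pi> \<in> label_group col. column_strict (x \<circ> \<pi>)"
proof -
  define S where "S \<pi> = (\<Sum>p<K. row p * rank ((x \<circ> \<pi>) p))" for \<pi>
  have "id \<in> label_group col" by (simp add: label_group_def)
  then have ne: "S ` label_group col \<noteq> {}" "finite (S ` label_group col)"
    using finite_label_group by auto
  have "Max (S ` label_group col) \<in> S ` label_group col" using Max_in[OF ne(2,1)] .
  then obtain \<pi> where \<pi>: "\<pi> \<in> label_group col" "S \<pi> = Max (S ` label_group col)"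
    by (metis imageE)
  have "rank (x (\<pi> p)) < rank (x (\<pi> q))" if pq: "p < K" "q < K" "col p = col q" "row p < row q" for p q
  proof (rule ccontr)
    assume "\<not> rank (x (\<pi> p)) < rank (x (\<pi> q))"
    moreover have "rank (x (\<pi> p)) \<noteq> rank (x (\<pi> q))"
    proof
      assume eq: "rank (x (\<pi> p)) = rank (x (\<pi> q))"
      have "\<pi> p < K" "\<pi> q < K" "col (\<pi> p) = col (\<pi> q)" using \<pi>(1) pq by (auto simp: label_groupD)
      then have "\<pi> p = \<pi> q" using eq assms rank_inj by (metis letters_def)
      then have "p = q" using permutes_inj[OF label_groupD(1)[OF \<pi>(1)]] by (auto simp: inj_def)
      then show False using pq by simp
    qed
    ultimately have gt: "rank (x (\<pi> q)) < rank (x (\<pi> p))" by simp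
    define \<sigma> where "\<sigma> = \<pi> \<circ> swap p q"
    have "\<sigma> \<in> label_group col"
      unfolding \<sigma>_def by (rule label_group_comp[OF \<pi>(1) label_group_transpose[OF pq(1-3)]])
    then have le: "S \<sigma> \<le> S \<pi>" using \<pi>(2) ne by simp
    have "p \<noteq> q" using pq by auto
    define R where "R = {..<K} - {p, q}"
    have K: "{..<K} = insert p (insert q R)" using pq by (auto simp: R_def)
    have R: "finite R" "p \<notin> R" "q \<notin> R" by (auto simp: R_def)
    have "(\<Sum>r\<in>R. row r * rank ((x \<circ> \<sigma>) r)) = (\<Sum>r\<in>R. row r * rank ((x \<circ> \<pi>) r))"
      using R by (intro sum.cong refl) (auto simp: \<sigma>_def Transposition.transpose_def)
    then have "row p * rank (x (\<pi> q)) + row q * rank (x (\<pi> p)) \<le> row p * rank (x (\<pi> p)) + row q * rank (x (\<pi> q))"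
      using le R \<open>p \<noteq> q\<close> unfolding S_def K by (simp add: \<sigma>_def)
    moreover obtain d where "rank (x (\<pi> p)) = rank (x (\<pi> q)) + d" "d > 0"
      using gt less_imp_add_positive by metis
    ultimately show False using pq(4) by (simp add: algebra_simps)
  qed
  then show ?thesis using \<pi>(1) by (auto simp: column_strict_def)
qed

text \<open>In passing from \<open>B\<close> to its image under \<open>g\<close>, a part
  \<open>D\<close> of \<open>B\<close> is replaced by equally many elements of \<open>A\<close>,
  each heavier than everything in \<open>D\<close>. The part \<open>D\<close> is not empty because
  \<open>g\<close> does not preserve \<open>A\<close>.\<close>

lemma garnir_content:
  assumes A: "finite A" "finite B" "A \<inter> B = {}" and g: "g permutes A \<union> B" and gA: "g ` A \<noteq> A"
    and AB: "\<And>a b. a \<in> A \<Longrightarrow> b \<in> B \<Longrightarrow> w b < (w a :: nat)"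
  shows "sum w B < sum (w \<circ> g) B"
proof -
  have inj: "inj g" by (rule permutes_inj[OF g])
  have inj_B: "inj_on g B" using inj by (rule inj_on_subset) simp
  have un: "g ` A \<union> g ` B = A \<union> B" using permutes_image[OF g] by (simp add: image_Un)
  have disj: "g ` A \<inter> g ` B = {}" using A(3) inj by (simp add: image_Int[symmetric])
  have cancel: "X = A" if "X \<union> B = A \<union> B" "X \<inter> B = {}" for X
    using that A(3) by blast
  have gB: "g ` B \<noteq> B" using cancel[of "g ` A"] un disj gA by auto
  have card: "card (g ` B) = card B" by (rule card_image[OF inj_B])
  define C where "C = g ` B \<inter> A" 
  define D where "D = B - g ` B"
  define I where "I = g ` B \<inter> B"
  have fin: "finite C" "finite D" "finite I" using A by (auto simp: C_def D_def I_def)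
  have 1: "g ` B = I \<union> C" "I \<inter> C = {}" using un A(3) by (auto simp: C_def I_def)
  have 2: "B = I \<union> D" "I \<inter> D = {}" by (auto simp: D_def I_def)
  have "card I + card C = card I + card D"
    using card card_Un_disjoint[OF fin(3,1) 1(2)] card_Un_disjoint[OF fin(3,2) 2(2)] 1(1) 2(1) by simp
  then have cc: "card C = card D" by simp
  have "D \<noteq> {}"
  proof
    assume "D = {}"
    then have "B \<subseteq> g ` B" by (auto simp: D_def)
    then have "B = g ` B" using card card_subset_eq[of "g ` B" B] A by simp
    then show False using gB by simp
  qed
  then have cpos: "card D > 0" using fin by auto
  define M where "M = Max (w ` D)"
  have "sum w D \<le> card D * M"
    using sum_bounded_above[of D w M] fin by (simp add: M_def)
  also have "\<dots> < card C * (M + 1)" using cc cpos by simp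
  also have "\<dots> \<le> sum w C"
  proof -
    have "M \<in> w ` D" unfolding M_def using fin \<open>D \<noteq> {}\<close> by (intro Max_in) auto
    then obtain b where "b \<in> B" "M = w b" by (auto simp: D_def)
    then have "M + 1 \<le> w c" if "c \<in> C" for c using AB[of c b] that by (auto simp: C_def)
    then show ?thesis using sum_bounded_below[of C "M + 1" w] by simp
  qed
  finally have "sum w B < sum w (g ` B)"
    unfolding 1(1) by (subst 2(1)) (simp add: sum.union_disjoint fin 1(2) 2(2))
  also have "\<dots> = sum (w \<circ> g) B" by (rule sum.reindex[OF inj_B])
  finally show ?thesis .
qed

text \<open>Modulo the relations \<open>\<Sum>y\<in>P \<union> A. \<psi> (h(i := y)) = 0\<close> in every slot \<open>i\<close>, all slots can be moved from \<open>P\<close> to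
  \<open>A\<close>; the right hand side is later killed by the pigeonhole principle.\<close>

lemma slot_exchange:
  fixes \<psi> :: "(nat \<Rightarrow> nat) \<Rightarrow> complex"
  assumes "finite I" "J \<subseteq> I"
    and rel: "\<And>h i. i \<in> I \<Longrightarrow> \<forall>j \<in> I - {i}. h j \<in> P \<union> A \<Longrightarrow> (\<Sum>y\<in>P. \<psi> (h(i := y))) = - (\<Sum>y\<in>A. \<psi> (h(i := y)))"
  shows "(\<Sum>h\<in>PiE I (\<lambda>_. P). \<psi> h) = (- 1) ^ card J * (\<Sum>h\<in>PiE I (\<lambda>j. if j \<in> J then A else P). \<psi> h)"
proof -
  have "finite J" using assms(1,2) finite_subset by blast
  then show ?thesis using assms(2)
  proof (induction J)
    case (insert i J)
    define F where "F j = (if j \<in> J then A else P)" for j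
    have split: "(\<Sum>h\<in>PiE I G. \<psi> h) = (\<Sum>g\<in>PiE (I - {i}) G. \<Sum>y\<in>G i. \<psi> (g(i := y)))" for G
    proof -
      have I: "insert i (I - {i}) = I" using insert by auto
      have "(\<Sum>h\<in>PiE I G. \<psi> h) = (\<Sum>h\<in>(\<lambda>(y, g). g(i := y)) ` (G i \<times> PiE (I - {i}) G). \<psi> h)"
        using PiE_insert_eq[of i "I - {i}" G] unfolding I by simp
      also have "\<dots> = (\<Sum>(y, g)\<in>G i \<times> PiE (I - {i}) G. \<psi> (g(i := y)))"
        by (subst sum.reindex) (auto simp: case_prod_unfold intro!: inj_combinator[unfolded case_prod_unfold])
      also have "\<dots> = (\<Sum>y\<in>G i. \<Sum>g\<in>PiE (I - {i}) G. \<psi> (g(i := y)))"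
        by (simp add: sum.cartesian_product)
      finally show ?thesis by (simp add: sum.swap[of _ "G i"])
    qed
    have "(\<Sum>h\<in>PiE I F. \<psi> h) = (\<Sum>g\<in>PiE (I - {i}) F. - (\<Sum>y\<in>A. \<psi> (g(i := y))))"
    proof (subst split, rule sum.cong[OF refl])
      fix g assume "g \<in> PiE (I - {i}) F"
      then have "\<forall>j \<in> I - {i}. g j \<in> P \<union> A" by (auto simp: F_def PiE_def Pi_def split: if_splits)
      moreover have "F i = P" using insert by (simp add: F_def)
      ultimately show "(\<Sum>y\<in>F i. \<psi> (g(i := y))) = - (\<Sum>y\<in>A. \<psi> (g(i := y)))"
        using rel[of i g] insert by simp
    qed
    also have "\<dots> = - (\<Sum>g\<in>PiE (I - {i}) (F(i := A)). \<Sum>y\<in>(F(i := A)) i. \<psi> (g(i := y)))"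
    proof -
      have "PiE (I - {i}) F = PiE (I - {i}) (F(i := A))" by (intro PiE_cong) auto
      then show ?thesis by (simp add: sum_negf)
    qed
    also have "\<dots> = - (\<Sum>h\<in>PiE I (F(i := A)). \<psi> h)" by (simp only: split)
    also have "F(i := A) = (\<lambda>j. if j \<in> insert i J then A else P)" by (auto simp: F_def fun_eq_iff)
    finally show ?case using insert by (simp add: F_def)
  qed simp
qed

section \<open>Relations at a column-strict filling when all values of larger content vanish\<close>

context
  fixes t :: tensor and x :: "nat \<Rightarrow> nat"
  assumes t: "t \<in> V0" and x: "letters x" "column_strict x"
    and larger: "\<And>y. letters y \<Longrightarrow> content x < content y \<Longrightarrow> t (fill y) = 0"
begin

lemma t_GL: "t \<in> GL_rep n m" and t_trace_free: "trace_free n K t"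
  using t by (auto simp: V0_iff)

lemma column_mono:
  assumes "p < K" "q < K" "col p = col q" "row p \<le> row q" shows "rank (x p) \<le> rank (x q)"
proof (cases "row p = row q")
  case True
  then show ?thesis using box_inj[OF assms(1,2)] assms(3) by auto
next
  case False
  then show ?thesis using assms x(2) by (auto simp: column_strict_def less_imp_le)
qed

text \<open>A Garnir relation for the part \<open>A\<close> of the left column from the offending
  row downward and the part \<open>B\<close> of the right column down to that row. By column
  strictness all letters of \<open>A\<close> outrank those of \<open>B\<close>, so a permutation
  mixing the two sets gives larger content and a vanishing value; the others are column
  permutations, and each contributes \<open>t (fill x)\<close>.\<close>

lemma row_straighten:
  assumes pq: "p < K" "q < K" "row p = row q" "col p \<le> col q" "rank (x q) < rank (x p)"
  shows "t (fill x) = 0"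
proof -
  define c d r where "c = col p" and "d = col q" and "r = row p"
  have cd: "c < d" using pq box_inj[OF pq(1-3)] by (auto simp: c_def d_def le_less)
  define A where "A = {p'. p' < K \<and> col p' = c \<and> r \<le> row p'}"
  define B where "B = {q'. q' < K \<and> col q' = d \<and> row q' \<le> r}"
  have fin: "finite A" "finite B" by (auto simp: A_def B_def)
  have disj: "A \<inter> B = {}" using cd by (auto simp: A_def B_def)
  have AB: "rank (x b) < rank (x a)" if "a \<in> A" "b \<in> B" for a b
  proof -
    have "rank (x p) \<le> rank (x a)" "rank (x b) \<le> rank (x q)"
      using that pq column_mono by (auto simp: A_def B_def c_def d_def r_def)
    then show ?thesis using pq(5) by simp
  qed
  \<comment> \<open>Pigeonhole: \<open>A\<close> and \<open>B\<close> together have at least one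
    element more than the left column has rows, and a column permutation sends them to rows of that
    column, the right column being no longer.\<close>
  have rows: "\<exists>a \<in> A \<union> B. \<exists>b \<in> A \<union> B. a \<noteq> b \<and> row (\<tau> a) = row (\<tau> b)"
    if \<tau>: "\<tau> \<in> label_group col" for \<tau>
  proof (rule ccontr)
    assume "\<not> ?thesis"
    then have inj: "inj_on (\<lambda>a. row (\<tau> a)) (A \<union> B)" by (auto simp: inj_on_def)
    define H where "H = {i. 1 \<le> i \<and> i \<le> n \<and> c < lam i}"
    have finH: "finite H" by (rule finite_subset[of _ "{..n}"]) (auto simp: H_def)
    have "(\<lambda>a. row (\<tau> a)) ` (A \<union> B) \<subseteq> H"
    proof (rule image_subsetI)
      fix a assume a: "a \<in> A \<union> B"
      then have "a < K" "c \<le> col a" using cd by (auto simp: A_def B_def)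
      then have "\<tau> a < K" "c \<le> col (\<tau> a)" using label_groupD[OF \<tau>] by auto
      then show "row (\<tau> a) \<in> H" using box_bounds[of "\<tau> a"] by (auto simp: H_def)
    qed
    then have "card (A \<union> B) \<le> card H" using inj finH by (metis card_image card_mono)
    moreover have "card (A \<union> B) = card A + card B" using fin disj by (rule card_Un_disjoint)
    moreover have "card {i \<in> H. r \<le> i} \<le> card A"
    proof -
      have "{i \<in> H. r \<le> i} \<subseteq> row ` A"
      proof
        fix i assume "i \<in> {i \<in> H. r \<le> i}"
        then have "pos i c \<in> A" "row (pos i c) = i" using pos[of i c] by (auto simp: A_def H_def)
        then show "i \<in> row ` A" by force
      qed
      then show ?thesis using fin by (meson card_image_le card_mono finite_imageI le_trans)
    qed
    moreover have "card {1..r} \<le> card B"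
    proof -
      have "{1..r} \<subseteq> row ` B"
      proof
        fix i assume i: "i \<in> {1..r}"
        then have "d < lam i" using col_lt_lam[OF pq(2), of i] pq by (auto simp: d_def r_def)
        then have "pos i d \<in> B" "row (pos i d) = i" using pos[of i d] i by (auto simp: B_def)
        then show "i \<in> row ` B" by force
      qed
      then show ?thesis using fin by (meson card_image_le card_mono finite_imageI le_trans)
    qed
    moreover have "card H + 1 \<le> card {i \<in> H. r \<le> i} + card {1..r}"
    proof -
      have "r \<in> H" using box_bounds[OF pq(1)] by (auto simp: H_def c_def r_def)
      have "card ({i \<in> H. r \<le> i} \<union> {1..r}) + card ({i \<in> H. r \<le> i} \<inter> {1..r}) = card {i \<in> H. r \<le> i} + card {1..r}"
        using finH by (subst card_Un_Int) auto
      moreover have "card H \<le> card ({i \<in> H. r \<le> i} \<union> {1..r})"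
        using finH by (intro card_mono) (auto simp: H_def)
      moreover have "{i \<in> H. r \<le> i} \<inter> {1..r} = {r}" using \<open>r \<in> H\<close> by (auto simp: H_def)
      ultimately show ?thesis by simp
    qed
    ultimately show False by simp
  qed
  define G where "G = {g. g permutes A \<union> B}"
  have X: "A \<union> B \<subseteq> {..<K}" by (auto simp: A_def B_def)
  have finG: "finite G" unfolding G_def using fin by (intro finite_permutations) auto
  have perm: "g permutes {..<K}" if "g \<in> G" for g
    using that X by (auto simp: G_def intro: permutes_subset)
  have summand: "of_int (sign g) * t (fill (x \<circ> g)) = (if g ` A = A then t (fill x) else 0)" if g: "g \<in> G" for g
  proof (cases "g ` A = A")
    case True
    have gX: "g permutes A \<union> B" using g by (simp add: G_def)
    have gB: "g ` B = B"
    proof -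
      have "g ` A \<union> g ` B = A \<union> B" "g ` A \<inter> g ` B = {}"
        using permutes_image[OF gX] disj permutes_inj[OF gX] by (auto simp: image_Un[symmetric] image_Int[symmetric])
      then have "A \<union> g ` B = A \<union> B" "A \<inter> g ` B = {}" using True by simp_all
      moreover have "Y = B" if "A \<union> Y = A \<union> B" "A \<inter> Y = {}" for Y using that disj by blast
      ultimately show ?thesis by blast
    qed
    have "col (g y) = col y" if "y < K" for y
    proof (cases "y \<in> A \<union> B")
      case yX: True
      then have "(y \<in> A \<and> g y \<in> A) \<or> (y \<in> B \<and> g y \<in> B)" using True gB by blast
      then show ?thesis by (auto simp: A_def B_def)
    next
      case False
      then show ?thesis using permutes_not_in[OF gX] by simp
    qed
    then have "g \<in> label_group col" using perm[OF g] by (simp add: label_group_def)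
    then show ?thesis
      using True by (simp add: GL_rep_column_sign[OF t_GL] mult.assoc[symmetric] flip: of_int_mult)
  next
    case False
    have gX: "g permutes A \<union> B" using g by (simp add: G_def)
    define w where "w p = (2::nat) ^ rank (x p)" for p
    have less: "sum w B < sum (w \<circ> g) B"
      using AB by (intro garnir_content[OF fin disj gX False]) (simp add: w_def)
    define R where "R = {..<K} - (A \<union> B)"
    have K: "{..<K} = R \<union> (A \<union> B)" using X by (auto simp: R_def)
    have R: "finite R" "R \<inter> (A \<union> B) = {}" by (auto simp: R_def)
    \<comment> \<open>The factor d + 1 on \<open>B\<close> is written as (c + 1) + (d - c): the sum
      over the union is invariant under \<open>g\<close>, so only the excess on \<open>B\<close>
      changes, and \<open>garnir_content\<close> makes it grow.\<close>
    have split: "(\<Sum>p<K. (col p + 1) * f p) = (\<Sum>p\<in>R. (col p + 1) * f p) + (c + 1) * (sum f (A \<union> B)) + (d - c) * sum f B" for f :: "nat \<Rightarrow> nat"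
    proof -
      have "(\<Sum>p<K. (col p + 1) * f p) = (\<Sum>p\<in>R. (col p + 1) * f p) + ((\<Sum>p\<in>A. (col p + 1) * f p) + (\<Sum>p\<in>B. (col p + 1) * f p))"
        unfolding K using R fin disj by (simp add: sum.union_disjoint)
      also have "(\<Sum>p\<in>A. (col p + 1) * f p) = (c + 1) * sum f A"
        unfolding sum_distrib_left by (intro sum.cong refl) (auto simp: A_def)
      also have "(\<Sum>p\<in>B. (col p + 1) * f p) = ((c + 1) + (d - c)) * sum f B"
        unfolding sum_distrib_left using cd by (intro sum.cong refl) (auto simp: B_def)
      finally show ?thesis using fin disj by (simp add: sum.union_disjoint algebra_simps)
    qed
    have "sum (w \<circ> g) (A \<union> B) = sum w (A \<union> B)"
      using sum.reindex_bij_betw[OF permutes_imp_bij[OF gX], of w] by (simp add: comp_def)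
    moreover have "(\<Sum>p\<in>R. (col p + 1) * (w \<circ> g) p) = (\<Sum>p\<in>R. (col p + 1) * w p)"
      using permutes_not_in[OF gX] by (intro sum.cong refl) (auto simp: R_def)
    ultimately have "(\<Sum>p<K. (col p + 1) * w p) < (\<Sum>p<K. (col p + 1) * (w \<circ> g) p)"
      unfolding split using less cd by simp
    then have "content x < content (x \<circ> g)"
      by (simp add: content_def w_def)
    moreover have "letters (x \<circ> g)" using x(1) letters_perm[OF perm[OF g]] by simp
    ultimately show ?thesis using larger False by simp
  qed
  have "0 = (\<Sum>g\<in>G. of_int (sign g) * t (fill (x \<circ> g)))"
    unfolding G_def by (rule GL_rep_garnir[OF t_GL X rows, symmetric])
  also have "\<dots> = (\<Sum>g\<in>G. if g ` A = A then t (fill x) else 0)"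
    by (intro sum.cong refl) (rule summand)
  also have "\<dots> = (\<Sum>g\<in>{g\<in>G. g ` A = A}. t (fill x))"
    using finG by (rule sum.inter_filter[symmetric])
  also have "\<dots> = of_nat (card {g\<in>G. g ` A = A}) * t (fill x)" by simp
  finally have "of_nat (card {g\<in>G. g ` A = A}) * t (fill x) = 0" by simp
  moreover have "id \<in> {g\<in>G. g ` A = A}" by (simp add: G_def)
  then have "card {g\<in>G. g ` A = A} \<noteq> 0" using finG by auto
  ultimately show ?thesis by simp
qed

text \<open>For j in \<open>P\<close> both members j and n + j of a pair occur in column c, and they
  are replaced by the pair with index \<open>h j\<close>. Letters can serve as addresses because no
  letter repeats within a column of a column-strict filling.\<close>

definition subst_pairs :: "nat \<Rightarrow> nat set \<Rightarrow> (nat \<Rightarrow> nat) \<Rightarrow> nat \<Rightarrow> nat" where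
  "subst_pairs c P h q = (if col q \<noteq> c then x q else if x q \<in> P then h (x q)
     else if n \<le> x q \<and> x q - n \<in> P then n + h (x q - n) else x q)"

text \<open>Too small a letter in row k + 1 forces k + 1 letters into the k pairs of lowest rank, so
  more pairs are complete (\<open>P\<close>) than absent (\<open>A\<close>). The trace relations
  allow a complete pair to be traded, up to sign, from \<open>P\<close> to \<open>A\<close>. Doing
  so in all slots turns a positive multiple of \<open>t (fill x)\<close> into a sum over maps from
  \<open>P\<close> to \<open>A\<close>, none of which is injective.\<close>

lemma king_straighten:
  assumes p0: "p0 < K" "rank (x p0) + 1 < 2 * row p0"
  shows "t (fill x) = 0"
proof -
  define c where "c = col p0"
  define k where "k = row p0 - 1"
  have k: "row p0 = k + 1" "k < n" "rank (x p0) \<le> 2 * k"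
    using p0 box_bounds[OF p0(1)] by (auto simp: k_def)
  define U where "U = {j. j < k \<and> (\<exists>q<K. col q = c \<and> x q = j)}"
  define W where "W = {j. j < k \<and> (\<exists>q<K. col q = c \<and> x q = n + j)}"
  define P where "P = U \<inter> W"
  define A where "A = {..<k} - (U \<union> W)"
  have fin: "finite U" "finite W" "finite P" "finite A" by (auto simp: U_def W_def P_def A_def)
  have col_inj: "q = q'" if "q < K" "q' < K" "col q = c" "col q' = c" "x q = x q'" for q q'
    using column_strict_inj[OF x(2)] that by simp
  have inj: "inj_on x {q. q < K \<and> col q = c}"
    by (rule inj_onI) (use col_inj in auto)
  \<comment> \<open>The k + 1 letters in rows 1 to k + 1 have rank at most 2 k, whence k + 1 \<le>
    |U| + |W| = |U \<union> W| + |P|, while |A| = k - |U \<union> W|.\<close>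
  have "card A < card P"
  proof -
    define S where "S = (\<lambda>i. pos i c) ` {1..k + 1}"
    have pos_i: "pos i c < K \<and> row (pos i c) = i \<and> col (pos i c) = c" if "i \<in> {1..k + 1}" for i
      using pos[of i c] col_lt_lam[OF p0(1), of i] that k by (auto simp: c_def)
    have "inj_on (\<lambda>i. pos i c) {1..k + 1}" by (rule inj_onI) (use pos_i in metis)
    then have cS: "card S = k + 1" by (simp add: S_def card_image)
    have "x ` S \<subseteq> U \<union> (\<lambda>j. n + j) ` W"
    proof (rule image_subsetI)
      fix q assume "q \<in> S"
      then obtain i where i: "i \<in> {1..k + 1}" "q = pos i c" by (auto simp: S_def)
      then have q: "q < K" "row q \<le> row p0" "col q = c" using pos_i[OF i(1)] k by auto
      then have r: "rank (x q) \<le> 2 * k" using column_mono[OF q(1) p0(1)] k by (simp add: c_def)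
      show "x q \<in> U \<union> (\<lambda>j. n + j) ` W"
      proof (cases "x q < n")
        case True
        then show ?thesis using q r by (auto simp: U_def rank_def)
      next
        case False
        then have "x q = n + (x q - n)" "x q - n < k" using r k by (auto simp: rank_def split: if_splits)
        then show ?thesis using q by (auto simp: W_def)
      qed
    qed
    moreover have "S \<subseteq> {q. q < K \<and> col q = c}" using pos_i by (auto simp: S_def)
    then have "card (x ` S) = card S" using inj by (intro card_image) (rule inj_on_subset)
    ultimately have "k + 1 \<le> card (U \<union> (\<lambda>j. n + j) ` W)"
      using cS fin by (metis card_mono finite_Un finite_imageI)
    also have "\<dots> \<le> card U + card W"
      using card_Un_le card_image_le[OF fin(2)] by (meson add_left_mono le_trans)
    also have "\<dots> = card (U \<union> W) + card P"
      unfolding P_def by (rule card_Un_Int[OF fin(1,2)])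
    finally have "k + 1 \<le> card (U \<union> W) + card P" .
    moreover have "card A = k - card (U \<union> W)"
      unfolding A_def using fin by (subst card_Diff_subset) (auto simp: U_def W_def)
    moreover have "card (U \<union> W) \<le> k"
      using card_mono[of "{..<k}" "U \<union> W"] by (auto simp: U_def W_def)
    ultimately show ?thesis by simp
  qed
  have Pk: "j < k" "j < n" if "j \<in> P" for j using that k by (auto simp: P_def U_def)
  have "\<exists>a b. \<forall>j \<in> P. a j < K \<and> col (a j) = c \<and> x (a j) = j \<and> b j < K \<and> col (b j) = c \<and> x (b j) = n + j"
  proof -
    have "\<forall>j \<in> P. \<exists>q. q < K \<and> col q = c \<and> x q = j" by (auto simp: P_def U_def)
    moreover have "\<forall>j \<in> P. \<exists>q. q < K \<and> col q = c \<and> x q = n + j" by (auto simp: P_def W_def)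
    ultimately show ?thesis by metis
  qed
  then obtain a b where ab: "\<And>j. j \<in> P \<Longrightarrow> a j < K" "\<And>j. j \<in> P \<Longrightarrow> col (a j) = c" "\<And>j. j \<in> P \<Longrightarrow> x (a j) = j"
    "\<And>j. j \<in> P \<Longrightarrow> b j < K" "\<And>j. j \<in> P \<Longrightarrow> col (b j) = c" "\<And>j. j \<in> P \<Longrightarrow> x (b j) = n + j" by blast
  define xs where "xs = subst_pairs c P"
  define \<psi> where "\<psi> h = t (fill (xs h))" for h
  have xs_a: "xs h (a j) = h j" if "j \<in> P" for h j
    using that ab by (simp add: xs_def subst_pairs_def)
  have xs_b: "xs h (b j) = n + h j" if "j \<in> P" for h j
  proof -
    have "n + j \<notin> P" using Pk by fastforce
    then show ?thesis using that ab by (simp add: xs_def subst_pairs_def)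
  qed
  have xs_other: "xs h q = x q" if "q < K" "\<And>j. j \<in> P \<Longrightarrow> q \<noteq> a j \<and> q \<noteq> b j" for h q
  proof (cases "col q = c")
    case True
    have "x q \<notin> P"
    proof
      assume "x q \<in> P"
      then have "q = a (x q)" using ab(1-3)[of "x q"] True that(1) \<open>x q \<in> P\<close> by - (rule col_inj[of q "a (x q)"], simp_all)
      moreover have "q \<noteq> a (x q)" using that(2)[OF \<open>x q \<in> P\<close>] by (rule conjunct1)
      ultimately show False by contradiction
    qed
    moreover have "\<not> (n \<le> x q \<and> x q - n \<in> P)"
    proof
      assume *: "n \<le> x q \<and> x q - n \<in> P"
      then have xP: "x q - n \<in> P" by simp
      then have "x (b (x q - n)) = x q" using ab(6)[OF xP] * by simp
      then have "q = b (x q - n)" using xP ab(4,5)[of "x q - n"] True that(1) by - (rule col_inj[of q "b (x q - n)"], simp_all)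
      moreover have "q \<noteq> b (x q - n)" using that(2)[OF xP] by (rule conjunct2)
      ultimately show False by contradiction
    qed
    ultimately show ?thesis by (auto simp add: xs_def subst_pairs_def)
  qed (simp add: xs_def subst_pairs_def)
  have ab_ne: "a i \<noteq> b j" if "i \<in> P" "j \<in> P" for i j
    using that ab(3)[of i] ab(6)[of j] Pk(2)[of i] by (metis leD le_add1)
  have a_inj: "a i = a j \<longleftrightarrow> i = j" "b i = b j \<longleftrightarrow> i = j" if "i \<in> P" "j \<in> P" for i j
    by (metis ab(3) that, metis ab(6) that add_left_cancel)
  have xs_eqI: "fill (xs h) = fill y"
    if "\<And>j. j \<in> P \<Longrightarrow> y (a j) = h j" "\<And>j. j \<in> P \<Longrightarrow> y (b j) = n + h j"
      "\<And>q. q < K \<Longrightarrow> (\<And>j. j \<in> P \<Longrightarrow> q \<noteq> a j \<and> q \<noteq> b j) \<Longrightarrow> y q = x q" for h y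
  proof (rule fill_cong)
    fix q assume q: "q < K"
    show "xs h q = y q"
    proof (cases "\<exists>j\<in>P. q = a j \<or> q = b j")
      case True
      then show ?thesis using that(1,2) xs_a xs_b by auto
    next
      case False
      then show ?thesis using that(3)[OF q] xs_other[OF q] by auto
    qed
  qed
  have xs_letters: "letters (xs h)" if hn: "\<And>j. j \<in> P \<Longrightarrow> h j < n" for h
  proof -
    have "xs h q < N" if "q < K" for q
      using x(1) that hn[of "x q"] hn[of "x q - n"]
      by (auto simp: xs_def subst_pairs_def letters_def N_def)
    then show ?thesis by (simp add: letters_def)
  qed
  have \<psi>_repeat: "\<psi> h = 0" if "q < K" "q' < K" "q \<noteq> q'" "col q = c" "col q' = c" "xs h q = xs h q'" for h q q'
    unfolding \<psi>_def using that by (intro GL_rep_repeat[OF t_GL, of q q']) auto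
  have \<psi>_noninj: "\<psi> h = 0" if ninj: "\<not> inj_on h P" for h
  proof -
    obtain i j where ij: "i \<in> P" "j \<in> P" "i \<noteq> j" "h i = h j" using ninj by (auto simp: inj_on_def)
    then show ?thesis using \<psi>_repeat[of "a i" "a j" h] ab xs_a a_inj by auto
  qed
  \<comment> \<open>This explains the base 2 in \<open>content\<close>: the letters at
    \<open>Q\<close> have distinct ranks at most 2 k, so their powers sum to less than 2^(2 k + 1),
    a value that a single letter of a pair with index at least k already reaches.\<close>
  have \<psi>_large: "\<psi> h = 0" if h: "\<And>j. j \<in> P \<Longrightarrow> h j < n" and j: "j \<in> P" "k \<le> h j" for h j
  proof -
    define Q where "Q = a ` P \<union> b ` P"
    define R where "R = {..<K} - Q"
    have Q: "finite Q" "Q \<subseteq> {..<K}" "\<And>q. q \<in> Q \<Longrightarrow> col q = c" using ab fin by (auto simp: Q_def)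
    have K: "{..<K} = R \<union> Q" "R \<inter> Q = {}" "finite R" using Q by (auto simp: R_def)
    have split: "content y = (\<Sum>p\<in>R. (col p + 1) * 2 ^ rank (y p)) + (c + 1) * (\<Sum>p\<in>Q. 2 ^ rank (y p))" for y
      unfolding content_def K(1) using K Q by (simp add: sum.union_disjoint sum_distrib_left)
    have "(\<Sum>p\<in>R. (col p + 1) * 2 ^ rank (xs h p)) = (\<Sum>p\<in>R. (col p + 1) * 2 ^ rank (x p))"
    proof (intro sum.cong refl)
      fix p assume "p \<in> R"
      then have "xs h p = x p" by (intro xs_other) (auto simp: R_def Q_def)
      then show "(col p + 1) * 2 ^ rank (xs h p) = (col p + 1) * 2 ^ rank (x p)" by simp
    qed
    moreover have "(\<Sum>p\<in>Q. 2 ^ rank (x p)) < (\<Sum>p\<in>Q. (2::nat) ^ rank (xs h p))"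
    proof -
      have geo: "(\<Sum>r<l. 2 ^ r) < (2::nat) ^ l" for l by (induction l) auto
      have rx: "rank (x q) \<le> 2 * k" if "q \<in> Q" for q
        using that ab Pk by (force simp: Q_def rank_def)
      have "inj_on (\<lambda>q. rank (x q)) Q"
      proof (rule inj_onI)
        fix q q' assume *: "q \<in> Q" "q' \<in> Q" "rank (x q) = rank (x q')"
        then have "x q < N" "x q' < N" using Q(2) x(1) by (auto simp: letters_def)
        then have "x q = x q'" using *(3) by (rule rank_inj)
        then show "q = q'" using Q(2) Q(3)[OF *(1)] Q(3)[OF *(2)] *(1,2) by (intro col_inj[of q q']) auto
      qed
      then have "(\<Sum>p\<in>Q. 2 ^ rank (x p)) = (\<Sum>r\<in>(\<lambda>q. rank (x q)) ` Q. (2::nat) ^ r)"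
        by (simp add: sum.reindex)
      also have "\<dots> \<le> (\<Sum>r<2 * k + 1. 2 ^ r)"
        using rx by (intro sum_mono2) (auto simp: less_Suc_eq_le)
      also have "\<dots> < 2 ^ (2 * k + 1)"
        using geo .
      also have "\<dots> \<le> 2 ^ rank (xs h (a j))"
        using j h[OF j(1)] xs_a[OF j(1), of h] by (intro power_increasing) (auto simp: rank_def)
      also have "\<dots> \<le> (\<Sum>p\<in>Q. 2 ^ rank (xs h p))"
        using Q(1) j(1) by (intro member_le_sum) (auto simp: Q_def)
      finally show ?thesis .
    qed
    ultimately have "content x < content (xs h)" unfolding split by (simp only: nat_add_left_cancel_less mult_less_cancel1) simp
    then show ?thesis unfolding \<psi>_def by (intro larger xs_letters h)
  qed
  \<comment> \<open>In the trace relation for slot i, an index y \<ge> k gives larger content, and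
    an index below k of which exactly one letter occurs in the column repeats that letter. Only
    \<open>P\<close> and \<open>A\<close> remain.\<close>
  have rel: "(\<Sum>y\<in>P. \<psi> (h(i := y))) = - (\<Sum>y\<in>A. \<psi> (h(i := y)))"
    if i: "i \<in> P" and h: "\<forall>j \<in> P - {i}. h j \<in> P \<union> A" for h i
  proof -
    have PA: "P \<union> A \<subseteq> {..<n}" "P \<inter> A = {}" using Pk k by (auto simp: A_def P_def)
    have "(\<Sum>y<n. \<psi> (h(i := y))) = (\<Sum>y<n. t (fill ((xs h)(a i := y, b i := n + y))))"
      unfolding \<psi>_def
    proof (intro sum.cong refl arg_cong[where f = t] xs_eqI)
      fix y
      show "((xs h)(a i := y, b i := n + y)) (a j) = (h(i := y)) j" if "j \<in> P" for j
        using that i ab_ne[of j i] a_inj[of j i] by (simp add: xs_a)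
      show "((xs h)(a i := y, b i := n + y)) (b j) = n + (h(i := y)) j" if "j \<in> P" for j
        using that i ab_ne[of i j] a_inj[of j i] by (auto simp add: xs_b)
      show "((xs h)(a i := y, b i := n + y)) q = x q" if "q < K" "\<And>j. j \<in> P \<Longrightarrow> q \<noteq> a j \<and> q \<noteq> b j" for q
        using that(2)[OF i] xs_other[OF that] by simp
    qed
    also have "\<dots> = 0"
      using i ab ab_ne[OF i i] by (intro trace_free_pairs[OF t_GL t_trace_free]) auto
    finally have "(\<Sum>y<n. \<psi> (h(i := y))) = 0" .
    moreover have "(\<Sum>y<n. \<psi> (h(i := y))) = (\<Sum>y\<in>P \<union> A. \<psi> (h(i := y)))"
    proof (rule sum.mono_neutral_right)
      show "\<forall>y\<in>{..<n} - (P \<union> A). \<psi> (h(i := y)) = 0"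
      proof
        fix y assume y: "y \<in> {..<n} - (P \<union> A)"
        show "\<psi> (h(i := y)) = 0"
        proof (cases "k \<le> y")
          case True
          have "(h(i := y)) j < n" if "j \<in> P" for j
            using that h PA y by (cases "j = i") auto
          then show ?thesis using True i by (intro \<psi>_large[of _ i]) auto
        next
          case False
          then have "(y \<in> U \<and> y \<notin> W) \<or> (y \<in> W \<and> y \<notin> U)" using y by (auto simp: A_def P_def)
          then show ?thesis
          proof
            assume yU: "y \<in> U \<and> y \<notin> W"
            then obtain q where q: "q < K" "col q = c" "x q = y" by (auto simp: U_def)
            have "q \<noteq> a j \<and> q \<noteq> b j" if "j \<in> P" for j
              using that yU q ab(3,6)[OF that] y by (auto simp: P_def)
            then have "xs (h(i := y)) q = y" "q \<noteq> a i" using q i xs_other[of q] by auto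
            then show ?thesis using q i ab(1,2)[OF i] xs_a[OF i]
              by (intro \<psi>_repeat[of q "a i"]) auto
          next
            assume yW: "y \<in> W \<and> y \<notin> U"
            then obtain q where q: "q < K" "col q = c" "x q = n + y" by (auto simp: W_def)
            have "q \<noteq> a j \<and> q \<noteq> b j" if "j \<in> P" for j
              using that yW q ab(3,6)[OF that] Pk[OF that] by (auto simp: P_def)
            then have "xs (h(i := y)) q = n + y" "q \<noteq> b i" using q i xs_other[of q] by auto
            then show ?thesis using q i ab(4,5)[OF i] xs_b[OF i]
              by (intro \<psi>_repeat[of q "b i"]) auto
          qed
        qed
      qed
    qed (use PA in auto)
    ultimately show ?thesis using PA fin by (simp add: sum.union_disjoint eq_neg_iff_add_eq_0)
  qed
  \<comment> \<open>Exchanging two pairs performs two transpositions in the column, so the signs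
    cancel.\<close>
  have \<psi>_perm: "\<psi> \<sigma> = \<psi> id" if "\<sigma> permutes P" for \<sigma>
    using fin(3) that
  proof (induction rule: permutes_rev_induct)
    case (swap i j \<sigma>)
    have bounds: "a i < K" "a j < K" "b i < K" "b j < K" "col (a i) = col (a j)" "col (b i) = col (b j)"
      "a i \<noteq> a j" "b i \<noteq> b j"
      using swap ab a_inj by auto
    have "fill (xs (\<sigma> \<circ> swap i j)) = fill (xs \<sigma> \<circ> swap (a i) (a j) \<circ> swap (b i) (b j))"
    proof (rule xs_eqI)
      show "(xs \<sigma> \<circ> swap (a i) (a j) \<circ> swap (b i) (b j)) (a l) = (\<sigma> \<circ> swap i j) l" if "l \<in> P" for l
        using that swap ab_ne a_inj by (auto simp: Transposition.transpose_def xs_a)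
      show "(xs \<sigma> \<circ> swap (a i) (a j) \<circ> swap (b i) (b j)) (b l) = n + (\<sigma> \<circ> swap i j) l" if "l \<in> P" for l
        using that swap ab_ne[symmetric] a_inj by (auto simp: Transposition.transpose_def xs_b)
      show "(xs \<sigma> \<circ> swap (a i) (a j) \<circ> swap (b i) (b j)) q = x q" if "q < K" "\<And>j. j \<in> P \<Longrightarrow> q \<noteq> a j \<and> q \<noteq> b j" for q
        using that swap xs_other[OF that] by (auto simp: Transposition.transpose_def)
    qed
    then have "\<psi> (\<sigma> \<circ> swap i j) = \<psi> \<sigma>"
      using GL_rep_swap[OF t_GL bounds(1,2,7,5), of "xs \<sigma>"]
        GL_rep_swap[OF t_GL bounds(3,4,8,6), of "xs \<sigma> \<circ> swap (a i) (a j)"] by (simp add: \<psi>_def)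
    then show ?case using swap.IH by (rule trans)
  qed (rule refl)
  have \<psi>_id: "\<psi> id = t (fill x)"
    unfolding \<psi>_def using ab by (intro arg_cong[where f = t] xs_eqI) auto
  have \<psi>_inj: "\<psi> h = t (fill x)" if h: "h \<in> PiE P (\<lambda>_. P)" "inj_on h P" for h
  proof -
    define \<sigma> where "\<sigma> = (\<lambda>j. if j \<in> P then h j else j)"
    have "\<sigma> permutes P"
      using h fin(3) by (intro inj_imp_permutes) (auto simp: \<sigma>_def inj_on_def)
    moreover have "\<psi> h = \<psi> \<sigma>"
      unfolding \<psi>_def by (intro arg_cong[where f = t] xs_eqI) (auto simp: \<sigma>_def xs_a xs_b xs_other)
    ultimately show ?thesis using \<psi>_perm \<psi>_id by simp
  qed
  have "(\<Sum>h\<in>PiE P (\<lambda>_. P). \<psi> h) = (- 1) ^ card P * (\<Sum>h\<in>PiE P (\<lambda>_. A). \<psi> h)"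
  proof -
    have "PiE P (\<lambda>j. if j \<in> P then A else P) = PiE P (\<lambda>_. A)" by (intro PiE_cong) simp
    then show ?thesis using slot_exchange[OF fin(3) order_refl, of P A \<psi>] rel by simp
  qed
  moreover have "\<psi> h = 0" if "h \<in> PiE P (\<lambda>_. A)" for h
  proof (rule \<psi>_noninj)
    show "\<not> inj_on h P"
    proof
      assume "inj_on h P"
      then have "card P \<le> card A" using that fin by (intro card_inj_on_le[of h]) auto
      then show False using \<open>card A < card P\<close> by simp
    qed
  qed
  ultimately have "(\<Sum>h\<in>PiE P (\<lambda>_. P). \<psi> h) = 0" by simp
  \<comment> \<open>A self-map of \<open>P\<close> that is not injective repeats a letter; every
    injective one contributes \<open>t (fill x)\<close>, and the identity is among them.\<close>
  moreover have "(\<Sum>h\<in>PiE P (\<lambda>_. P). \<psi> h) = (\<Sum>h\<in>{h \<in> PiE P (\<lambda>_. P). inj_on h P}. t (fill x))"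
    using \<psi>_noninj \<psi>_inj fin(3) by (intro sum.mono_neutral_cong_right finite_PiE) auto
  ultimately have "of_nat (card {h \<in> PiE P (\<lambda>_. P). inj_on h P}) * t (fill x) = 0" by simp
  moreover have "restrict id P \<in> {h \<in> PiE P (\<lambda>_. P). inj_on h P}" by (auto simp: inj_on_def)
  moreover have "finite {h \<in> PiE P (\<lambda>_. P). inj_on h P}"
    using fin(3) by (simp add: finite_PiE)
  ultimately have "card {h \<in> PiE P (\<lambda>_. P). inj_on h P} \<noteq> 0 \<and> of_nat (card {h \<in> PiE P (\<lambda>_. P). inj_on h P}) * t (fill x) = 0"
    using card_0_eq by blast
  then show ?thesis by (metis mult_eq_0_iff of_nat_eq_0_iff)
qed

lemma nonstandard_straighten:
  assumes "\<And>y. standard y \<Longrightarrow> t (fill y) = 0"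
  shows "t (fill x) = 0"
proof (cases "standard x")
  case False
  then consider p q where "p < K" "q < K" "row p = row q" "col p \<le> col q" "rank (x q) < rank (x p)"
    | p where "p < K" "rank (x p) + 1 < 2 * row p"
    using x by (auto simp: standard_def not_le)
  then show ?thesis by cases (auto intro: row_straighten king_straighten)
qed (use assms in auto)

end

text \<open>Descending induction on \<open>content\<close>, which is bounded: a filling with a
  repeated letter in a column gives 0, and any other is first sorted by a column permutation, which
  keeps the content, and then straightened.\<close>

theorem V0_determined:
  assumes t: "t \<in> V0" and std: "\<And>y. standard y \<Longrightarrow> t (fill y) = 0"
  shows "t = (\<lambda>w. 0)"
proof -
  define B where "B = (\<Sum>p<K. (col p + 1) * 2 ^ (2 * n + 1))"
  have zero: "t (fill x) = 0" if "letters x" for x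
    using that
  proof (induction "B - content x" arbitrary: x rule: less_induct)
    case less
    have IH: "t (fill y) = 0" if "letters y" "content x < content y" for y
      using less(1)[of y] that content_bound[of y] by (auto simp: B_def)
    show ?case
    proof (cases "\<exists>p q. p < K \<and> q < K \<and> col p = col q \<and> x p = x q \<and> p \<noteq> q")
      case True
      then show ?thesis using GL_rep_repeat[of t _ _ x] t by (auto simp: V0_iff)
    next
      case False
      then obtain \<pi> where \<pi>: "\<pi> \<in> label_group col" "column_strict (x \<circ> \<pi>)"
        using exists_column_strict[OF less(2)] by blast
      have l: "letters (x \<circ> \<pi>)" using letters_perm[OF label_groupD(1)[OF \<pi>(1)]] less(2) by simp
      have "t (fill (x \<circ> \<pi>)) = 0"
        using t l \<pi>(2) IH std by (rule nonstandard_straighten) (simp_all add: content_column_perm[OF \<pi>(1)])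
      then show ?thesis using GL_rep_column_sign[of t \<pi> x] t \<pi>(1) by (simp add: V0_iff)
    qed
  qed
  show ?thesis
  proof
    fix w show "t w = 0"
    proof (cases "w \<in> words N K")
      case True
      then show ?thesis using words_fill zero by auto
    next
      case False
      then show ?thesis using V0_carrier[OF t] by (simp add: tensor_space_def)
    qed
  qed
qed

section \<open>Gelfand-Tsetlin patterns and the polytope\<close>

text \<open>The root \<open>\<alpha>\<close> is placed at row \<open>root_row \<alpha>\<close> and level \<open>level \<alpha>\<close> of a pattern; the levels of row \<open>i\<close>
  run from \<open>2 i - 1\<close> to \<open>2 n\<close>, and the arrows decrease the level by one or increase row and level by
  one.\<close>

definition root_row :: "root \<Rightarrow> nat" where
  "root_row \<alpha> = (case \<alpha> of Rt i j \<Rightarrow> i | Rtb i j \<Rightarrow> i)"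

definition level :: "root \<Rightarrow> nat" where
  "level \<alpha> = (case \<alpha> of Rt i j \<Rightarrow> 2 * n + i - j | Rtb i j \<Rightarrow> i + j - 1)"

definition root_at :: "nat \<Rightarrow> nat \<Rightarrow> root" where
  "root_at i k = (if n + i \<le> k then Rt i (2 * n + i - k) else Rtb i (k + 1 - i))"

lemma poset_level:
  assumes "\<alpha> \<in> poset n"
  shows "1 \<le> root_row \<alpha>" "root_row \<alpha> \<le> n" "2 * root_row \<alpha> \<le> level \<alpha> + 1" "level \<alpha> \<le> 2 * n"
    "root_at (root_row \<alpha>) (level \<alpha>) = \<alpha>"
  using assms by (auto simp: poset_def root_row_def level_def root_at_def)

lemma root_at:
  assumes "1 \<le> i" "i \<le> n" "2 * i \<le> k + 1" "k \<le> 2 * n"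
  shows "root_at i k \<in> poset n" "root_row (root_at i k) = i" "level (root_at i k) = k"
  using assms by (auto simp: poset_def root_row_def level_def root_at_def)

lemma arrow_level:
  "arrow n \<alpha> \<beta> \<Longrightarrow> (root_row \<beta> = root_row \<alpha> \<and> level \<alpha> = level \<beta> + 1) \<or>
     (root_row \<beta> = root_row \<alpha> + 1 \<and> level \<beta> = level \<alpha> + 1)"
  by (induction rule: arrow.induct) (auto simp: root_row_def level_def)

lemma arrow_row: "1 \<le> i \<Longrightarrow> i \<le> n \<Longrightarrow> 2 * i \<le> k \<Longrightarrow> k \<le> 2 * n \<Longrightarrow> arrow n (root_at i k) (root_at i (k - 1))"
proof -
  assume a: "1 \<le> i" "i \<le> n" "2 * i \<le> k" "k \<le> 2 * n"
  consider "n + i < k" | "k = n + i" | "k < n + i" by linarith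
  then show ?thesis
  proof cases
    case 1
    then show ?thesis using a arrow.intros(1)[of i "2 * n + i - k" n] by (auto simp: root_at_def Suc_diff_le)
  next
    case 2
    then show ?thesis using a arrow.intros(2)[of i n] by (auto simp: root_at_def)
  next
    case 3
    then show ?thesis using a arrow.intros(3)[of i "k - i" n] by (auto simp: root_at_def Suc_diff_le)
  qed
qed

lemma arrow_diag:
  assumes "1 \<le> i" "i \<le> n" "2 * i \<le> k" "k < 2 * n"
  shows "arrow n (root_at i k) (root_at (i + 1) (k + 1))"
  using assms arrow.intros(4)[of i "2 * n + i - k" n] arrow.intros(5)[of i "k + 1 - i" n]
  by (auto simp: root_at_def)

text \<open>Read \<open>X i k\<close> as the number of entries of rank at most k in row i of a
  tableau: the diagonal inequality is then column strictness and the zeros are King's row condition.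
  The boundary values 0 and \<open>lam i\<close> are part of \<open>X\<close>, so the transfer
  formula needs no boundary cases.\<close>

definition pattern :: "(nat \<Rightarrow> nat \<Rightarrow> nat) \<Rightarrow> bool" where
  "pattern X \<longleftrightarrow> (\<forall>i k. 1 \<le> i \<longrightarrow> (k + 1 < 2 * i \<longrightarrow> X i k = 0) \<and> (2 * n < k \<longrightarrow> X i k = lam i) \<and>
     X i k \<le> X i (k + 1) \<and> X (i + 1) (k + 1) \<le> X i k)"

lemma patternD:
  assumes "pattern X" "1 \<le> i"
  shows "k + 1 < 2 * i \<Longrightarrow> X i k = 0" "2 * n < k \<Longrightarrow> X i k = lam i"
    "X i k \<le> X i (k + 1)" "X (i + 1) (k + 1) \<le> X i k"
  using assms unfolding pattern_def by blast+

lemma pattern_row_mono: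
  assumes "pattern X" "1 \<le> i" "k \<le> k'"
  shows "X i k \<le> X i k'"
  using assms(3) lift_Suc_mono_le[of "X i"] patternD(3)[OF assms(1,2)] by simp

lemma pattern_diag_mono:
  assumes "pattern X" "1 \<le> i"
  shows "X (i + r) (k + r) \<le> X i k"
proof (induction r)
  case (Suc r)
  then show ?case using patternD(4)[OF assms(1), of "i + r" "k + r"] assms(2) by simp
qed simp

text \<open>The transfer map between marked order polytopes and marked chain polytopes.\<close>

definition transfer :: "(nat \<Rightarrow> nat \<Rightarrow> nat) \<Rightarrow> root \<Rightarrow> nat" where
  "transfer X \<alpha> = (if \<alpha> \<in> poset n then X (root_row \<alpha>) (level \<alpha>) -
     max (X (root_row \<alpha>) (level \<alpha> - 1)) (X (root_row \<alpha> + 1) (level \<alpha> + 1)) else 0)"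

lemma transfer_add:
  assumes "pattern X" "\<alpha> \<in> poset n"
  shows "transfer X \<alpha> + max (X (root_row \<alpha>) (level \<alpha> - 1)) (X (root_row \<alpha> + 1) (level \<alpha> + 1)) = X (root_row \<alpha>) (level \<alpha>)"
  using patternD(4)[OF assms(1), of "root_row \<alpha>" "level \<alpha>"] pattern_row_mono[OF assms(1), of "root_row \<alpha>" "level \<alpha> - 1" "level \<alpha>"]
    poset_level(1)[OF assms(2)] assms(2) by (simp add: transfer_def)

text \<open>Telescoping: the value of \<open>X\<close> at the target of an arrow is one of the two
  values under the max at its source.\<close>

lemma transfer_path:
  assumes "pattern X" "successively (arrow n) p" "set p \<subseteq> poset n" "p \<noteq> []"
  shows "sum (transfer X) (set p) + max (X (root_row (last p)) (level (last p) - 1)) (X (root_row (last p) + 1) (level (last p) + 1))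
    \<le> X (root_row (hd p)) (level (hd p))"
  using assms(2-4)
proof (induction p)
  case (Cons \<alpha> p)
  show ?case
  proof (cases p)
    case Nil
    then show ?thesis using transfer_add[OF assms(1), of \<alpha>] Cons.prems by simp
  next
    case (Cons \<beta> p')
    have ar: "arrow n \<alpha> \<beta>" and \<alpha>: "\<alpha> \<in> poset n" using Cons.prems Cons by auto
    have "X (root_row \<beta>) (level \<beta>) \<le> max (X (root_row \<alpha>) (level \<alpha> - 1)) (X (root_row \<alpha> + 1) (level \<alpha> + 1))"
      using arrow_level[OF ar] by auto
    moreover have "sum (transfer X) (set (\<alpha> # p)) \<le> transfer X \<alpha> + sum (transfer X) (set p)"
      by (cases "\<alpha> \<in> set p") (auto simp: insert_absorb)
    ultimately show ?thesis
      using Cons.IH Cons.prems Cons transfer_add[OF assms(1) \<alpha>] by (auto simp: successively_Cons)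
  qed
qed simp

lemma lam_split: "i \<le> j \<Longrightarrow> j \<le> n \<Longrightarrow> lam i = (\<Sum>l = i..j. m l) + lam (j + 1)"
  unfolding part_def using sum.ub_add_nat[of i j m "n - j"] by simp

lemma FFLV_int_iff:
  "s \<in> FFLV_int n m \<longleftrightarrow> (\<forall>\<alpha>. \<alpha> \<notin> poset n \<longrightarrow> s \<alpha> = 0) \<and>
     (\<forall>p i j. dyck_path n p \<and> hd p = Rt i i \<longrightarrow>
        (last p = Rt j j \<longrightarrow> sum s (set p) \<le> (\<Sum>l = i..j. m l)) \<and>
        (last p = Rtb j j \<longrightarrow> sum s (set p) \<le> lam i))"
  unfolding FFLV_int_def FFLV_def part_def
  by (simp add: of_nat_sum[symmetric] del: of_nat_sum)

text \<open>At the end \<open>Rt j j\<close> of a path, which has level 2 n, the remaining max is at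
  least the boundary value \<open>lam (j + 1)\<close>. This improves the bound \<open>lam i\<close>
  to the sum of the m from i to j.\<close>

lemma transfer_FFLV:
  assumes X: "pattern X"
  shows "transfer X \<in> FFLV_int n m"
  unfolding FFLV_int_iff
proof (intro conjI allI impI; (elim conjE)?)
  fix p i j assume p: "dyck_path n p" "hd p = Rt i i"
  have ne: "p \<noteq> []" and set: "set p \<subseteq> poset n" and suc: "successively (arrow n) p"
    using p by (auto simp: dyck_path_def)
  have "Rt i i \<in> poset n" using hd_in_set[OF ne] set p(2) by auto
  then have i: "1 \<le> i" "i \<le> n" by (auto simp: poset_def)
  have "X (root_row (hd p)) (level (hd p)) = X i (2 * n)" by (simp add: p root_row_def level_def)
  also have "\<dots> \<le> lam i" using patternD(2,3)[OF X i(1), of "2 * n"] patternD(2)[OF X i(1), of "2 * n + 1"] by simp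
  finally have b: "sum (transfer X) (set p) + max (X (root_row (last p)) (level (last p) - 1)) (X (root_row (last p) + 1) (level (last p) + 1)) \<le> lam i"
    using transfer_path[OF X suc set ne] by linarith
  show "sum (transfer X) (set p) \<le> lam i" using b by linarith
  assume l: "last p = Rt j j"
  have "i \<le> j" using p l by (auto simp: dyck_path_def)
  have "Rt j j \<in> poset n" using last_in_set[OF ne] set l by auto
  then have j: "j \<le> n" by (auto simp: poset_def)
  have "X (root_row (last p) + 1) (level (last p) + 1) = lam (j + 1)"
    using patternD(2)[OF X, of "j + 1"] by (simp add: l root_row_def level_def)
  then show "sum (transfer X) (set p) \<le> (\<Sum>l = i..j. m l)"
    using b lam_split[OF \<open>i \<le> j\<close> j] by linarith
qed (simp add: transfer_def)

text \<open>The value at (i, k) is recovered from its two neighbours under the max, and for both of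
  them k + 2 - 2 i, the distance from the zero region, is smaller.\<close>

lemma transfer_inj:
  assumes "pattern X" "pattern Y" "transfer X = transfer Y" "1 \<le> i"
  shows "X i k = Y i k"
  using assms(4)
proof (induction "k + 2 - 2 * i" arbitrary: i k rule: less_induct)
  case less
  consider "k + 1 < 2 * i" | "2 * n < k" | "2 * i \<le> k + 1" "k \<le> 2 * n" by linarith
  then show ?case
  proof cases
    case 3
    then have "i \<le> n" by simp
    note r = root_at[OF less(2) this 3]
    have "X i (k - 1) = Y i (k - 1)" using 3 less by (intro less(1)) auto
    moreover have "X (i + 1) (k + 1) = Y (i + 1) (k + 1)" using 3 less by (intro less(1)) auto
    ultimately show ?thesis
      using transfer_add[OF assms(1) r(1)] transfer_add[OF assms(2) r(1)] assms(3) r by simp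
  qed (use patternD(1,2)[OF assms(1) less(2)] patternD(1,2)[OF assms(2) less(2)] in auto)
qed

section \<open>From King tableaux to patterns\<close>

definition tableau_pattern :: "(nat \<Rightarrow> nat) \<Rightarrow> nat \<Rightarrow> nat \<Rightarrow> nat" where
  "tableau_pattern x i k = card {c. c < lam i \<and> rank (x (pos i c)) \<le> k}"

lemma tableau_pattern:
  assumes x: "standard x" shows "pattern (tableau_pattern x)"
  unfolding pattern_def
proof (intro allI impI conjI)
  fix i k :: nat assume i: "1 \<le> i"
  have cs: "rank (x p) < rank (x q)" if "p < K" "q < K" "col p = col q" "row p < row q" for p q
    using x that unfolding standard_def column_strict_def by blast
  show "tableau_pattern x i k = 0" if k: "k + 1 < 2 * i"
  proof -
    have "\<not> rank (x (pos i c)) \<le> k" if "c < lam i" for c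
    proof -
      have "2 * i \<le> rank (x (pos i c)) + 1" using x pos[OF i that] by (auto simp: standard_def)
      then show ?thesis using k by simp
    qed
    then have "{c. c < lam i \<and> rank (x (pos i c)) \<le> k} = {}" by blast
    then show ?thesis by (simp only: tableau_pattern_def card.empty)
  qed
  show "tableau_pattern x i k = lam i" if "2 * n < k"
  proof -
    have "rank a \<le> k" for a using rank_bounds(2)[of a] that by linarith
    then have "{c. c < lam i \<and> rank (x (pos i c)) \<le> k} = {..<lam i}" by auto
    then show ?thesis by (simp add: tableau_pattern_def)
  qed
  show "tableau_pattern x i k \<le> tableau_pattern x i (k + 1)"
    unfolding tableau_pattern_def by (rule card_mono) auto
  show "tableau_pattern x (i + 1) (k + 1) \<le> tableau_pattern x i k"
    unfolding tableau_pattern_def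
  proof (rule card_mono)
    show "{c. c < lam (i + 1) \<and> rank (x (pos (i + 1) c)) \<le> k + 1} \<subseteq> {c. c < lam i \<and> rank (x (pos i c)) \<le> k}"
    proof clarify
      fix c assume c: "c < lam (i + 1)" "rank (x (pos (i + 1) c)) \<le> k + 1"
      then have c': "c < lam i" using lam_antimono[of i "i + 1"] by simp
      then show "c < lam i \<and> rank (x (pos i c)) \<le> k"
        using c cs[of "pos i c" "pos (i + 1) c"] pos[OF i c'] pos[of "i + 1" c] by simp
    qed
  qed simp
qed

text \<open>Rows increase weakly, so the boxes of row i with rank at most k form an initial segment.
  Hence the pattern determines the tableau.\<close>

lemma tableau_pattern_less:
  assumes "standard x" "1 \<le> i" "c < lam i"
  shows "rank (x (pos i c)) \<le> k \<longleftrightarrow> c < tableau_pattern x i k"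
proof -
  define S where "S = {c. c < lam i \<and> rank (x (pos i c)) \<le> k}"
  have down: "c' \<in> S" if "c \<in> S" "c' \<le> c" for c c'
  proof -
    have c: "c < lam i" "c' < lam i" using that by (auto simp: S_def)
    have "rank (x (pos i c')) \<le> rank (x (pos i c))"
      using assms(1) pos[OF assms(2) c(1)] pos[OF assms(2) c(2)] that(2) by (auto simp: standard_def)
    then show ?thesis using that c by (auto simp: S_def)
  qed
  have fin: "finite S" by (simp add: S_def)
  have "S = {..<card S}"
  proof (cases "S = {}")
    case False
    have "S = {..Max S}" using down fin False by (auto intro: Max_in)
    then show ?thesis by (metis card_atMost lessThan_Suc_atMost)
  qed simp
  moreover have "rank (x (pos i c)) \<le> k \<longleftrightarrow> c \<in> S" using assms(3) by (simp add: S_def)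
  ultimately show ?thesis by (metis S_def lessThan_iff tableau_pattern_def)
qed

definition standard_words :: "nat list set" where
  "standard_words = fill ` {x. standard x}"

lemma finite_standard_words: "finite standard_words"
proof -
  have "standard_words \<subseteq> {w. set w \<subseteq> {..<N} \<and> length w = K}"
    by (auto simp: standard_words_def standard_def letters_def)
  then show ?thesis using finite_lists_length_eq[of "{..<N}" K] finite_subset by blast
qed

theorem standard_words_inj: "\<exists>g. inj_on g standard_words \<and> g ` standard_words \<subseteq> FFLV_int n m"
proof -
  define g where "g w = transfer (tableau_pattern ((!) w))" for w
  have cong: "tableau_pattern ((!) (fill x)) i k = tableau_pattern x i k" if "1 \<le> i" for x i k
    using that unfolding tableau_pattern_def by (intro arg_cong[where f = card] Collect_cong) (auto simp: pos)
  have st: "standard ((!) (fill x))" if "standard x" for x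
    using that by (auto simp: standard_def letters_def column_strict_def)
  have "g (fill x) \<in> FFLV_int n m" if "standard x" for x
    unfolding g_def by (intro transfer_FFLV tableau_pattern st that)
  moreover have "fill x = fill y" if xy: "standard x" "standard y" "g (fill x) = g (fill y)" for x y
  proof (rule fill_cong)
    fix p assume p: "p < K"
    have eq: "tableau_pattern x i k = tableau_pattern y i k" if "1 \<le> i" for i k
      using transfer_inj[OF tableau_pattern[OF st[OF xy(1)]] tableau_pattern[OF st[OF xy(2)]] _ that, of k] xy(3) cong[OF that]
      by (simp add: g_def)
    have "rank (x p) \<le> k \<longleftrightarrow> rank (y p) \<le> k" for k
      using tableau_pattern_less[OF xy(1) box_bounds(1,3)[OF p], of k]
        tableau_pattern_less[OF xy(2) box_bounds(1,3)[OF p], of k] eq[OF box_bounds(1)[OF p]]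
      by (simp add: pos_row_col[OF p])
    then have "rank (x p) = rank (y p)" by (metis order.eq_iff)
    then show "x p = y p" using rank_inj xy p by (auto simp: standard_def letters_def)
  qed
  ultimately show ?thesis by (intro exI[of _ g]) (auto simp: standard_words_def inj_on_def)
qed

text \<open>The inverse of \<open>transfer\<close>, obtained by solving its formula for the value at
  (i, k). Row 0 is set to 0 because the termination measure would not drop there at k = 0.\<close>

function pattern_of :: "(root \<Rightarrow> nat) \<Rightarrow> nat \<Rightarrow> nat \<Rightarrow> nat" where
  "pattern_of s i k = (if k + 1 < 2 * i \<or> i = 0 then 0 else if 2 * n < k then lam i else
     s (root_at i k) + max (pattern_of s i (k - 1)) (pattern_of s (i + 1) (k + 1)))"
  by pat_completeness auto
termination by (relation "Wellfounded.measure (\<lambda>(s, i, k). k + 2 - 2 * i)") auto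

declare pattern_of.simps [simp del]

lemma pattern_of_zero: "k + 1 < 2 * i \<Longrightarrow> pattern_of s i k = 0"
  by (subst pattern_of.simps) simp

lemma pattern_of_top: "1 \<le> i \<Longrightarrow> 2 * n < k \<Longrightarrow> pattern_of s i k = lam i"
  by (subst pattern_of.simps) (auto simp: lam_beyond)

text \<open>Following the larger of the two neighbours traces a path along which all maxima are
  attained. It stops at \<open>Rtb j j\<close>, with boundary value 0, or at \<open>Rt j j\<close>,
  with boundary value \<open>lam (j + 1)\<close>. The bound on level minus twice the row keeps a new
  vertex off the rest of the path, so the sum over the set counts every vertex once.\<close>

lemma pattern_of_path:
  assumes "1 \<le> i" "i \<le> n" "2 * i \<le> k + 1" "k \<le> 2 * n"
  shows "\<exists>p j. p \<noteq> [] \<and> set p \<subseteq> poset n \<and> successively (arrow n) p \<and> hd p = root_at i k \<and> i \<le> j \<and> j \<le> n \<and>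
     (\<forall>\<alpha> \<in> set p. level \<alpha> + 2 * i \<le> k + 2 * root_row \<alpha>) \<and>
     ((last p = Rt j j \<and> sum s (set p) + lam (j + 1) = pattern_of s i k) \<or>
      (last p = Rtb j j \<and> sum s (set p) = pattern_of s i k))"
  using assms
proof (induction "k + 2 - 2 * i" arbitrary: i k rule: less_induct)
  case less
  note i = less(2-5)
  note r = root_at[OF i]
  have rec: "pattern_of s i k = s (root_at i k) + max (pattern_of s i (k - 1)) (pattern_of s (i + 1) (k + 1))"
    using i by (subst pattern_of.simps) simp
  have extend: ?case if ext: "i' \<le> n" "1 \<le> i'" "2 * i' \<le> k' + 1" "k' \<le> 2 * n" "i \<le> i'" "k' + 2 * i < k + 2 * i'"
    "arrow n (root_at i k) (root_at i' k')" "pattern_of s i k = s (root_at i k) + pattern_of s i' k'" for i' k'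
  proof -
    have "k' + 2 - 2 * i' < k + 2 - 2 * i" using ext i by linarith
    from less(1)[OF this ext(2,1,3,4)] obtain p j where
      pj: "p \<noteq> [] \<and> set p \<subseteq> poset n \<and> successively (arrow n) p \<and> hd p = root_at i' k' \<and> i' \<le> j \<and> j \<le> n \<and>
     (\<forall>\<alpha> \<in> set p. level \<alpha> + 2 * i' \<le> k' + 2 * root_row \<alpha>) \<and>
     ((last p = Rt j j \<and> sum s (set p) + lam (j + 1) = pattern_of s i' k') \<or>
      (last p = Rtb j j \<and> sum s (set p) = pattern_of s i' k'))"
      by (elim exE) (rule that)
    then have p: "p \<noteq> []" "set p \<subseteq> poset n" "successively (arrow n) p" "hd p = root_at i' k'" "i' \<le> j" "j \<le> n"
      "\<forall>\<alpha> \<in> set p. level \<alpha> + 2 * i' \<le> k' + 2 * root_row \<alpha>"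
      "(last p = Rt j j \<and> sum s (set p) + lam (j + 1) = pattern_of s i' k') \<or> (last p = Rtb j j \<and> sum s (set p) = pattern_of s i' k')"
      by simp_all
    have "root_at i k \<notin> set p" using p(7) r ext by force
    then have "sum s (set (root_at i k # p)) = s (root_at i k) + sum s (set p)" by simp
    moreover have "\<forall>\<alpha> \<in> set p. level \<alpha> + 2 * i \<le> k + 2 * root_row \<alpha>" using p(7) ext(6) by fastforce
    ultimately show ?thesis
      using p ext r by (intro exI[of _ "root_at i k # p"] exI[of _ j]) (auto simp: successively_Cons)
  qed
  consider "k + 1 = 2 * i" | "2 * i \<le> k" "pattern_of s (i + 1) (k + 1) \<le> pattern_of s i (k - 1)"
    | "2 * i \<le> k" "pattern_of s i (k - 1) \<le> pattern_of s (i + 1) (k + 1)" "k < 2 * n"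
    | "pattern_of s i (k - 1) \<le> pattern_of s (i + 1) (k + 1)" "k = 2 * n"
    using i by linarith
  then show ?case
  proof cases
    case 1
    have "pattern_of s i (k - 1) = 0" "pattern_of s (i + 1) (k + 1) = 0"
      using 1 i by - (rule pattern_of_zero; presburger)+
    moreover have "root_at i k = Rtb i i" using 1 i by (auto simp: root_at_def)
    ultimately show ?thesis using i rec r by (intro exI[of _ "[root_at i k]"] exI[of _ i]) auto
  next
    case 2
    then show ?thesis using i rec by (intro extend[of i "k - 1"] arrow_row) auto
  next
    case 3
    then show ?thesis using i rec by (intro extend[of "i + 1" "k + 1"] arrow_diag) auto
  next
    case 4
    have "pattern_of s (i + 1) (k + 1) = lam (i + 1)"
      using 4 by (intro pattern_of_top) auto
    moreover have "root_at i k = Rt i i" using 4 i by (auto simp: root_at_def)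
    ultimately show ?thesis using 4 i rec r by (intro exI[of _ "[root_at i k]"] exI[of _ i]) auto
  qed
qed

text \<open>The step from level 2 n to the boundary is the one pattern inequality that the recursion
  does not supply; here the inequalities of the polytope enter.\<close>

lemma pattern_of_bound:
  assumes s: "s \<in> FFLV_int n m" and i: "1 \<le> i" "i \<le> n"
  shows "pattern_of s i (2 * n) \<le> lam i"
proof -
  obtain p j where p: "p \<noteq> []" "set p \<subseteq> poset n" "successively (arrow n) p" "hd p = root_at i (2 * n)" "i \<le> j" "j \<le> n"
    "(last p = Rt j j \<and> sum s (set p) + lam (j + 1) = pattern_of s i (2 * n)) \<or> (last p = Rtb j j \<and> sum s (set p) = pattern_of s i (2 * n))"
    using pattern_of_path[of i "2 * n" s] i by auto
  have h: "hd p = Rt i i" using p(4) i by (simp add: root_at_def)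
  have dy: "dyck_path n p" using p h unfolding dyck_path_def by blast
  have b: "last p = Rt j j \<Longrightarrow> sum s (set p) \<le> (\<Sum>l = i..j. m l)" "last p = Rtb j j \<Longrightarrow> sum s (set p) \<le> lam i"
    using s dy h unfolding FFLV_int_iff by blast+
  show ?thesis using p(7) b lam_split[OF p(5,6)] by auto
qed

theorem FFLV_pattern:
  assumes s: "s \<in> FFLV_int n m"
  shows "\<exists>X. pattern X \<and> transfer X = s"
proof (intro exI conjI)
  show "pattern (pattern_of s)"
    unfolding pattern_def
  proof (intro allI impI conjI)
    fix i k :: nat assume i: "1 \<le> i"
    show "k + 1 < 2 * i \<Longrightarrow> pattern_of s i k = 0"
      by (rule pattern_of_zero)
    show "2 * n < k \<Longrightarrow> pattern_of s i k = lam i"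
      using i by (rule pattern_of_top)
    show "pattern_of s i k \<le> pattern_of s i (k + 1)"
    proof -
      consider "k + 1 < 2 * i" | "2 * i \<le> k + 1" "k = 2 * n" | "2 * i \<le> k + 1" "k < 2 * n" | "2 * i \<le> k + 1" "2 * n < k" by linarith
      then show ?thesis
      proof cases
        case 1
        then show ?thesis by (simp add: pattern_of_zero)
      next
        case 2
        then have "i \<le> n" by simp
        moreover have "pattern_of s i (k + 1) = lam i" using 2 i by (simp add: pattern_of_top)
        ultimately show ?thesis using pattern_of_bound[OF s i] 2 by simp
      next
        case 3
        then show ?thesis using i by (subst (2) pattern_of.simps) simp
      next
        case 4
        then show ?thesis using i by (simp add: pattern_of_top)
      qed
    qed
    show "pattern_of s (i + 1) (k + 1) \<le> pattern_of s i k"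
    proof -
      consider "k + 1 < 2 * i" | "2 * i \<le> k + 1" "k \<le> 2 * n" | "2 * i \<le> k + 1" "2 * n < k" by linarith
      then show ?thesis
      proof cases
        case 1
        then show ?thesis by (simp add: pattern_of_zero)
      next
        case 2
        then show ?thesis using i by (subst (2) pattern_of.simps) simp
      next
        case 3
        then show ?thesis using i lam_antimono[of i "i + 1"] by (simp add: pattern_of_top)
      qed
    qed
  qed
  show "transfer (pattern_of s) = s"
  proof
    fix \<alpha>
    show "transfer (pattern_of s) \<alpha> = s \<alpha>"
    proof (cases "\<alpha> \<in> poset n")
      case True
      note a = poset_level[OF True]
      have "pattern_of s (root_row \<alpha>) (level \<alpha>) = s \<alpha> + max (pattern_of s (root_row \<alpha>) (level \<alpha> - 1)) (pattern_of s (root_row \<alpha> + 1) (level \<alpha> + 1))"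
        using a by (subst pattern_of.simps) simp
      then show ?thesis using True by (simp add: transfer_def)
    next
      case False
      then show ?thesis using s by (simp add: transfer_def FFLV_int_iff)
    qed
  qed
qed

section \<open>Entries of the root vectors\<close>

lemma root_weight_Rt:
  assumes "i \<le> j" "j < n" shows "root_weight n (Rt i j) l = eps i l - eps (j + 1) l"
proof -
  have "(\<Sum>r = i..j. eps r l - eps (r + 1) l) = eps i l - eps (j + 1) l"
    using assms(1) by (induction j rule: dec_induct) auto
  moreover have "(\<Sum>r = i..j. simple_root n r l) = (\<Sum>r = i..j. eps r l - eps (r + 1) l)"
    using assms by (intro sum.cong refl) (simp add: simple_root_def)
  ultimately show ?thesis using assms by simp
qed

lemma root_weight_Rtb:
  assumes "i \<le> j" "j \<le> n" shows "root_weight n (Rtb i j) l = eps i l + eps j l"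
proof -
  have tel: "(\<Sum>r = a..<n. simple_root n r l) = eps a l - eps n l" if "a \<le> n" for a
  proof -
    have "(\<Sum>r = a..<n. simple_root n r l) = (\<Sum>r = a..<n. eps r l - eps (Suc r) l)"
      by (intro sum.cong refl) (simp add: simple_root_def)
    also have "\<dots> = eps a l - eps n l"
      using sum_Suc_diff'[OF that, of "\<lambda>r. - eps r l"] by (simp add: algebra_simps)
    finally show ?thesis .
  qed
  have "{i..n} = insert n {i..<n}" using assms by auto
  then have "(\<Sum>r = i..n. simple_root n r l) = simple_root n n l + (\<Sum>r = i..<n. simple_root n r l)" by simp
  then show ?thesis using tel[of i] tel[of j] assms by (simp add: simple_root_def)
qed

definition letter_weight :: "nat \<Rightarrow> nat \<Rightarrow> int" where
  "letter_weight a l = (if a < n then eps (a + 1) l else if a < 2 * n then - eps (a - n + 1) l else 0)"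

lemma cartan_entry:
  assumes "a < N" "b < N"
  shows "cartan n h $$ (b, a) = (if a = b then \<Sum>l = 1..n. of_int (letter_weight a l) * h l else 0)"
proof -
  have "cartan n h $$ (b, a) = (\<Sum>i = 1..n. h i * (matrix_unit N i i - matrix_unit N (n + i) (n + i)) $$ (b, a))"
    using assms by (simp add: cartan_def N_def)
  also have "\<dots> = (\<Sum>i = 1..n. if a = b then of_int (letter_weight a i) * h i else 0)"
    using assms by (intro sum.cong refl) (auto simp: matrix_unit_def letter_weight_def eps_def N_def)
  finally show ?thesis by simp
qed

lemma sp_entry:
  assumes "X \<in> sp_odd n" "c < N" "d < N"
  shows "(\<Sum>a<N. X $$ (a, c) * omega n $$ (a, d)) + (\<Sum>a<N. omega n $$ (c, a) * X $$ (a, d)) = 0"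
proof -
  have Xc: "X \<in> carrier_mat N N" and eq: "transpose_mat X * omega n + omega n * X = 0\<^sub>m N N"
    using assms(1) by (auto simp: sp_odd_def N_def)
  have om: "omega n \<in> carrier_mat N N" using N_def by (simp add: omega_def)
  have "(transpose_mat X * omega n + omega n * X) $$ (c, d) = 0" using eq assms by simp
  then show ?thesis using Xc om assms by (simp add: scalar_prod_def atLeast0LessThan)
qed

lemma omega_entry:
  assumes "a < N" "b < N"
  shows "omega n $$ (a, b) = (if a < n \<and> b = n + a then 1 else if b < n \<and> a = n + b then - 1 else 0)"
  using assms by (simp add: omega_def N_def)

text \<open>Block form of the symplectic condition: the diagonal blocks are negative transposes of
  each other and the lower left block is symmetric. This ties the two entries of a root vector to
  each other.\<close>

lemma sp_entry_upper:
  assumes "X \<in> sp_odd n" "i < n" "j < n"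
  shows "X $$ (j, i) = - X $$ (n + i, n + j)" "X $$ (n + j, i) = X $$ (n + i, j)"
proof -
  have N: "i < N" "j < N" "n + i < N" "n + j < N" using assms by (auto simp: N_def)
  have row: "(\<Sum>a<N. omega n $$ (i, a) * X $$ (a, d)) = X $$ (n + i, d)" for d
  proof -
    have "(\<Sum>a<N. omega n $$ (i, a) * X $$ (a, d)) = (\<Sum>a<N. if a = n + i then X $$ (a, d) else 0)"
      using assms N by (intro sum.cong refl) (auto simp: omega_entry)
    then show ?thesis using N by simp
  qed
  have "(\<Sum>a<N. X $$ (a, i) * omega n $$ (a, n + j)) = (\<Sum>a<N. if a = j then X $$ (a, i) else 0)"
    using assms N by (intro sum.cong refl) (auto simp: omega_entry)
  then show "X $$ (j, i) = - X $$ (n + i, n + j)"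
    using sp_entry[OF assms(1) N(1,4)] N by (simp add: row eq_neg_iff_add_eq_0)
  have "(\<Sum>a<N. X $$ (a, i) * omega n $$ (a, j)) = (\<Sum>a<N. if a = n + j then - X $$ (a, i) else 0)"
    using assms N by (intro sum.cong refl) (auto simp: omega_entry)
  then show "X $$ (n + j, i) = X $$ (n + i, j)"
    using sp_entry[OF assms(1) N(1,2)] N by (simp add: row)
qed

text \<open>Matrix units are weight vectors under the bracket with the Cartan subalgebra; taking
  \<open>h\<close> to be the l-th coordinate vector reads off one coordinate of the weight.\<close>

lemma neg_root_space_entry:
  assumes X: "X \<in> neg_root_space n \<alpha>" and ab: "a < N" "b < N" "X $$ (b, a) \<noteq> 0"
  shows "a < 2 * n" "b < 2 * n" "\<And>l. 1 \<le> l \<Longrightarrow> l \<le> n \<Longrightarrow> letter_weight b l - letter_weight a l = - root_weight n \<alpha> l"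
proof -
  have Xe: "X \<in> sp_even n" using X by (simp add: neg_root_space_def)
  then have Xc: "X \<in> carrier_mat N N" by (simp add: sp_even_def sp_odd_def N_def)
  show "a < 2 * n" "b < 2 * n"
    using Xe ab by (auto simp: sp_even_def N_def less_Suc_eq)
  fix l assume l: "1 \<le> l" "l \<le> n"
  define h where "h r = (if r = l then 1 else 0 :: complex)" for r
  have delta: "(\<Sum>r = 1..n. of_int (g r) * h r) = of_int (g l)" for g :: "nat \<Rightarrow> int"
    using l by (simp add: h_def if_distrib[where f = "(*) _"] cong: if_cong)
  have H: "cartan n h \<in> carrier_mat N N" by (simp add: cartan_def N_def)
  have "(cartan n h * X - X * cartan n h) $$ (b, a) = ((- (\<Sum>l = 1..n. of_int (root_weight n \<alpha> l) * h l)) \<cdot>\<^sub>m X) $$ (b, a)"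
    using X by (simp add: neg_root_space_def)
  moreover have "(cartan n h * X) $$ (b, a) = of_int (letter_weight b l) * X $$ (b, a)"
  proof -
    have "(cartan n h * X) $$ (b, a) = (\<Sum>c<N. cartan n h $$ (b, c) * X $$ (c, a))"
      using H Xc ab by (simp add: scalar_prod_def atLeast0LessThan)
    also have "\<dots> = (\<Sum>c<N. if c = b then of_int (letter_weight b l) * X $$ (b, a) else 0)"
      using ab by (intro sum.cong refl) (auto simp: cartan_entry delta simp del: One_nat_def)
    finally show ?thesis using ab by simp
  qed
  moreover have "(X * cartan n h) $$ (b, a) = of_int (letter_weight a l) * X $$ (b, a)"
  proof -
    have "(X * cartan n h) $$ (b, a) = (\<Sum>c<N. X $$ (b, c) * cartan n h $$ (c, a))"
      using H Xc ab by (simp add: scalar_prod_def atLeast0LessThan)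
    also have "\<dots> = (\<Sum>c<N. if c = a then of_int (letter_weight a l) * X $$ (b, a) else 0)"
      using ab by (intro sum.cong refl) (auto simp: cartan_entry delta simp del: One_nat_def)
    finally show ?thesis using ab by simp
  qed
  ultimately have "of_int (letter_weight b l) * X $$ (b, a) - of_int (letter_weight a l) * X $$ (b, a) = - of_int (root_weight n \<alpha> l) * X $$ (b, a)"
    using ab Xc H by (simp add: delta del: One_nat_def)
  then have "(of_int (letter_weight b l) - of_int (letter_weight a l)) * X $$ (b, a) = of_int (- root_weight n \<alpha> l) * X $$ (b, a)"
    by (simp only: left_diff_distrib of_int_minus)
  then have "of_int (letter_weight b l) - of_int (letter_weight a l) = (of_int (- root_weight n \<alpha> l) :: complex)"
    using ab(3) by (simp only: mult_cancel_right) simp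
  then have "(of_int (letter_weight b l - letter_weight a l) :: complex) = of_int (- root_weight n \<alpha> l)"
    by simp
  then show "letter_weight b l - letter_weight a l = - root_weight n \<alpha> l" by (simp only: of_int_eq_iff)
qed

text \<open>The root whose root vector moves the letter \<open>a\<close> to the letter \<open>b\<close>.\<close>

definition moving_root :: "nat \<Rightarrow> nat \<Rightarrow> root" where
  "moving_root b a = (if b < n then Rt (a + 1) b else if b = 2 * n then Rt (a + 1) n
     else Rtb (min (a + 1) (b - n + 1)) (max (a + 1) (b - n + 1)))"

lemma Rt_entry:
  assumes X: "X \<in> neg_root_space n (Rt i j)" and ij: "1 \<le> i" "i \<le> j" "j < n"
    and ab: "a < N" "b < N" "X $$ (b, a) \<noteq> 0"
  shows "(a = i - 1 \<and> b = j) \<or> (a = n + j \<and> b = n + i - 1)"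
proof -
  have e: "letter_weight b l - letter_weight a l = eps (j + 1) l - eps i l" if "1 \<le> l" "l \<le> n" for l
    using neg_root_space_entry(3)[OF X ab that] root_weight_Rt[OF ij(2,3), of l] by simp
  have ab2: "a < 2 * n" "b < 2 * n" using neg_root_space_entry(1,2)[OF X ab] by auto
  have ei: "letter_weight b i - letter_weight a i = - 1" using e[of i] ij by (simp add: eps_def)
  have ej: "letter_weight b (j + 1) - letter_weight a (j + 1) = 1" using e[of "j + 1"] ij by (simp add: eps_def)
  have eo: "letter_weight b l = letter_weight a l" if "1 \<le> l" "l \<le> n" "l \<noteq> i" "l \<noteq> j + 1" for l
    using e[of l] that by (simp add: eps_def)
  show ?thesis
  proof (cases "a < n")
    case True
    then have "a + 1 = i" using ei ej eo[of "a + 1"] ij ab2 by (auto simp: letter_weight_def eps_def split: if_splits)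
    then show ?thesis using ej ij ab2 True by (auto simp: letter_weight_def eps_def split: if_splits)
  next
    case False
    then have "a = n + j" using ei ej eo[of "a - n + 1"] ij ab2 by (auto simp: letter_weight_def eps_def split: if_splits)
    then show ?thesis using ei ij ab2 by (auto simp: letter_weight_def eps_def split: if_splits)
  qed
qed

lemma Rtb_entry:
  assumes X: "X \<in> neg_root_space n (Rtb i j)" and ij: "1 \<le> i" "i \<le> j" "j \<le> n"
    and ab: "a < N" "b < N" "X $$ (b, a) \<noteq> 0"
  shows "(a = i - 1 \<and> b = n + j - 1) \<or> (a = j - 1 \<and> b = n + i - 1)"
proof -
  have e: "letter_weight b l - letter_weight a l = - eps i l - eps j l" if "1 \<le> l" "l \<le> n" for l
    using neg_root_space_entry(3)[OF X ab that] root_weight_Rtb[OF ij(2,3), of l] by simp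
  have ab2: "a < 2 * n" "b < 2 * n" using neg_root_space_entry(1,2)[OF X ab] by auto
  have ei: "letter_weight b i - letter_weight a i = - 1 - (if i = j then 1 else 0)" using e[of i] ij by (simp add: eps_def)
  have ej: "letter_weight b j - letter_weight a j = - 1 - (if i = j then 1 else 0)" using e[of j] ij by (simp add: eps_def)
  have eo: "letter_weight b l = letter_weight a l" if "1 \<le> l" "l \<le> n" "l \<noteq> i" "l \<noteq> j" for l
    using e[of l] that by (simp add: eps_def)
  show ?thesis
  proof (cases "a < n")
    case True
    then have "a + 1 = i \<or> a + 1 = j" using ei ej eo[of "a + 1"] ij ab2 by (auto simp: letter_weight_def eps_def split: if_splits)
    then show ?thesis using ei ej ij ab2 True by (auto simp: letter_weight_def eps_def split: if_splits)
  next
    case False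
    then show ?thesis using ei ej ij ab2 by (auto simp: letter_weight_def eps_def split: if_splits)
  qed
qed

lemma neg_root_space_sp: "X \<in> neg_root_space n \<alpha> \<Longrightarrow> X \<in> sp_odd n"
  by (simp add: neg_root_space_def sp_even_def)

lemma nonzero_entry:
  assumes "X \<in> carrier_mat N N" "X \<noteq> 0\<^sub>m N N"
  shows "\<exists>a<N. \<exists>b<N. X $$ (b, a) \<noteq> 0"
  using assms by (metis carrier_matD eq_matI index_zero_mat zero_carrier_mat)

lemma matrix_unit_sp:
  assumes "1 \<le> i" "i \<le> n" shows "matrix_unit N N i \<in> sp_odd n"
proof -
  have "transpose_mat (matrix_unit N N i) * omega n = 0\<^sub>m N N"
    by (rule eq_matI) (auto simp: matrix_unit_def omega_def scalar_prod_def N_def intro!: sum.neutral)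
  moreover have "omega n * matrix_unit N N i = 0\<^sub>m N N"
    by (rule eq_matI) (auto simp: matrix_unit_def omega_def scalar_prod_def N_def intro!: sum.neutral)
  moreover have "matrix_unit N N i \<in> carrier_mat N N" by (simp add: matrix_unit_def)
  ultimately show ?thesis unfolding sp_odd_def N_def[symmetric] by simp
qed

section \<open>Root vectors as moves of letters\<close>

context
  fixes f :: "root \<Rightarrow> complex mat"
  assumes f: "is_root_vectors n f"
begin

lemma root_cases:
  assumes "\<alpha> \<in> poset n"
  obtains (diag) i j where "\<alpha> = Rt i j" "1 \<le> i" "i \<le> j" "j < n" "f \<alpha> \<in> neg_root_space n \<alpha>" "f \<alpha> \<noteq> 0\<^sub>m N N"
    | (odd) i where "\<alpha> = Rt i n" "1 \<le> i" "i \<le> n" "f \<alpha> = matrix_unit N N i"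
    | (bar) i j where "\<alpha> = Rtb i j" "1 \<le> i" "i \<le> j" "j \<le> n" "f \<alpha> \<in> neg_root_space n \<alpha>" "f \<alpha> \<noteq> 0\<^sub>m N N"
proof (cases \<alpha>)
  case (Rt i j)
  then have ij: "1 \<le> i" "i \<le> j" "j \<le> n" using assms by (auto simp: poset_def)
  show ?thesis
  proof (cases "j = n")
    case True
    then show ?thesis using odd[of i] Rt ij f by (auto simp: is_root_vectors_def N_def)
  next
    case False
    then have "\<alpha> \<in> pos_roots n" using Rt ij by (auto simp: pos_roots_def)
    then show ?thesis using diag[of i j] Rt ij False f by (auto simp: is_root_vectors_def N_def)
  qed
next
  case (Rtb i j)
  then have ij: "1 \<le> i" "i \<le> j" "j \<le> n" using assms by (auto simp: poset_def)
  then have "\<alpha> \<in> pos_roots n" using Rtb by (auto simp: pos_roots_def)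
  then show ?thesis using bar[of i j] Rtb ij f by (auto simp: is_root_vectors_def N_def)
qed

text \<open>In the application the source \<open>a\<close> is a letter of the highest weight vector,
  hence below n. This discards the second entry of the root vector of \<open>Rt i j\<close>, whose
  source is n + j.\<close>

lemma root_vector_entry:
  assumes "\<alpha> \<in> poset n" "a < n" "a < b" "b < N" "f \<alpha> $$ (b, a) \<noteq> 0"
  shows "\<alpha> = moving_root b a"
  using assms(1)
proof (cases rule: root_cases)
  case (diag i j)
  then show ?thesis using Rt_entry[of "f \<alpha>" i j a b] assms by (auto simp: moving_root_def N_def)
next
  case (odd i)
  then show ?thesis using assms by (auto simp: matrix_unit_def moving_root_def N_def split: if_splits)
next
  case (bar i j)
  then show ?thesis using Rtb_entry[of "f \<alpha>" i j a b] assms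
    by (auto simp: moving_root_def N_def min_def max_def)
qed

text \<open>A root vector of the symplectic part is only known to be nonzero. Its weight leaves at
  most two positions for a nonzero entry, and the symplectic relation between them makes both
  nonzero, in particular the required one.\<close>

lemma moving_root_entry:
  assumes "a < n" "a < b" "b < N"
  shows "moving_root b a \<in> poset n" "f (moving_root b a) $$ (b, a) \<noteq> 0"
proof -
  show p: "moving_root b a \<in> poset n"
    using assms by (auto simp: moving_root_def poset_def N_def min_def max_def)
  show "f (moving_root b a) $$ (b, a) \<noteq> 0"
    using p
  proof (cases rule: root_cases)
    case (diag i j)
    then have ab: "b = j" "a = i - 1" using assms by (auto simp: moving_root_def split: if_splits)
    have "f (moving_root b a) \<in> carrier_mat N N" using neg_root_space_sp[OF diag(5)] by (simp add: sp_odd_def N_def)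
    then obtain a' b' where *: "a' < N" "b' < N" "f (moving_root b a) $$ (b', a') \<noteq> 0"
      using nonzero_entry diag(6) by blast
    then have "(a' = i - 1 \<and> b' = j) \<or> (a' = n + j \<and> b' = n + i - 1)"
      using Rt_entry[OF _ diag(2,3,4)] diag(1,5) by metis
    then show ?thesis
    proof
      assume e: "a' = n + j \<and> b' = n + i - 1"
      have "f (moving_root b a) $$ (j, i - 1) = - f (moving_root b a) $$ (n + (i - 1), n + j)"
        using neg_root_space_sp[OF diag(5)] diag by (intro sp_entry_upper) auto
      moreover have "n + (i - 1) = n + i - 1" using diag by simp
      ultimately show ?thesis using * e ab by simp
    qed (use * ab in auto)
  next
    case (odd i)
    then have "b = 2 * n" "a + 1 = i" using assms by (auto simp: moving_root_def split: if_splits)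
    then show ?thesis using odd by (auto simp: matrix_unit_def N_def)
  next
    case (bar i j)
    have ab: "(a = i - 1 \<and> b = n + j - 1) \<or> (a = j - 1 \<and> b = n + i - 1)"
      using bar(1) assms by (auto simp: moving_root_def N_def min_def max_def split: if_splits)
    have "f (moving_root b a) \<in> carrier_mat N N" using neg_root_space_sp[OF bar(5)] by (simp add: sp_odd_def N_def)
    then obtain a' b' where *: "a' < N" "b' < N" "f (moving_root b a) $$ (b', a') \<noteq> 0"
      using nonzero_entry bar(6) by blast
    then have "(a' = i - 1 \<and> b' = n + j - 1) \<or> (a' = j - 1 \<and> b' = n + i - 1)"
      using Rtb_entry[OF _ bar(2,3,4)] bar(1,5) by metis
    moreover have "f (moving_root b a) $$ (n + (j - 1), i - 1) = f (moving_root b a) $$ (n + (i - 1), j - 1)"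
      using neg_root_space_sp[OF bar(5)] bar by (intro sp_entry_upper) auto
    moreover have "n + (i - 1) = n + i - 1" "n + (j - 1) = n + j - 1" using bar by auto
    ultimately show ?thesis using * ab by auto
  qed
qed

lemma root_vector_sp: "\<alpha> \<in> poset n \<Longrightarrow> f \<alpha> \<in> sp_odd n"
  by (erule root_cases) (auto simp: neg_root_space_sp matrix_unit_sp)

end

end

text \<open>The rearrangement inequality inside the classes of \<open>c\<close>, strict unless
  \<open>\<phi>\<close> is the identity on \<open>D\<close>. The induction removes an element p with
  maximal \<open>r\<close>: if \<open>\<phi>\<close> moves p, then fixing p and redirecting its
  preimage to its image strictly raises the sum.\<close>

lemma rearrangement:
  fixes r y :: "'a \<Rightarrow> nat" and c :: "'a \<Rightarrow> 'b"
  assumes "finite D" "bij_betw \<phi> D D" "\<And>p. p \<in> D \<Longrightarrow> c (\<phi> p) = c p"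
    and "\<And>p q. p \<in> D \<Longrightarrow> q \<in> D \<Longrightarrow> c p = c q \<Longrightarrow> r p < r q \<Longrightarrow> y p < y q"
    and "\<And>p q. p \<in> D \<Longrightarrow> q \<in> D \<Longrightarrow> c p = c q \<Longrightarrow> r p = r q \<Longrightarrow> p = q"
  shows "(\<Sum>p\<in>D. r (\<phi> p) * y p) < (\<Sum>p\<in>D. r p * y p) \<or> (\<forall>p\<in>D. \<phi> p = p)"
  using assms
proof (induction "card D" arbitrary: D \<phi>)
  case 0
  then show ?case by simp
next
  case (Suc k)
  note fin = Suc(3) and bij = Suc(4) and c = Suc(5) and mono = Suc(6) and inj = Suc(7)
  have "D \<noteq> {}" using Suc(2) by auto
  then have "Max (r ` D) \<in> r ` D" using fin by (intro Max_in) auto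
  then obtain p where p: "p \<in> D" "r p = Max (r ` D)" by (metis imageE)
  have max: "r q \<le> r p" if "q \<in> D" for q using p(2) that fin by simp
  define E where "E = D - {p}"
  have E: "finite E" "p \<notin> E" "D = insert p E" using p fin by (auto simp: E_def)
  have card: "k = card E" using Suc(2) E by simp
  have injD: "inj_on \<phi> D" and im: "\<phi> ` D = D" using bij by (auto simp: bij_betw_def)
  have IH: "(\<Sum>p\<in>E. r (\<psi> p) * y p) < (\<Sum>p\<in>E. r p * y p) \<or> (\<forall>p\<in>E. \<psi> p = p)"
    if "bij_betw \<psi> E E" "\<And>q. q \<in> E \<Longrightarrow> c (\<psi> q) = c q" for \<psi>
    using that mono inj E by (intro Suc(1)[OF card E(1)]) auto
  show ?case
  proof (cases "\<phi> p = p")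
    case True
    have "bij_betw \<phi> E E"
      unfolding E_def using bij_betw_DiffI[OF bij, of "{p}" "{p}"] True p(1) by simp
    then show ?thesis using IH[of \<phi>] c True E by auto
  next
    case False
    obtain q where q: "q \<in> D" "\<phi> q = p" using im p(1) by (metis imageE)
    have qp: "q \<noteq> p" using False q by auto
    have \<phi>p: "\<phi> p \<in> D" using im p(1) by blast
    have "c (\<phi> p) = c p" "c q = c p" using c[OF p(1)] c[OF q(1)] q(2) by auto
    then have lt: "r (\<phi> p) < r p" "r q < r p"
      using max[OF \<phi>p] max[OF q(1)] inj[OF \<phi>p p(1)] inj[OF q(1) p(1)] False qp by (auto simp: le_less)
    have yq: "y q < y p" using mono[OF q(1) p(1) \<open>c q = c p\<close> lt(2)] .
    define \<psi> where "\<psi> = \<phi>(q := \<phi> p)"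
    have "bij_betw \<psi> E E"
    proof -
      have "\<psi> ` E \<subseteq> E"
      proof
        fix z assume "z \<in> \<psi> ` E"
        then obtain u where u: "u \<in> E" "z = \<psi> u" by blast
        show "z \<in> E"
        proof (cases "u = q")
          case True
          then show ?thesis using u \<phi>p False by (simp add: \<psi>_def E_def)
        next
          case u': False
          then have "z = \<phi> u" using u by (simp add: \<psi>_def)
          moreover have "\<phi> u \<noteq> p" using u' u q injD by (auto simp: E_def inj_on_def)
          ultimately show ?thesis using u im by (auto simp: E_def)
        qed
      qed
      moreover have "inj_on \<psi> E"
        using injD p(1) by (auto simp: \<psi>_def E_def inj_on_def)
      ultimately show ?thesis using E(1) by (simp add: bij_betw_def endo_inj_surj)
    qed
    moreover have "c (\<psi> u) = c u" if "u \<in> E" for u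
      using that c \<open>c (\<phi> p) = c p\<close> \<open>c q = c p\<close> by (auto simp: \<psi>_def E_def)
    ultimately have "(\<Sum>p\<in>E. r (\<psi> p) * y p) < (\<Sum>p\<in>E. r p * y p) \<or> (\<forall>p\<in>E. \<psi> p = p)"
      by (rule IH)
    then have le: "(\<Sum>p\<in>E. r (\<psi> p) * y p) \<le> (\<Sum>p\<in>E. r p * y p)"
      by (elim disjE) (simp_all cong: sum.cong)
    define G where "G = E - {q}"
    have G: "finite G" "q \<notin> G" "E = insert q G" using q qp fin by (auto simp: G_def E_def)
    have rest: "(\<Sum>p\<in>G. r (\<psi> p) * y p) = (\<Sum>p\<in>G. r (\<phi> p) * y p)"
      using G(2) by (intro sum.cong refl) (auto simp: \<psi>_def)
    have "(\<Sum>p\<in>E. r (\<psi> p) * y p) = r (\<phi> p) * y q + (\<Sum>p\<in>G. r (\<phi> p) * y p)"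
      unfolding rest[symmetric] unfolding G(3) using G(1,2) by (simp add: \<psi>_def)
    moreover have "(\<Sum>p\<in>D. r (\<phi> p) * y p) = r (\<phi> p) * y p + (r p * y q + (\<Sum>p\<in>G. r (\<phi> p) * y p))"
      using G(1,2) E(2) q(2) unfolding E(3) G(3) by simp
    moreover have "(\<Sum>p\<in>D. r p * y p) = r p * y p + (\<Sum>p\<in>E. r p * y p)"
      using E(1,2) unfolding E(3) by simp
    moreover have "r (\<phi> p) * y p + r p * y q < r p * y p + r (\<phi> p) * y q"
    proof -
      define d e where "d = r p - r (\<phi> p)" and "e = y p - y q"
      then have d: "r p = r (\<phi> p) + d" "d > 0" and e: "y p = y q + e" "e > 0" using lt(1) yq by auto
      show ?thesis using d e by (simp add: algebra_simps)
    qed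
    ultimately show ?thesis using le by linarith
  qed
qed

context diagram
begin

section \<open>Leading terms\<close>

text \<open>The letters occurring in column \<open>c\<close> of the highest weight vector.\<close>

definition inner :: "nat \<Rightarrow> nat \<Rightarrow> bool" where
  "inner c b \<longleftrightarrow> b < n \<and> c < lam (b + 1)"

definition outer_positions :: "(nat \<Rightarrow> nat) \<Rightarrow> nat set" where
  "outer_positions x = {p. p < K \<and> \<not> inner (col p) (x p)}"

lemma finite_outer [simp]: "finite (outer_positions x)"
  by (simp add: outer_positions_def)

lemma inner_outer_less: "inner c a \<Longrightarrow> \<not> inner c b \<Longrightarrow> a < b"
  using lam_antimono[of "b + 1" "a + 1"] by (force simp: inner_def)

lemma inner_row: "p < K \<Longrightarrow> inner (col p) (row p - 1)"
  using box_bounds[of p] by (simp add: inner_def)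

end

section \<open>Coordinates of the highest weight vector\<close>

locale root_action = diagram +
  fixes v :: tensor and f :: "root \<Rightarrow> complex mat"
  assumes v: "is_highest_weight_vector n m v" and f: "is_root_vectors n f"
begin

lemma v_GL: "v \<in> GL_rep n m" and v_nonzero: "v \<noteq> (\<lambda>w. 0)"
  using v by (auto simp: is_highest_weight_vector_def)

text \<open>A torus element with one coordinate 2 and all others 1 multiplies the coordinate at
  \<open>x\<close> by 2 to the number of occurrences of that letter; the weight condition determines
  the exponent.\<close>

lemma weight_count:
  assumes x: "letters x" "v (fill x) \<noteq> 0" and b: "b < N"
  shows "card {p. p < K \<and> x p = b} = lam (b + 1)"
proof -
  define d :: "nat \<Rightarrow> complex" where "d i = (if i = b + 1 then 2 else 1)" for i
  have w: "fill x \<in> words N K" using x(1) by (simp add: fill_words)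
  have "group_act N (mat_diag N (\<lambda>a. d (a + 1))) v (fill x) =
      (\<Sum>u\<in>words N K. (\<Prod>p<K. mat_diag N (\<lambda>a. d (a + 1)) $$ (x p, u ! p)) * v u)"
    using w by (simp add: group_act_def words_def)
  also have "\<dots> = (\<Sum>u\<in>words N K. if u = fill x then (\<Prod>p<K. d (x p + 1)) * v (fill x) else 0)"
  proof (intro sum.cong refl)
    fix u assume u: "u \<in> words N K"
    have bounds: "x p < N" "u ! p < N" if "p < K" for p
      using x(1) u that by (auto simp: letters_def words_def subset_iff)
    show "(\<Prod>p<K. mat_diag N (\<lambda>a. d (a + 1)) $$ (x p, u ! p)) * v u = (if u = fill x then (\<Prod>p<K. d (x p + 1)) * v (fill x) else 0)"
    proof (cases "u = fill x")
      case True
      have "(\<Prod>p<K. mat_diag N (\<lambda>a. d (a + 1)) $$ (x p, u ! p)) = (\<Prod>p<K. d (x p + 1))"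
        using bounds True by (intro prod.cong refl) (auto simp: mat_diag_def)
      then show ?thesis using True by simp
    next
      case False
      then obtain p where p: "p < K" "u ! p \<noteq> x p"
        using u by (auto simp: words_def list_eq_iff_nth_eq)
      then have "mat_diag N (\<lambda>a. d (a + 1)) $$ (x p, u ! p) = 0"
        using bounds[OF p(1)] by (simp add: mat_diag_def)
      then have "(\<Prod>p<K. mat_diag N (\<lambda>a. d (a + 1)) $$ (x p, u ! p)) = 0"
        using p(1) by (intro prod_zero) auto
      then show ?thesis using False by simp
    qed
  qed
  also have "\<dots> = (\<Prod>p<K. d (x p + 1)) * v (fill x)"
  proof -
    have "finite (words N K)"
      using finite_lists_length_eq[of "{..<N}" K] by (simp add: words_def conj_commute)
    then show ?thesis using w by simp
  qed
  finally have 1: "group_act N (mat_diag N (\<lambda>a. d (a + 1))) v (fill x) = (\<Prod>p<K. d (x p + 1)) * v (fill x)" .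
  have "\<forall>i \<in> {1..2 * n + 1}. d i \<noteq> 0" by (simp add: d_def)
  then have "group_act N (mat_diag N (\<lambda>a. d (a + 1))) v = (\<Prod>i = 1..N. d i ^ lam i) \<odot>\<^bsub>L\<^esub> v"
    using v unfolding is_highest_weight_vector_def N_def by blast
  then have "(\<Prod>p<K. d (x p + 1)) * v (fill x) = (\<Prod>i = 1..N. d i ^ lam i) * v (fill x)"
    using 1 by (auto simp add: tensor_space_def)
  then have "(\<Prod>p<K. d (x p + 1)) = (\<Prod>i = 1..N. d i ^ lam i)" using x(2) by simp
  moreover have "(\<Prod>p<K. d (x p + 1)) = 2 ^ card {p. p < K \<and> x p = b}"
  proof -
    have "(\<Prod>p<K. d (x p + 1)) = (\<Prod>p\<in>{p. p < K \<and> x p = b}. 2)"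
      by (rule prod.mono_neutral_cong_right) (auto simp: d_def)
    then show ?thesis by simp
  qed
  moreover have "(\<Prod>i = 1..N. d i ^ lam i) = 2 ^ lam (b + 1)"
  proof -
    have "(\<Prod>i = 1..N. d i ^ lam i) = (\<Prod>i\<in>{b + 1}. d i ^ lam i)"
      using b by (intro prod.mono_neutral_right) (auto simp: d_def)
    then show ?thesis by (simp add: d_def)
  qed
  ultimately have "(2::complex) ^ card {p. p < K \<and> x p = b} = 2 ^ lam (b + 1)" by simp
  then have "of_nat (2 ^ card {p. p < K \<and> x p = b}) = (of_nat (2 ^ lam (b + 1)) :: complex)" by simp
  then have "(2::nat) ^ card {p. p < K \<and> x p = b} = 2 ^ lam (b + 1)" by (simp only: of_nat_eq_iff)
  then show ?thesis by simp
qed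

lemma v_column_inj:
  assumes "v (fill x) \<noteq> 0" "p < K" "q < K" "col p = col q" "x p = x q"
  shows "p = q"
  using GL_rep_repeat[OF v_GL assms(2,3) _ assms(4), of x] assms(1,5) by blast

lemma column_length:
  "\<exists>l. \<forall>i. 1 \<le> i \<longrightarrow> (c < lam i \<longleftrightarrow> i \<le> l)"
proof -
  define S where "S = {i. 1 \<le> i \<and> c < lam i}"
  have "S \<subseteq> {..n}"
  proof
    fix i assume "i \<in> S"
    then show "i \<in> {..n}" using lam_beyond[of i] by (cases "i \<le> n") (auto simp: S_def)
  qed
  then have S: "finite S" by (rule finite_subset) simp
  show ?thesis
  proof (cases "S = {}")
    case True
    then show ?thesis by (intro exI[of _ 0]) (auto simp: S_def)
  next
    case False
    have "Max S \<in> S" using S False by simp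
    have "c < lam i \<longleftrightarrow> i \<le> Max S" if "1 \<le> i" for i
    proof
      show "c < lam i \<Longrightarrow> i \<le> Max S" using that S by (auto simp: S_def)
      show "i \<le> Max S \<Longrightarrow> c < lam i" using \<open>Max S \<in> S\<close> lam_antimono[of i "Max S"] by (auto simp: S_def)
    qed
    then show ?thesis by blast
  qed
qed

text \<open>A letter occurs at most once in a column, so \<open>weight_count\<close> gives the
  number of columns containing b. If one of them had length at most b, then by induction it would
  also contain all letters below its length, hence more letters than boxes.\<close>

lemma v_columns:
  assumes x: "letters x" "v (fill x) \<noteq> 0" and b: "b < N"
  shows "col ` {p. p < K \<and> x p = b} = {..<lam (b + 1)}"
  using b
proof (induction b rule: less_induct)
  case (less b)
  have inj: "inj_on col {p. p < K \<and> x p = b}" for b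
    by (rule inj_onI) (use v_column_inj[OF x(2)] in auto)
  have card: "card (col ` {p. p < K \<and> x p = b}) = lam (b + 1)"
    using weight_count[OF x less(2)] card_image[OF inj, of b] by simp
  have "col ` {p. p < K \<and> x p = b} \<subseteq> {..<lam (b + 1)}"
  proof (rule image_subsetI, rule ccontr)
    fix p assume p: "p \<in> {p. p < K \<and> x p = b}" "col p \<notin> {..<lam (b + 1)}"
    define c where "c = col p"
    obtain l where l: "\<And>i. 1 \<le> i \<Longrightarrow> c < lam i \<longleftrightarrow> i \<le> l" using column_length by blast
    have "l \<le> b" using p(2) l[of "b + 1"] by (simp add: c_def)
    define S where "S = {q. q < K \<and> col q = c}"
    have "S \<subseteq> (\<lambda>i. pos i c) ` {1..l}"
    proof
      fix q assume q: "q \<in> S"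
      then have "q = pos (row q) c" "row q \<in> {1..l}"
        using pos_row_col[of q] box_bounds[of q] l[of "row q"] by (auto simp: S_def)
      then show "q \<in> (\<lambda>i. pos i c) ` {1..l}" by blast
    qed
    then have "card S \<le> l" using surj_card_le[of "{1..l}" S] by simp
    have "insert b {..<l} \<subseteq> x ` S"
    proof
      fix a assume "a \<in> insert b {..<l}"
      then consider "a = b" | "a < l" by auto
      then show "a \<in> x ` S"
      proof cases
        case 1
        then show ?thesis using p by (auto simp: S_def c_def)
      next
        case 2
        then have "c < lam (a + 1)" "a < b" "a < N" using l[of "a + 1"] \<open>l \<le> b\<close> less(2) by auto
        then have "c \<in> col ` {p. p < K \<and> x p = a}" using less(1)[of a] by simp
        then show ?thesis by (auto simp: S_def)
      qed
    qed
    moreover have "finite S" by (simp add: S_def)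
    ultimately have "card (insert b {..<l}) \<le> card S"
      by (meson card_image_le card_mono finite_imageI le_trans)
    then show False using \<open>card S \<le> l\<close> \<open>l \<le> b\<close> by simp
  qed
  then show ?case using card by (intro card_subset_eq) auto
qed

lemma v_inner:
  assumes x: "letters x" "v (fill x) \<noteq> 0" and p: "p < K"
  shows "inner (col p) (x p)"
proof -
  have "x p < N" using x(1) p by (simp add: letters_def)
  then have "col p < lam (x p + 1)" using v_columns[OF x, of "x p"] p by blast
  then show ?thesis using lam_beyond[of "x p + 1"] by (cases "x p < n") (auto simp: inner_def)
qed

text \<open>Sending each box to the box of its column where its letter stands canonically is a
  column permutation. So up to sign all nonzero coordinates of \<open>v\<close> equal the one at the
  canonical filling, which is therefore nonzero.\<close>

lemma v_value:
  assumes "letters x" "\<And>p. p < K \<Longrightarrow> inner (col p) (x p)"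
    and inj: "\<And>p q. p < K \<Longrightarrow> q < K \<Longrightarrow> col p = col q \<Longrightarrow> x p = x q \<Longrightarrow> p = q"
  shows "\<exists>\<pi> \<in> label_group col. v (fill x) = of_int (sign \<pi>) * v (fill (\<lambda>p. row p - 1))"
proof -
  define \<pi> where "\<pi> p = (if p < K then pos (x p + 1) (col p) else p)" for p
  have pp: "\<pi> p < K" "row (\<pi> p) = x p + 1" "col (\<pi> p) = col p" if "p < K" for p
    using assms(2)[OF that] pos[of "x p + 1" "col p"] that by (auto simp: \<pi>_def inner_def)
  have "inj_on \<pi> {..<K}"
  proof (rule inj_onI)
    fix p q assume *: "p \<in> {..<K}" "q \<in> {..<K}" "\<pi> p = \<pi> q"
    then have "x p + 1 = x q + 1" "col p = col q" using pp[of p] pp[of q] by auto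
    then show "p = q" using * inj by auto
  qed
  then have "\<pi> permutes {..<K}"
    using pp by (intro inj_imp_permutes) (auto simp: \<pi>_def)
  then have \<pi>: "\<pi> \<in> label_group col" using pp by (simp add: label_group_def)
  have "fill x = fill ((\<lambda>p. row p - 1) \<circ> \<pi>)"
    by (rule fill_cong) (simp add: pp)
  then show ?thesis using GL_rep_column_sign[OF v_GL \<pi>] \<pi> by auto
qed

lemma v_top: "v (fill (\<lambda>p. row p - 1)) \<noteq> 0"
proof -
  have "v \<in> carrier L" by (rule GL_rep_carrier[OF v_GL])
  then obtain w where w: "w \<in> words N K" "v w \<noteq> 0"
    using v_nonzero by (auto simp: tensor_space_def fun_eq_iff)
  obtain x where x: "letters x" "w = fill x" using words_fill[OF w(1)] by blast
  then show ?thesis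
    using v_value[OF x(1)] v_inner[OF x(1)] v_column_inj[of x] w(2) by force
qed

text \<open>The nonzero coordinates of \<open>v\<close> involve only letters below n, and \<omega>
  vanishes on their span.\<close>

lemma v_trace_free: "v \<in> V0"
proof -
  have carr: "v \<in> carrier L" by (rule GL_rep_carrier[OF v_GL])
  have "trace_at v x p q = 0" if "p < q" "q < K" for x p q
    unfolding trace_at_def
  proof (intro sum.neutral ballI)
    fix a b assume ab: "a \<in> {..<N}" "b \<in> {..<N}"
    define y where "y = x(p := a, q := b)"
    have y: "y p = a" "y q = b" using that by (auto simp: y_def)
    show "omega n $$ (a, b) * v (fill (x(p := a, q := b))) = 0"
    proof (cases "v (fill y) = 0")
      case False
      then have "letters y" using carr fill_words[of y] by (auto simp: tensor_space_def)
      then have "a < n" "b < n" using v_inner[OF _ False] that y by (auto simp: inner_def)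
      then show ?thesis using ab by (simp add: omega_entry)
    qed (simp add: y_def)
  qed
  then show ?thesis using carr v_GL by (auto simp: V0_iff trace_free_iff)
qed

section \<open>Moving outer letters by root vectors\<close>

lemma outer_vanish:
  assumes "letters x" "length Xs < card (outer_positions x)"
  shows "foldr lie Xs v (fill x) = 0"
  using assms
proof (induction Xs arbitrary: x)
  case Nil
  then have "outer_positions x \<noteq> {}" by auto
  then show ?case using v_inner[OF Nil(1)] by (auto simp: outer_positions_def)
next
  case (Cons X Xs)
  have "foldr lie Xs v (fill (x(p := a))) = 0" if "p < K" "a < N" for p a
  proof -
    have "outer_positions x - {p} \<subseteq> outer_positions (x(p := a))" by (auto simp: outer_positions_def)
    then have "card (outer_positions x - {p}) \<le> card (outer_positions (x(p := a)))" by (intro card_mono) auto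
    moreover have "card (outer_positions x) - 1 \<le> card (outer_positions x - {p})"
      by (simp add: card_Diff_singleton_if)
    ultimately have "length Xs < card (outer_positions (x(p := a)))" using Cons.prems by simp
    then show ?thesis by (rule Cons.IH[OF letters_upd[OF Cons.prems(1) that(2)]])
  qed
  then show ?case by (simp add: lie_fill[OF Cons.prems(1)])
qed

definition apply_roots :: "root list \<Rightarrow> tensor" where
  "apply_roots \<alpha>s = foldr (\<lambda>\<alpha>. lie (f \<alpha>)) \<alpha>s v"

lemma apply_roots_vanish:
  "letters x \<Longrightarrow> length \<alpha>s < card (outer_positions x) \<Longrightarrow> apply_roots \<alpha>s (fill x) = 0"
  using outer_vanish[of x "map f \<alpha>s"] by (simp add: apply_roots_def foldr_map comp_def)

text \<open>A way to move every outer letter of \<open>x\<close> back, using each root of the list exactly once.\<close>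

definition assignment :: "root list \<Rightarrow> (nat \<Rightarrow> nat) \<Rightarrow> (nat \<Rightarrow> nat) \<Rightarrow> bool" where
  "assignment \<alpha>s x a \<longleftrightarrow> (\<forall>p \<in> outer_positions x. inner (col p) (a p)) \<and>
     mset \<alpha>s = image_mset (\<lambda>p. moving_root (x p) (a p)) (mset_set (outer_positions x)) \<and>
     v (fill (\<lambda>p. if p \<in> outer_positions x then a p else x p)) \<noteq> 0"

text \<open>There are as many roots as outer letters, so none may be wasted: the factor
  \<open>\<alpha>\<close> must account for an outer letter and replace it by an inner one, as
  otherwise the remaining factors are too few. The two letters then determine
  \<open>\<alpha>\<close>.\<close>

lemma outer_move:
  assumes "length (\<alpha> # \<alpha>s) = card (outer_positions x)" "set (\<alpha> # \<alpha>s) \<subseteq> poset n" "letters x"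
    and "p < K" "b < N" "f \<alpha> $$ (x p, b) \<noteq> 0" "apply_roots \<alpha>s (fill (x(p := b))) \<noteq> 0"
  shows "p \<in> outer_positions x" "inner (col p) b" "outer_positions (x(p := b)) = outer_positions x - {p}"
    "\<alpha> = moving_root (x p) b"
proof -
  have "\<not> length \<alpha>s < card (outer_positions (x(p := b)))"
    using apply_roots_vanish[of "x(p := b)" \<alpha>s] assms(3,5,7) by auto
  then have le: "card (outer_positions (x(p := b))) < card (outer_positions x)" using assms(1) by simp
  show p: "p \<in> outer_positions x" and b: "inner (col p) b"
  proof -
    have "outer_positions x \<subseteq> outer_positions (x(p := b))" if "p \<notin> outer_positions x \<or> \<not> inner (col p) b"
      using that by (auto simp: outer_positions_def)
    then have "p \<in> outer_positions x \<and> inner (col p) b"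
      using le card_mono[OF finite_outer, of "outer_positions x" "x(p := b)"] by (meson leD)
    then show "p \<in> outer_positions x" "inner (col p) b" by auto
  qed
  show "outer_positions (x(p := b)) = outer_positions x - {p}"
    using b by (auto simp: outer_positions_def)
  have "b < x p" using inner_outer_less[OF b] p by (simp add: outer_positions_def)
  then show "\<alpha> = moving_root (x p) b"
    using root_vector_entry[OF f, of \<alpha> b "x p"] assms b by (auto simp: inner_def letters_def)
qed

lemma assignment_extend:
  assumes p: "p \<in> outer_positions x" "inner (col p) b" "outer_positions (x(p := b)) = outer_positions x - {p}"
    and "\<alpha> = moving_root (x p) b" "assignment \<alpha>s (x(p := b)) a"
  shows "assignment (\<alpha> # \<alpha>s) x (a(p := b))"
proof -
  have "mset_set (outer_positions x) = add_mset p (mset_set (outer_positions x - {p}))"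
    using p(1) by (simp add: mset_set.remove)
  moreover have "image_mset (\<lambda>q. moving_root ((x(p := b)) q) (a q)) (mset_set (outer_positions x - {p})) =
      image_mset (\<lambda>q. moving_root (x q) ((a(p := b)) q)) (mset_set (outer_positions x - {p}))"
    by (intro image_mset_cong) auto
  moreover have "(\<lambda>q. if q \<in> outer_positions (x(p := b)) then a q else (x(p := b)) q) =
      (\<lambda>q. if q \<in> outer_positions x then (a(p := b)) q else x q)"
    unfolding p(3) using p(1) by (intro ext) auto
  moreover have "\<forall>q \<in> outer_positions x. inner (col q) ((a(p := b)) q)"
    using assms(5) p(2) unfolding assignment_def p(3) by auto
  ultimately show ?thesis using assms(4,5) unfolding assignment_def p(3) by simp
qed

lemma assignment_exists:
  assumes "letters x" "length \<alpha>s = card (outer_positions x)" "set \<alpha>s \<subseteq> poset n" "apply_roots \<alpha>s (fill x) \<noteq> 0"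
  shows "\<exists>a. assignment \<alpha>s x a"
  using assms
proof (induction \<alpha>s arbitrary: x)
  case Nil
  then have "outer_positions x = {}" by simp
  then show ?case using Nil by (auto simp: assignment_def apply_roots_def)
next
  case (Cons \<alpha> \<alpha>s)
  have "apply_roots (\<alpha> # \<alpha>s) (fill x) = (\<Sum>p<K. \<Sum>b<N. f \<alpha> $$ (x p, b) * apply_roots \<alpha>s (fill (x(p := b))))"
    using lie_fill[OF Cons.prems(1)] by (simp add: apply_roots_def)
  then obtain p b where pb: "p < K" "b < N" "f \<alpha> $$ (x p, b) \<noteq> 0" "apply_roots \<alpha>s (fill (x(p := b))) \<noteq> 0"
    using Cons.prems(4) by (metis (no_types, lifting) lessThan_iff mult_zero_left mult_zero_right sum.not_neutral_contains_not_neutral)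
  note mv = outer_move[OF Cons.prems(2,3,1) pb]
  have len: "length \<alpha>s = card (outer_positions (x(p := b)))"
    using Cons.prems(2) mv by (simp add: card_Diff_singleton)
  have "set \<alpha>s \<subseteq> poset n" using Cons.prems(3) by simp
  then obtain a where "assignment \<alpha>s (x(p := b)) a"
    using Cons.IH[OF letters_upd[OF Cons.prems(1) pb(2)] len _ pb(4)] by blast
  then show ?case using assignment_extend[OF mv] by blast
qed

text \<open>The coordinate may be reached in several ways, because equal roots of the list can be
  distributed over their positions in any order. All ways give the same product, so the coordinate
  is a positive integer times it and nothing cancels.\<close>

lemma assignment_unique:
  assumes "letters x" "length \<alpha>s = card (outer_positions x)" "set \<alpha>s \<subseteq> poset n" "assignment \<alpha>s x a"
    and "\<And>a'. assignment \<alpha>s x a' \<Longrightarrow> \<forall>p \<in> outer_positions x. a' p = a p"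
  shows "\<exists>k::nat. k \<ge> 1 \<and> apply_roots \<alpha>s (fill x) = of_nat k *
    ((\<Prod>p\<in>outer_positions x. f (moving_root (x p) (a p)) $$ (x p, a p)) * v (fill (\<lambda>p. if p \<in> outer_positions x then a p else x p)))"
  using assms
proof (induction \<alpha>s arbitrary: x)
  case Nil
  then have "outer_positions x = {}" by simp
  then show ?case by (intro exI[of _ 1]) (simp add: apply_roots_def)
next
  case (Cons \<alpha> \<alpha>s)
  define C where "C = (\<Prod>p\<in>outer_positions x. f (moving_root (x p) (a p)) $$ (x p, a p)) * v (fill (\<lambda>p. if p \<in> outer_positions x then a p else x p))"
  define D where "D = {p \<in> outer_positions x. moving_root (x p) (a p) = \<alpha>}"
  have aN: "a p < N" if "p \<in> outer_positions x" for p
    using Cons.prems(4) that by (auto simp: assignment_def inner_def N_def)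
  have sub: "set \<alpha>s \<subseteq> poset n" using Cons.prems(3) by simp
  have zero: "f \<alpha> $$ (x p, b) * apply_roots \<alpha>s (fill (x(p := b))) = 0"
    if pb: "p < K" "b < N" "\<not> (p \<in> D \<and> b = a p)" for p b
  proof (rule ccontr)
    assume "\<not> ?thesis"
    then have nz: "f \<alpha> $$ (x p, b) \<noteq> 0" "apply_roots \<alpha>s (fill (x(p := b))) \<noteq> 0" by auto
    note mv = outer_move[OF Cons.prems(2,3,1) pb(1,2) nz]
    have len: "length \<alpha>s = card (outer_positions (x(p := b)))"
      using Cons.prems(2) mv by (simp add: card_Diff_singleton)
    obtain a' where "assignment \<alpha>s (x(p := b)) a'"
      using assignment_exists[OF letters_upd[OF Cons.prems(1) pb(2)] len sub nz(2)] by blast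
    then have "\<forall>q \<in> outer_positions x. (a'(p := b)) q = a q"
      using Cons.prems(5) assignment_extend[OF mv] by blast
    then have "b = a p" using mv(1) by auto
    then show False using pb(3) mv by (simp add: D_def)
  qed
  have nonzero: "\<exists>k::nat. k \<ge> 1 \<and> f \<alpha> $$ (x p, a p) * apply_roots \<alpha>s (fill (x(p := a p))) = of_nat k * C" if pD: "p \<in> D" for p
  proof -
    have p: "p \<in> outer_positions x" "p < K" and \<alpha>: "moving_root (x p) (a p) = \<alpha>"
      using pD by (auto simp: D_def outer_positions_def)
    have ina: "inner (col p) (a p)" using Cons.prems(4) p by (simp add: assignment_def)
    have out: "outer_positions (x(p := a p)) = outer_positions x - {p}"
      using ina by (auto simp: outer_positions_def)
    have rest: "(\<lambda>q. if q \<in> outer_positions (x(p := a p)) then a q else (x(p := a p)) q) =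
      (\<lambda>q. if q \<in> outer_positions x then a q else x q)"
      unfolding out using p(1) by (intro ext) auto
    have ms: "mset_set (outer_positions x) = add_mset p (mset_set (outer_positions x - {p}))"
      using p(1) by (simp add: mset_set.remove)
    have im: "image_mset (\<lambda>q. moving_root ((x(p := a p)) q) (a q)) (mset_set (outer_positions x - {p})) =
      image_mset (\<lambda>q. moving_root (x q) (a q)) (mset_set (outer_positions x - {p}))"
      by (intro image_mset_cong) auto
    have as: "assignment \<alpha>s (x(p := a p)) a"
      using Cons.prems(4) \<alpha> unfolding assignment_def rest unfolding out im ms by auto
    have un: "\<forall>q \<in> outer_positions (x(p := a p)). a' q = a q" if "assignment \<alpha>s (x(p := a p)) a'" for a'
    proof -
      have "assignment (\<alpha> # \<alpha>s) x (a'(p := a p))"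
        using p(1) ina out \<alpha>[symmetric] that by (rule assignment_extend)
      then have "\<forall>q\<in>outer_positions x. (a'(p := a p)) q = a q" by (rule Cons.prems(5))
      then show ?thesis unfolding out by (metis DiffE fun_upd_other singletonI)
    qed
    have len: "length \<alpha>s = card (outer_positions (x(p := a p)))"
      using Cons.prems(2) p out by (simp add: card_Diff_singleton)
    obtain k :: nat where k: "k \<ge> 1" "apply_roots \<alpha>s (fill (x(p := a p))) = of_nat k *
      ((\<Prod>q\<in>outer_positions (x(p := a p)). f (moving_root ((x(p := a p)) q) (a q)) $$ ((x(p := a p)) q, a q)) *
       v (fill (\<lambda>q. if q \<in> outer_positions x then a q else x q)))"
      using Cons.IH[OF letters_upd[OF Cons.prems(1) aN[OF p(1)]] len sub as un] unfolding rest by blast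
    have "(\<Prod>q\<in>outer_positions (x(p := a p)). f (moving_root ((x(p := a p)) q) (a q)) $$ ((x(p := a p)) q, a q)) =
       (\<Prod>q\<in>outer_positions x - {p}. f (moving_root (x q) (a q)) $$ (x q, a q))"
      unfolding out by (intro prod.cong refl) auto
    moreover have "(\<Prod>q\<in>outer_positions x. f (moving_root (x q) (a q)) $$ (x q, a q)) =
       f \<alpha> $$ (x p, a p) * (\<Prod>q\<in>outer_positions x - {p}. f (moving_root (x q) (a q)) $$ (x q, a q))"
      using p(1) \<alpha> by (simp add: prod.remove)
    ultimately show ?thesis using k by (intro exI[of _ k]) (simp add: C_def)
  qed
  then obtain k where k: "\<And>p. p \<in> D \<Longrightarrow> k p \<ge> (1::nat)"
    "\<And>p. p \<in> D \<Longrightarrow> f \<alpha> $$ (x p, a p) * apply_roots \<alpha>s (fill (x(p := a p))) = of_nat (k p) * C" by metis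
  have finD: "finite D" "D \<subseteq> {..<K}" by (auto simp: D_def outer_positions_def)
  have "D \<noteq> {}"
  proof -
    have "\<alpha> \<in># mset (\<alpha> # \<alpha>s)" by simp
    then have "\<alpha> \<in> (\<lambda>p. moving_root (x p) (a p)) ` outer_positions x"
      using Cons.prems(4) unfolding assignment_def by (metis finite_outer finite_set_mset_mset_set set_image_mset)
    then show ?thesis by (auto simp: D_def)
  qed
  have "apply_roots (\<alpha> # \<alpha>s) (fill x) = (\<Sum>p<K. \<Sum>b<N. f \<alpha> $$ (x p, b) * apply_roots \<alpha>s (fill (x(p := b))))"
    using lie_fill[OF Cons.prems(1)] by (simp add: apply_roots_def)
  also have "\<dots> = (\<Sum>p\<in>D. \<Sum>b<N. f \<alpha> $$ (x p, b) * apply_roots \<alpha>s (fill (x(p := b))))"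
    using finD zero by (intro sum.mono_neutral_right) (auto intro!: sum.neutral)
  also have "\<dots> = (\<Sum>p\<in>D. \<Sum>b\<in>{a p}. f \<alpha> $$ (x p, b) * apply_roots \<alpha>s (fill (x(p := b))))"
    using finD(2) zero aN by (intro sum.cong refl sum.mono_neutral_right) (auto simp: D_def)
  also have "\<dots> = (\<Sum>p\<in>D. of_nat (k p) * C)" using k(2) by simp
  also have "\<dots> = of_nat (\<Sum>p\<in>D. k p) * C" by (simp add: sum_distrib_right)
  finally have "apply_roots (\<alpha> # \<alpha>s) (fill x) = of_nat (\<Sum>p\<in>D. k p) * C" .
  moreover have "(\<Sum>p\<in>D. k p) \<ge> 1"
  proof -
    obtain p where "p \<in> D" using \<open>D \<noteq> {}\<close> by blast
    then have "k p \<le> (\<Sum>p\<in>D. k p)" using finD(1) by (intro member_le_sum) auto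
    then show ?thesis using k(1)[OF \<open>p \<in> D\<close>] by simp
  qed
  ultimately show ?case unfolding C_def by blast
qed

end

lemma count_image_mset_set:
  assumes "finite D"
  shows "count (image_mset g (mset_set D)) a = card {p \<in> D. g p = a}"
  using assms
proof (induction D)
  case (insert p D)
  have "{q \<in> insert p D. g q = a} = (if g p = a then insert p {q \<in> D. g q = a} else {q \<in> D. g q = a})" by auto
  then show ?case using insert by simp
qed simp

section \<open>Words and multisets of roots attached to patterns\<close>

context root_action
begin

text \<open>The column with number \<open>c\<close> of the word of a pattern \<open>X\<close> encodes the level set \<open>{(i, k). c < X i k}\<close>: the
  letter \<open>i\<close> is moved by the root at the first \<open>k\<close> in the level set, unless the arrow to the next
  row stays in the level set.\<close>

definition first_level :: "(nat \<Rightarrow> nat \<Rightarrow> nat) \<Rightarrow> nat \<Rightarrow> nat" where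
  "first_level X p = (LEAST k. col p < X (row p) k)"

definition moved :: "(nat \<Rightarrow> nat \<Rightarrow> nat) \<Rightarrow> nat \<Rightarrow> bool" where
  "moved X p \<longleftrightarrow> first_level X p \<le> 2 * n \<and> X (row p + 1) (first_level X p + 1) \<le> col p"

text \<open>The 0-based letter to which the root at row i and level k moves the letter i: unbarred,
  odd and barred as the level decreases.\<close>

definition letter_at :: "nat \<Rightarrow> nat \<Rightarrow> nat" where
  "letter_at i k = (if n + i < k then 2 * n + i - k else if k = n + i then 2 * n else n + k - i)"

definition pattern_word :: "(nat \<Rightarrow> nat \<Rightarrow> nat) \<Rightarrow> nat \<Rightarrow> nat" where
  "pattern_word X p = (if moved X p then letter_at (row p) (first_level X p) else row p - 1)"

definition pattern_roots :: "(nat \<Rightarrow> nat \<Rightarrow> nat) \<Rightarrow> root multiset" where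
  "pattern_roots X = image_mset (\<lambda>p. moving_root (pattern_word X p) (row p - 1))
     (mset_set (outer_positions (pattern_word X)))"

definition root_wt :: "root \<Rightarrow> nat" where
  "root_wt \<alpha> = root_row \<alpha> * (level \<alpha> + 1 - root_row \<alpha>)"

text \<open>Numbers the target letters in the order in which they appear with increasing level: in
  1-based numbering n + 1, ..., 2 n, then 2 n + 1, then n, ..., 2 receive 1, ..., 2 n.\<close>

definition letter_wt :: "nat \<Rightarrow> nat" where
  "letter_wt b = (if b < n then 2 * n + 1 - b else if b = 2 * n then n + 1 else b + 1 - n)"

lemma root_wt_moving:
  assumes "a < n" "a < b" "b < N" shows "root_wt (moving_root b a) = (a + 1) * letter_wt b"
proof -
  consider "b < n" | "b = 2 * n" | j where "b = n + j" "j < n"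
    using assms(3) le_Suc_ex[of n b] by (fastforce simp: N_def not_less)
  then show ?thesis
  proof cases
    case (3 j)
    then show ?thesis using assms by (cases "a \<le> j")
      (auto simp: moving_root_def root_wt_def letter_wt_def root_row_def level_def min_def max_def)
  qed (use assms in \<open>auto simp: moving_root_def root_wt_def letter_wt_def root_row_def level_def\<close>)
qed

lemma letter_at:
  assumes "1 \<le> i" "i \<le> n" "2 * i \<le> k + 1" "k \<le> 2 * n"
  shows "letter_at i k < N" "moving_root (letter_at i k) (i - 1) = root_at i k" "letter_wt (letter_at i k) = k + 1 - i"
  using assms by (auto simp: letter_at_def N_def moving_root_def root_at_def letter_wt_def min_def max_def)

lemma first_level:
  assumes X: "pattern X" and p: "p < K"
  shows "col p < X (row p) (first_level X p)" "k < first_level X p \<Longrightarrow> X (row p) k \<le> col p"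
    "2 * row p \<le> first_level X p + 1" "first_level X p = k \<longleftrightarrow> col p < X (row p) k \<and> (k = 0 \<or> X (row p) (k - 1) \<le> col p)"
proof -
  note b = box_bounds[OF p]
  have "col p < X (row p) (2 * n + 1)" using patternD(2)[OF X b(1), of "2 * n + 1"] b(3) by simp
  then show 1: "col p < X (row p) (first_level X p)" unfolding first_level_def by (rule LeastI)
  show 2: "X (row p) k \<le> col p" if "k < first_level X p" for k
    using not_less_Least[of k "\<lambda>k. col p < X (row p) k"] that by (simp add: first_level_def)
  show "2 * row p \<le> first_level X p + 1"
    using patternD(1)[OF X b(1), of "first_level X p"] 1 by (cases "first_level X p + 1 < 2 * row p") auto
  show "first_level X p = k \<longleftrightarrow> col p < X (row p) k \<and> (k = 0 \<or> X (row p) (k - 1) \<le> col p)"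
  proof
    assume "col p < X (row p) k \<and> (k = 0 \<or> X (row p) (k - 1) \<le> col p)"
    then have k: "col p < X (row p) k" "k = 0 \<or> X (row p) (k - 1) \<le> col p" by auto
    have "first_level X p \<le> k" unfolding first_level_def using k(1) by (rule Least_le)
    moreover have "\<not> first_level X p < k"
    proof
      assume "first_level X p < k"
      then have "first_level X p \<le> k - 1" by simp
      then have "X (row p) (first_level X p) \<le> X (row p) (k - 1)"
        by (rule pattern_row_mono[OF X b(1)])
      then show False using k(2) 1 \<open>first_level X p < k\<close> by auto
    qed
    ultimately show "first_level X p = k" by simp
  qed (use 1 2[of "k - 1"] in \<open>cases "k = 0"; auto\<close>)
qed

lemma moved_letter:
  assumes X: "pattern X" and p: "p < K" "moved X p"
  shows "letter_at (row p) (first_level X p) < N"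
    "moving_root (letter_at (row p) (first_level X p)) (row p - 1) = root_at (row p) (first_level X p)"
    "letter_wt (letter_at (row p) (first_level X p)) = first_level X p + 1 - row p"
  using letter_at[of "row p" "first_level X p"] box_bounds[OF p(1)] first_level(3)[OF X p(1)] p(2)
  by (auto simp: moved_def)

lemma pattern_word_letters: "pattern X \<Longrightarrow> letters (pattern_word X)"
  using moved_letter(1) box_bounds by (force simp: letters_def pattern_word_def N_def)

text \<open>A moved letter could be inner only if it were an unbarred letter whose row still meets
  the column. Diagonal monotonicity from (i + 1, k + 1) up to level 2 n + 1 ends exactly in the row
  of that letter, at its boundary value, and contradicts \<open>moved\<close>.\<close>

lemma outer_pattern_word:
  assumes X: "pattern X"
  shows "outer_positions (pattern_word X) = {p. p < K \<and> moved X p}"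
proof -
  have "\<not> inner (col p) (letter_at (row p) (first_level X p))" if p: "p < K" "moved X p" for p
  proof
    define i k c where "i = row p" and "k = first_level X p" and "c = col p"
    assume "inner (col p) (letter_at (row p) (first_level X p))"
    then have l: "letter_at i k < n" "c < lam (letter_at i k + 1)" by (auto simp: inner_def i_def k_def c_def)
    have k: "k \<le> 2 * n" "X (i + 1) (k + 1) \<le> c" "2 * i \<le> k + 1"
      using p first_level(3)[OF X p(1)] by (auto simp: moved_def i_def k_def c_def)
    have la: "letter_at i k = 2 * n + i - k" using l(1) k by (auto simp: letter_at_def split: if_splits)
    have "X (i + 1 + (2 * n - k)) (k + 1 + (2 * n - k)) \<le> X (i + 1) (k + 1)"
      by (rule pattern_diag_mono[OF X]) simp
    moreover have "X (i + 1 + (2 * n - k)) (k + 1 + (2 * n - k)) = lam (i + 1 + (2 * n - k))"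
      using k by (intro patternD(2)[OF X]) auto
    moreover have "letter_at i k + 1 = i + 1 + (2 * n - k)" using la k by simp
    ultimately show False using l(2) k(2) by simp
  qed
  then show ?thesis using inner_row by (auto simp: outer_positions_def pattern_word_def)
qed

text \<open>The boxes of row i moved by the root at level k are those in the columns c with
  \<open>M\<close> \<le> c < \<open>X i k\<close>: the lower bound says that k is the first level
  and that the arrow to the next row leaves the level set.\<close>

lemma count_pattern_roots:
  assumes X: "pattern X" shows "count (pattern_roots X) \<alpha> = transfer X \<alpha>"
proof -
  define S where "S = {p. p < K \<and> moved X p \<and> root_at (row p) (first_level X p) = \<alpha>}"
  have "count (pattern_roots X) \<alpha> = card {p \<in> outer_positions (pattern_word X). moving_root (pattern_word X p) (row p - 1) = \<alpha>}"
    unfolding pattern_roots_def by (rule count_image_mset_set) simp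
  also have "{p \<in> outer_positions (pattern_word X). moving_root (pattern_word X p) (row p - 1) = \<alpha>} = S"
    using moved_letter(2)[OF X] by (auto simp: outer_pattern_word[OF X] S_def pattern_word_def)
  finally have count: "count (pattern_roots X) \<alpha> = card S" .
  have valid: "1 \<le> row p" "row p \<le> n" "2 * row p \<le> first_level X p + 1" "first_level X p \<le> 2 * n" if "p < K" "moved X p" for p
    using that box_bounds first_level(3)[OF X] by (auto simp: moved_def)
  show ?thesis
  proof (cases "\<alpha> \<in> poset n")
    case False
    then have "S = {}" using root_at(1)[OF valid] by (auto simp: S_def)
    then show ?thesis using count False by (simp add: transfer_def)
  next
    case True
    define i k where "i = root_row \<alpha>" and "k = level \<alpha>"
    note ik = poset_level[OF True, folded i_def k_def]
    define M where "M = max (X i (k - 1)) (X (i + 1) (k + 1))"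
    have Xle: "X i k \<le> lam i"
      using pattern_row_mono[OF X ik(1), of k "2 * n + 1"] patternD(2)[OF X ik(1), of "2 * n + 1"] ik(4) by simp
    have mem: "pos i c \<in> S" if c: "M \<le> c" "c < X i k" for c
    proof -
      have "c < lam i" using c Xle by simp
      note q = pos[OF ik(1) this]
      have "first_level X (pos i c) = k" using first_level(4)[OF X q(1), of k] q c by (simp add: M_def)
      then show ?thesis using q c ik by (simp add: S_def moved_def M_def)
    qed
    have "S = (\<lambda>c. pos i c) ` {M..<X i k}"
    proof
      show "S \<subseteq> (\<lambda>c. pos i c) ` {M..<X i k}"
      proof
        fix p assume "p \<in> S"
        then have p: "p < K" "moved X p" "root_at (row p) (first_level X p) = \<alpha>" by (auto simp: S_def)
        then have e: "row p = i" "first_level X p = k"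
          using root_at(2,3)[OF valid[OF p(1,2)]] by (auto simp: i_def k_def)
        have "col p < X i k" "X i (k - 1) \<le> col p" "X (i + 1) (k + 1) \<le> col p"
          using first_level(4)[OF X p(1), of k] p(2) e ik patternD(1)[OF X ik(1), of "k - 1"] by (auto simp: moved_def)
        then show "p \<in> (\<lambda>c. pos i c) ` {M..<X i k}"
          using pos_row_col[OF p(1)] e by (intro image_eqI[of _ _ "col p"]) (auto simp: M_def)
      qed
    qed (use mem in auto)
    moreover have "inj_on (\<lambda>c. pos i c) {M..<X i k}"
    proof (rule inj_onI)
      fix c d assume *: "c \<in> {M..<X i k}" "d \<in> {M..<X i k}" "pos i c = pos i d"
      then have "c < lam i" "d < lam i" using Xle by auto
      then have "col (pos i c) = c" "col (pos i d) = d" by (simp_all only: pos(3)[OF ik(1)])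
      then show "c = d" using *(3) by metis
    qed
    ultimately have "card S = X i k - M" by (simp add: card_image)
    then show ?thesis using count True by (simp add: transfer_def i_def k_def M_def)
  qed
qed

lemma pattern_word_assignment:
  assumes X: "pattern X" and "mset \<alpha>s = pattern_roots X"
  shows "assignment \<alpha>s (pattern_word X) (\<lambda>p. row p - 1)"
proof -
  have "fill (\<lambda>p. if p \<in> outer_positions (pattern_word X) then row p - 1 else pattern_word X p) = fill (\<lambda>p. row p - 1)"
    by (rule fill_cong) (auto simp: outer_pattern_word[OF X] pattern_word_def)
  moreover have "\<forall>p\<in>outer_positions (pattern_word X). inner (col p) (row p - 1)"
    using inner_row by (simp add: outer_positions_def)
  ultimately show ?thesis
    using assms(2) v_top by (simp only: assignment_def pattern_roots_def) simp
qed

text \<open>The left side depends only on the multiset of roots, the right side on the assignment;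
  this makes competing assignments comparable.\<close>

lemma assignment_wt:
  assumes "letters x" "assignment \<alpha>s x a"
  shows "(\<Sum>\<alpha>\<in>#mset \<alpha>s. root_wt \<alpha>) = (\<Sum>p\<in>outer_positions x. (a p + 1) * letter_wt (x p))"
proof -
  have "(\<Sum>\<alpha>\<in>#mset \<alpha>s. root_wt \<alpha>) = (\<Sum>p\<in>outer_positions x. root_wt (moving_root (x p) (a p)))"
    using assms(2) by (simp add: assignment_def sum_unfold_sum_mset image_mset.compositionality comp_def)
  also have "\<dots> = (\<Sum>p\<in>outer_positions x. (a p + 1) * letter_wt (x p))"
  proof (intro sum.cong refl root_wt_moving)
    fix p assume p: "p \<in> outer_positions x"
    then have i: "inner (col p) (a p)" using assms(2) by (simp add: assignment_def)
    then show "a p < n" by (simp add: inner_def)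
    show "a p < x p" using inner_outer_less[OF i] p by (simp add: outer_positions_def)
    show "x p < N" using p assms(1) by (simp add: letters_def outer_positions_def)
  qed
  finally show ?thesis .
qed

text \<open>Send each moved box to the box of its column where its source letter stands canonically.
  This permutes the moved boxes, since the unmoved ones still hold their canonical letters and a
  column may not repeat a letter. The total root weight becomes a sum of source row times target
  number, to which \<open>rearrangement\<close> applies.\<close>

lemma assignment_pattern_word:
  assumes X: "pattern X" and a: "assignment \<alpha>s (pattern_word X) a"
  shows "(\<Sum>\<alpha>\<in>#mset \<alpha>s. root_wt \<alpha>) < (\<Sum>\<alpha>\<in>#pattern_roots X. root_wt \<alpha>) \<or>
     (\<forall>p \<in> outer_positions (pattern_word X). a p = row p - 1)"
proof -
  define D where "D = outer_positions (pattern_word X)"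
  define x where "x = pattern_word X"
  have D: "p < K" "moved X p" if "p \<in> D" for p using that by (auto simp: D_def outer_pattern_word[OF X])
  have ia: "inner (col p) (a p)" if "p \<in> D" for p using a that by (auto simp: assignment_def D_def)
  define ov where "ov p = (if p \<in> D then a p else x p)" for p
  have vov: "v (fill ov) \<noteq> 0" using a unfolding ov_def[abs_def] D_def x_def assignment_def by blast
  define \<phi> where "\<phi> p = pos (a p + 1) (col p)" for p
  have \<phi>: "\<phi> p < K" "row (\<phi> p) = a p + 1" "col (\<phi> p) = col p" if "p \<in> D" for p
    using pos[of "a p + 1" "col p"] ia[OF that] by (auto simp: \<phi>_def inner_def)
  have \<phi>D: "\<phi> p \<in> D" if p: "p \<in> D" for p
  proof (rule ccontr)
    assume n: "\<phi> p \<notin> D"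
    then have "\<not> moved X (\<phi> p)" using \<phi>(1)[OF p] by (auto simp: D_def outer_pattern_word[OF X])
    then have "ov (\<phi> p) = a p" using n \<phi>(2)[OF p] by (simp add: ov_def x_def pattern_word_def)
    moreover have "ov p = a p" using p by (simp add: ov_def)
    ultimately have "\<phi> p = p" using v_column_inj[OF vov \<phi>(1)[OF p] D(1)[OF p] \<phi>(3)[OF p]] by simp
    then show False using n p by simp
  qed
  have finD: "finite D" by (simp add: D_def)
  have "inj_on \<phi> D"
  proof (rule inj_onI)
    fix p q assume pq: "p \<in> D" "q \<in> D" "\<phi> p = \<phi> q"
    then have "a p = a q" "col p = col q" using \<phi>(2,3)[OF pq(1)] \<phi>(2,3)[OF pq(2)] by auto
    then have "ov p = ov q" using pq by (simp add: ov_def)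
    then show "p = q" using v_column_inj[OF vov D(1)[OF pq(1)] D(1)[OF pq(2)] \<open>col p = col q\<close>] by simp
  qed
  then have bij: "bij_betw \<phi> D D" using endo_inj_surj[of D \<phi>] \<phi>D finD by (auto simp: bij_betw_def)
  define y where "y p = letter_wt (x p)" for p
  have y: "y p = first_level X p + 1 - row p" "row p \<le> first_level X p" if "p \<in> D" for p
    using moved_letter(3)[OF X D[OF that]] D[OF that] first_level(3)[OF X D(1)[OF that]] box_bounds(1)[OF D(1)[OF that]]
    by (auto simp: y_def x_def pattern_word_def)
  \<comment> \<open>If the target numbers failed to increase, the diagonal from row p + 1 at the
    next level would meet the row of q at a level not below \<open>first_level X q\<close>. Its
    starting point would then lie in the level set of the column, which \<open>moved X p\<close>
    excludes; here row p + 1 means the row after that of p.\<close>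
  have mono: "y p < y q" if pq: "p \<in> D" "q \<in> D" "col p = col q" "row p < row q" for p q
  proof (rule ccontr)
    assume "\<not> y p < y q"
    then have le: "first_level X q + row p \<le> first_level X p + row q" using y[OF pq(1)] y[OF pq(2)] by linarith
    define r where "r = row q - row p - 1"
    have r: "row q = row p + 1 + r" using pq by (simp add: r_def)
    have "X (row p + 1 + r) (first_level X p + 1 + r) \<le> X (row p + 1) (first_level X p + 1)"
      by (rule pattern_diag_mono[OF X]) simp
    moreover have "X (row q) (first_level X q) \<le> X (row q) (first_level X p + 1 + r)"
      using le r box_bounds(1)[OF D(1)[OF pq(2)]] by (intro pattern_row_mono[OF X]) auto
    ultimately have "X (row q) (first_level X q) \<le> X (row p + 1) (first_level X p + 1)" using r by simp
    also have "\<dots> \<le> col p" using D(2)[OF pq(1)] by (simp add: moved_def)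
    finally show False using first_level(1)[OF X D(1)[OF pq(2)]] pq(3) by simp
  qed
  have "(\<Sum>p\<in>D. row (\<phi> p) * y p) < (\<Sum>p\<in>D. row p * y p) \<or> (\<forall>p\<in>D. \<phi> p = p)"
    using finD bij \<phi>(3) mono by (rule rearrangement[where c = col]) (use box_inj D(1) in auto)
  moreover have "(\<Sum>\<alpha>\<in>#mset \<alpha>s. root_wt \<alpha>) = (\<Sum>p\<in>D. row (\<phi> p) * y p)"
    using assignment_wt[OF pattern_word_letters[OF X] a] \<phi>(2) by (simp add: D_def y_def x_def)
  moreover have "(\<Sum>\<alpha>\<in>#pattern_roots X. root_wt \<alpha>) = (\<Sum>p\<in>D. row p * y p)"
  proof -
    obtain \<beta>s where \<beta>s: "mset \<beta>s = pattern_roots X" using ex_mset by blast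
    have "(\<Sum>\<alpha>\<in>#mset \<beta>s. root_wt \<alpha>) = (\<Sum>p\<in>D. (row p - 1 + 1) * y p)"
      using assignment_wt[OF pattern_word_letters[OF X] pattern_word_assignment[OF X \<beta>s]] by (simp add: D_def y_def x_def)
    also have "\<dots> = (\<Sum>p\<in>D. row p * y p)"
    proof (intro sum.cong refl)
      fix p assume "p \<in> D"
      then have "1 \<le> row p" by (rule box_bounds(1)[OF D(1)])
      then have "row p - 1 + 1 = row p" by simp
      then show "(row p - 1 + 1) * y p = row p * y p" by simp
    qed
    finally show ?thesis by (simp add: \<beta>s)
  qed
  moreover have "a p = row p - 1" if "p \<in> D" "\<phi> p = p" for p using \<phi>(2)[OF that(1)] that(2) by simp
  ultimately show ?thesis unfolding D_def[symmetric] by auto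
qed

lemma apply_roots_pattern_word:
  assumes X: "pattern X" and "set \<alpha>s \<subseteq> poset n" and len: "length \<alpha>s = card (outer_positions (pattern_word X))"
    and nz: "apply_roots \<alpha>s (fill (pattern_word X)) \<noteq> 0"
  shows "(\<Sum>\<alpha>\<in>#mset \<alpha>s. root_wt \<alpha>) < (\<Sum>\<alpha>\<in>#pattern_roots X. root_wt \<alpha>) \<or> mset \<alpha>s = pattern_roots X"
proof -
  obtain a where a: "assignment \<alpha>s (pattern_word X) a"
    using assignment_exists[OF pattern_word_letters[OF X] len assms(2) nz] by blast
  show ?thesis
  proof (rule disjE[OF assignment_pattern_word[OF X a]])
    assume eq: "\<forall>p \<in> outer_positions (pattern_word X). a p = row p - 1"
    have "mset \<alpha>s = pattern_roots X"
      using a eq unfolding assignment_def pattern_roots_def by (auto intro!: image_mset_cong)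
    then show ?thesis ..
  qed simp
qed

lemma apply_roots_pattern_nonzero:
  assumes X: "pattern X" and ms: "mset \<alpha>s = pattern_roots X" and sub: "set \<alpha>s \<subseteq> poset n"
  shows "length \<alpha>s = card (outer_positions (pattern_word X))" "apply_roots \<alpha>s (fill (pattern_word X)) \<noteq> 0"
proof -
  show len: "length \<alpha>s = card (outer_positions (pattern_word X))"
    using arg_cong[OF ms, of size] by (simp add: pattern_roots_def)
  define D where "D = outer_positions (pattern_word X)"
  have un: "\<forall>p \<in> outer_positions (pattern_word X). a p = row p - 1" if "assignment \<alpha>s (pattern_word X) a" for a
    using assignment_pattern_word[OF X that] ms by simp
  note as = pattern_word_assignment[OF X ms]
  obtain k :: nat where "k \<ge> 1" and k: "apply_roots \<alpha>s (fill (pattern_word X)) = of_nat k *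
    ((\<Prod>p\<in>D. f (moving_root (pattern_word X p) (row p - 1)) $$ (pattern_word X p, row p - 1)) *
     v (fill (\<lambda>p. if p \<in> D then row p - 1 else pattern_word X p)))"
    using assignment_unique[OF pattern_word_letters[OF X] len sub as un] unfolding D_def by blast
  have "f (moving_root (pattern_word X p) (row p - 1)) $$ (pattern_word X p, row p - 1) \<noteq> 0" if p: "p \<in> D" for p
  proof (rule moving_root_entry(2)[OF f])
    have i: "inner (col p) (row p - 1)" using p inner_row by (simp add: D_def outer_positions_def)
    then show "row p - 1 < n" by (simp add: inner_def)
    show "row p - 1 < pattern_word X p" using inner_outer_less[OF i] p by (simp add: D_def outer_positions_def)
    show "pattern_word X p < N" using pattern_word_letters[OF X] p by (simp add: letters_def D_def outer_positions_def)
  qed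
  moreover have "v (fill (\<lambda>p. if p \<in> D then row p - 1 else pattern_word X p)) \<noteq> 0"
    using as unfolding assignment_def D_def by blast
  ultimately show "apply_roots \<alpha>s (fill (pattern_word X)) \<noteq> 0"
    using k \<open>k \<ge> 1\<close> by (simp add: D_def)
qed

section \<open>Triangularity of monomials against pattern words\<close>

definition expand :: "root list \<Rightarrow> (root \<Rightarrow> nat) \<Rightarrow> root list" where
  "expand rs s = concat (map (\<lambda>\<alpha>. replicate (s \<alpha>) \<alpha>) rs)"

lemma set_expand: "set (expand rs s) \<subseteq> set rs"
  by (auto simp: expand_def)

lemma count_expand: "distinct rs \<Longrightarrow> count (mset (expand rs s)) \<alpha> = (if \<alpha> \<in> set rs then s \<alpha> else 0)"
  by (induction rs) (auto simp: expand_def)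

lemma mset_expand:
  assumes "distinct rs" "set rs = poset n" "pattern X"
  shows "mset (expand rs (transfer X)) = pattern_roots X"
  by (rule multiset_eqI) (simp add: count_expand[OF assms(1)] assms(2) count_pattern_roots[OF assms(3)] transfer_def)

text \<open>Among the monomials of degree at least e with nonzero coefficient, one of greatest
  degree and then of least root weight is evaluated at its pattern word. Smaller degree cannot
  change enough letters, larger degree has coefficient 0, and in equal degree a nonzero coordinate
  requires smaller weight or the same multiset of roots.\<close>

theorem monomials_independent:
  assumes rs: "distinct rs" "set rs = poset n" and S: "finite S" "S \<subseteq> FFLV_int n m"
    and van: "\<And>x. letters x \<Longrightarrow> e \<le> card (outer_positions x) \<Longrightarrow> (\<Sum>s\<in>S. c s * apply_roots (expand rs s) (fill x)) = 0"
    and s: "s \<in> S" "e \<le> length (expand rs s)"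
  shows "c s = 0"
proof (rule ccontr)
  assume "c s \<noteq> 0"
  define B where "B = {s \<in> S. e \<le> length (expand rs s) \<and> c s \<noteq> 0}"
  define d where "d = Max ((\<lambda>s. length (expand rs s)) ` B)"
  define wt where "wt s = (\<Sum>\<alpha>\<in>#mset (expand rs s). root_wt \<alpha>)" for s
  have B: "finite B" "B \<noteq> {}" using S(1) s \<open>c s \<noteq> 0\<close> by (auto simp: B_def)
  have "d \<in> (\<lambda>s. length (expand rs s)) ` B" unfolding d_def using B by (intro Max_in) auto
  then obtain s1 where s1: "s1 \<in> B \<and> length (expand rs s1) = d" by auto
  then obtain s0 where s0: "s0 \<in> B \<and> length (expand rs s0) = d"
    and min: "\<And>s'. s' \<in> B \<and> length (expand rs s') = d \<Longrightarrow> wt s0 \<le> wt s'"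
    using ex_has_least_nat[of "\<lambda>s. s \<in> B \<and> length (expand rs s) = d" s1 wt] by blast
  have max: "length (expand rs s') \<le> d" if "s' \<in> B" for s' using that B(1) by (simp add: d_def)
  have "s0 \<in> FFLV_int n m" using s0 S by (auto simp: B_def)
  then obtain X where X: "pattern X" "transfer X = s0" using FFLV_pattern by blast
  have ms: "mset (expand rs s0) = pattern_roots X" using mset_expand[OF rs X(1)] X(2) by simp
  have sub: "set (expand rs s') \<subseteq> poset n" for s' using set_expand rs(2) by blast
  note nz = apply_roots_pattern_nonzero[OF X(1) ms sub]
  have d: "d = card (outer_positions (pattern_word X))" using nz(1) s0 by simp
  note lX = pattern_word_letters[OF X(1)]
  have "c s' * apply_roots (expand rs s') (fill (pattern_word X)) = 0" if s': "s' \<in> S" "s' \<noteq> s0" for s'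
  proof (rule ccontr)
    assume "\<not> ?thesis"
    then have *: "c s' \<noteq> 0" "apply_roots (expand rs s') (fill (pattern_word X)) \<noteq> 0" by auto
    have ge: "d \<le> length (expand rs s')" using apply_roots_vanish[OF lX, of "expand rs s'"] *(2) d by (meson not_le)
    moreover have "e \<le> d" using s0 by (auto simp: B_def)
    ultimately have "s' \<in> B" using s' * by (simp add: B_def)
    then have len: "length (expand rs s') = d" using max ge by (simp add: order.antisym)
    then have "wt s0 \<le> wt s'" using min \<open>s' \<in> B\<close> by blast
    then have "mset (expand rs s') = pattern_roots X"
      using apply_roots_pattern_word[OF X(1) sub, of s'] len d *(2) ms by (simp add: wt_def)
    then have eq: "count (mset (expand rs s')) \<alpha> = count (mset (expand rs s0)) \<alpha>" for \<alpha> using ms by simp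
    have "s' \<alpha> = s0 \<alpha>" for \<alpha>
    proof (cases "\<alpha> \<in> poset n")
      case True
      then show ?thesis using eq[of \<alpha>] rs by (simp add: count_expand)
    next
      case False
      then show ?thesis using s'(1) \<open>s0 \<in> FFLV_int n m\<close> S(2) by (auto simp: FFLV_int_iff)
    qed
    then show False using s'(2) by blast
  qed
  then have "(\<Sum>s\<in>S. c s * apply_roots (expand rs s) (fill (pattern_word X))) = (\<Sum>s\<in>{s0}. c s * apply_roots (expand rs s) (fill (pattern_word X)))"
    using S(1) s0 by (intro sum.mono_neutral_right) (auto simp: B_def)
  moreover have "e \<le> d" using s0 by (auto simp: B_def)
  ultimately have "c s0 * apply_roots (expand rs s0) (fill (pattern_word X)) = 0"
    using van[OF lX] d by simp
  then show False using nz(2) s0 by (simp add: B_def)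
qed

end

section \<open>Bases\<close>

text \<open>Gaussian elimination: if the equation k is not trivial, it is solved for one unknown j,
  and the remaining equations still have more unknowns than equations.\<close>

lemma nontrivial_relation:
  fixes g :: "'i \<Rightarrow> 'k \<Rightarrow> 'f::field"
  assumes "finite K" "finite I" "card K < card I"
  shows "\<exists>c. (\<exists>i\<in>I. c i \<noteq> 0) \<and> (\<forall>k\<in>K. (\<Sum>i\<in>I. c i * g i k) = 0)"
  using assms
proof (induction K arbitrary: I g rule: finite_induct)
  case empty
  then have "I \<noteq> {}" by auto
  then show ?case by (intro exI[of _ "\<lambda>_. 1"]) auto
next
  case (insert k K)
  show ?case
  proof (cases "\<forall>i\<in>I. g i k = 0")
    case True
    have "card K < card I" using insert by simp
    then obtain c where c: "\<exists>i\<in>I. c i \<noteq> 0" "\<forall>k\<in>K. (\<Sum>i\<in>I. c i * g i k) = 0"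
      using insert.IH[OF insert.prems(1), of g] by blast
    then show ?thesis using True by (intro exI[of _ c]) auto
  next
    case False
    then obtain j where j: "j \<in> I" "g j k \<noteq> 0" by blast
    define J where "J = I - {j}"
    have J: "finite J" "j \<notin> J" "I = insert j J" using insert.prems j by (auto simp: J_def)
    have "card K < card J" using insert J by simp
    then obtain c where c: "\<exists>i\<in>J. c i \<noteq> 0" "\<forall>l\<in>K. (\<Sum>i\<in>J. c i * (g i l - g i k / g j k * g j l)) = 0"
      using insert.IH[OF J(1), of "\<lambda>i l. g i l - g i k / g j k * g j l"] by blast
    define d where "d = c(j := - (\<Sum>i\<in>J. c i * (g i k / g j k)))"
    have sum: "(\<Sum>i\<in>I. d i * g i l) = (\<Sum>i\<in>J. c i * (g i l - g i k / g j k * g j l))" for l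
    proof -
      have "(\<Sum>i\<in>J. d i * g i l) = (\<Sum>i\<in>J. c i * g i l)"
        using J(2) by (intro sum.cong refl) (auto simp: d_def)
      moreover have "(\<Sum>i\<in>I. d i * g i l) = d j * g j l + (\<Sum>i\<in>J. d i * g i l)"
        unfolding J(3) using J(1,2) by simp
      ultimately show ?thesis
        by (simp add: d_def sum_distrib_right right_diff_distrib sum_subtractf mult.assoc)
    qed
    have "(\<Sum>i\<in>I. d i * g i k) = 0" unfolding sum using j(2) by simp
    moreover have "\<exists>i\<in>I. d i \<noteq> 0" using c(1) J by (auto simp: d_def)
    ultimately show ?thesis using sum c(2) by (intro exI[of _ d]) auto
  qed
qed

text \<open>Coefficients are indexed by \<open>I\<close> and not by the vectors; uniqueness, applied
  to indicator coefficients, then yields the injectivity of \<open>b\<close>.\<close>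

lemma basis_familyI:
  fixes M :: "(complex, 'a) module" and b :: "'i \<Rightarrow> 'a"
  assumes M: "Module.module class_ring M" and fin: "finite I" and b: "\<And>i. i \<in> I \<Longrightarrow> b i \<in> carrier M"
    and span: "\<And>x. x \<in> carrier M \<Longrightarrow> \<exists>c. (\<Oplus>\<^bsub>M\<^esub>i\<in>I. c i \<odot>\<^bsub>M\<^esub> b i) = x"
    and uniq: "\<And>c c' i. (\<Oplus>\<^bsub>M\<^esub>i\<in>I. c i \<odot>\<^bsub>M\<^esub> b i) = (\<Oplus>\<^bsub>M\<^esub>i\<in>I. c' i \<odot>\<^bsub>M\<^esub> b i) \<Longrightarrow> i \<in> I \<Longrightarrow> c i = c' i"
  shows "basis_family M I b"
proof -
  interpret M: Module.module "class_ring :: complex ring" M by (rule M)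
  have vs: "vectorspace class_ring M"
    using M class_field by (rule vectorspace.intro)
  have delta: "(\<Oplus>\<^bsub>M\<^esub>k\<in>I. (if i = k then 1 else 0) \<odot>\<^bsub>M\<^esub> b k) = b i" if i: "i \<in> I" for i
  proof -
    have "(\<Oplus>\<^bsub>M\<^esub>k\<in>I. (if i = k then 1 else 0) \<odot>\<^bsub>M\<^esub> b k) = (\<Oplus>\<^bsub>M\<^esub>k\<in>I. if i = k then b k else \<zero>\<^bsub>M\<^esub>)"
      using b M.smult_one M.smult_l_null by (intro M.finsum_cong') auto
    also have "\<dots> = b i" using i fin b by (intro M.finsum_singleton) auto
    finally show ?thesis .
  qed
  have inj: "inj_on b I"
  proof (rule inj_onI)
    fix i j assume ij: "i \<in> I" "j \<in> I" "b i = b j"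
    then have "(\<Oplus>\<^bsub>M\<^esub>k\<in>I. (if i = k then 1 else 0) \<odot>\<^bsub>M\<^esub> b k) = (\<Oplus>\<^bsub>M\<^esub>k\<in>I. (if j = k then 1 else 0) \<odot>\<^bsub>M\<^esub> b k)"
      using delta by simp
    then have "(if i = j then 1 else 0 :: complex) = (if j = j then 1 else 0)" using ij(2) by (rule uniq)
    then show "i = j" by (simp split: if_splits)
  qed
  have lin: "M.lincomb a (b ` I) = (\<Oplus>\<^bsub>M\<^esub>i\<in>I. a (b i) \<odot>\<^bsub>M\<^esub> b i)" for a
    unfolding M.lincomb_def using b inj M.smult_closed by (intro M.finsum_reindex) auto
  have sub: "b ` I \<subseteq> carrier M" using b by blast
  have "vectorspace.basis class_ring M (b ` I)"
    unfolding vectorspace.basis_criterion[OF vs finite_imageI[OF fin] sub]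
  proof (intro allI impI ex_ex1I)
    fix x assume "x \<in> carrier M"
    then obtain c where c: "(\<Oplus>\<^bsub>M\<^esub>i\<in>I. c i \<odot>\<^bsub>M\<^esub> b i) = x" using span by blast
    \<comment> \<open>\<open>vectorspace.basis_criterion\<close> asks for a unique extensional
      coefficient function on the set of vectors, hence the restriction.\<close>
    define a where "a = restrict (\<lambda>y. c (the_inv_into I b y)) (b ` I)"
    have "(\<Oplus>\<^bsub>M\<^esub>i\<in>I. a (b i) \<odot>\<^bsub>M\<^esub> b i) = (\<Oplus>\<^bsub>M\<^esub>i\<in>I. c i \<odot>\<^bsub>M\<^esub> b i)"
      using b inj M.smult_closed by (intro M.finsum_cong') (auto simp: a_def the_inv_into_f_f)
    then show "\<exists>a. a \<in> b ` I \<rightarrow>\<^sub>E carrier class_ring \<and> M.lincomb a (b ` I) = x"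
      using c by (intro exI[of _ a]) (auto simp: lin a_def)
  next
    fix x a a' assume a: "a \<in> b ` I \<rightarrow>\<^sub>E carrier class_ring \<and> M.lincomb a (b ` I) = x"
      and a': "a' \<in> b ` I \<rightarrow>\<^sub>E carrier class_ring \<and> M.lincomb a' (b ` I) = x"
    have "M.lincomb a (b ` I) = M.lincomb a' (b ` I)" using a a' by (elim conjE) (erule trans, erule sym)
    then have "a (b i) = a' (b i)" if "i \<in> I" for i
      unfolding lin using that by (rule uniq)
    then have "\<And>y. y \<in> b ` I \<Longrightarrow> a y = a' y" by blast
    then show "a = a'" by (rule PiE_ext[OF conjunct1[OF a] conjunct1[OF a']])
  qed
  then show ?thesis using vs inj by (simp add: basis_family_def)
qed

section \<open>Spaces of tensors as modules\<close>

context diagram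
begin

lemma tensor_simps [simp]:
  "zero (tensor_space k l) = (\<lambda>w. 0)" "add (tensor_space k l) = (\<lambda>s t w. s w + t w)"
  "smult (tensor_space k l) = (\<lambda>c t w. c * t w)"
  by (simp_all add: tensor_space_def)

definition tensor_subspace :: "tensor set \<Rightarrow> bool" where
  "tensor_subspace W \<longleftrightarrow> (\<lambda>w. 0) \<in> W \<and> (\<forall>s\<in>W. \<forall>t\<in>W. \<forall>c d. (\<lambda>w. c * s w + d * t w) \<in> W)"

lemma tensor_subspaceD:
  assumes "tensor_subspace W"
  shows "(\<lambda>w. 0) \<in> W" "s \<in> W \<Longrightarrow> t \<in> W \<Longrightarrow> (\<lambda>w. c * s w + d * t w) \<in> W"
    "s \<in> W \<Longrightarrow> t \<in> W \<Longrightarrow> (\<lambda>w. s w + t w) \<in> W" "s \<in> W \<Longrightarrow> t \<in> W \<Longrightarrow> (\<lambda>w. s w - t w) \<in> W"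
    "s \<in> W \<Longrightarrow> (\<lambda>w. c * s w) \<in> W"
proof -
  show "(\<lambda>w. 0) \<in> W" and comb: "s \<in> W \<Longrightarrow> t \<in> W \<Longrightarrow> (\<lambda>w. c * s w + d * t w) \<in> W" for s t c d
    using assms by (auto simp: tensor_subspace_def)
  show "s \<in> W \<Longrightarrow> t \<in> W \<Longrightarrow> (\<lambda>w. s w + t w) \<in> W" using comb[of s t 1 1] by simp
  show "s \<in> W \<Longrightarrow> t \<in> W \<Longrightarrow> (\<lambda>w. s w - t w) \<in> W" using comb[of s t 1 "-1"] by simp
  show "s \<in> W \<Longrightarrow> (\<lambda>w. c * s w) \<in> W" using comb[of s s c 0] by simp
qed

lemma tensor_subspace_sum:
  assumes "tensor_subspace W" "\<And>i. i \<in> I \<Longrightarrow> t i \<in> W"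
  shows "(\<lambda>w. \<Sum>i\<in>I. c i * t i w) \<in> W"
  using assms(2)
proof (induction I rule: infinite_finite_induct)
  case (insert i I)
  then have "(\<lambda>w. c i * t i w + 1 * (\<Sum>i\<in>I. c i * t i w)) \<in> W" by (intro tensor_subspaceD(2)[OF assms(1)]) auto
  then show ?case using insert by simp
qed (simp_all add: tensor_subspaceD(1)[OF assms(1)])

lemma subspace_module:
  assumes "tensor_subspace W"
  shows "Module.module class_ring (L\<lparr>carrier := W\<rparr>)"
proof (rule module_criteria)
  show "cring (class_ring :: complex ring)" using class_field domain.axioms(1) field.axioms(1) by blast
  show "\<forall>s\<in>carrier (L\<lparr>carrier := W\<rparr>). \<exists>t\<in>carrier (L\<lparr>carrier := W\<rparr>). s \<oplus>\<^bsub>L\<lparr>carrier := W\<rparr>\<^esub> t = \<zero>\<^bsub>L\<lparr>carrier := W\<rparr>\<^esub>"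
  proof
    fix s assume "s \<in> carrier (L\<lparr>carrier := W\<rparr>)"
    then have "(\<lambda>w. - 1 * s w) \<in> W" by (intro tensor_subspaceD(5)[OF assms]) simp
    then show "\<exists>t\<in>carrier (L\<lparr>carrier := W\<rparr>). s \<oplus>\<^bsub>L\<lparr>carrier := W\<rparr>\<^esub> t = \<zero>\<^bsub>L\<lparr>carrier := W\<rparr>\<^esub>"
      by (intro bexI[of _ "\<lambda>w. - 1 * s w"]) auto
  qed
qed (auto simp: tensor_subspaceD[OF assms] algebra_simps)

lemma subspace_finsum:
  assumes "tensor_subspace W" "finite I" "\<And>i. i \<in> I \<Longrightarrow> b i \<in> W"
  shows "(\<Oplus>\<^bsub>L\<lparr>carrier := W\<rparr>\<^esub>i\<in>I. c i \<odot>\<^bsub>L\<lparr>carrier := W\<rparr>\<^esub> b i) = (\<lambda>w. \<Sum>i\<in>I. c i * b i w)"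
proof -
  interpret M: Module.module "class_ring :: complex ring" "L\<lparr>carrier := W\<rparr>" by (rule subspace_module[OF assms(1)])
  show ?thesis using assms(2,3)
  proof (induction I)
    case (insert i I)
    have "(\<lambda>j. c j \<odot>\<^bsub>L\<lparr>carrier := W\<rparr>\<^esub> b j) \<in> I \<rightarrow> carrier (L\<lparr>carrier := W\<rparr>)" "c i \<odot>\<^bsub>L\<lparr>carrier := W\<rparr>\<^esub> b i \<in> carrier (L\<lparr>carrier := W\<rparr>)"
      using insert.prems tensor_subspaceD(5)[OF assms(1)] by auto
    then show ?case using insert by (subst M.finsum_insert) (auto simp: insert.IH)
  qed simp
qed

lemma V0_subspace: "t \<in> V0 \<Longrightarrow> tensor_subspace V0"
  using V0_zero V0_comb by (auto simp: tensor_subspace_def)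

lemma trace_free_rep_V0: "trace_free_rep n m = L\<lparr>carrier := V0\<rparr>"
  by (simp add: trace_free_rep_def V0_def N_def)

end

context root_action
begin

lemma apply_roots_V0: "set \<alpha>s \<subseteq> poset n \<Longrightarrow> apply_roots \<alpha>s \<in> V0"
  unfolding apply_roots_def using v_trace_free
  by (induction \<alpha>s) (auto intro!: V0_lie root_vector_sp[OF f])

lemma V0_sub: "tensor_subspace V0"
  using v_trace_free by (rule V0_subspace)

end

section \<open>The monomial basis of the trace-free tensors\<close>

locale root_order = root_action +
  fixes rs :: "root list"
  assumes rs: "distinct rs" "set rs = poset n"
begin

definition monomial_vector :: "(root \<Rightarrow> nat) \<Rightarrow> tensor" where
  "monomial_vector s = apply_roots (expand rs s)"

definition monomial_degree :: "(root \<Rightarrow> nat) \<Rightarrow> nat" where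
  "monomial_degree s = length (expand rs s)"

lemma monomial_vector_V0: "monomial_vector s \<in> V0"
  unfolding monomial_vector_def using set_expand rs by (intro apply_roots_V0) blast

lemma independent:
  assumes "finite S" "S \<subseteq> FFLV_int n m" "\<And>x. letters x \<Longrightarrow> e \<le> card (outer_positions x) \<Longrightarrow> (\<Sum>s\<in>S. c s * monomial_vector s (fill x)) = 0"
    and "s \<in> S" "e \<le> monomial_degree s"
  shows "c s = 0"
  using monomials_independent[OF rs assms(1,2), of e c s] assms(3-5) by (simp add: monomial_vector_def monomial_degree_def)

text \<open>More monomials than standard words would admit a nontrivial combination vanishing at all
  standard words, hence zero by \<open>V0_determined\<close>, against independence. This bounds
  every finite subset, so finiteness comes out as well; the injection of tableaux into points gives
  the other inequality.\<close>

lemma finite_FFLV: "finite (FFLV_int n m)" and card_FFLV: "card (FFLV_int n m) = card standard_words"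
proof -
  have bound: "card S \<le> card standard_words" if S: "finite S" "S \<subseteq> FFLV_int n m" for S
  proof (rule ccontr)
    assume "\<not> ?thesis"
    then have lt: "card standard_words < card S" by simp
    obtain c where c: "\<exists>s\<in>S. c s \<noteq> 0" "\<forall>w\<in>standard_words. (\<Sum>s\<in>S. c s * monomial_vector s w) = 0"
      using nontrivial_relation[OF finite_standard_words S(1) lt, of monomial_vector] by blast
    have "(\<lambda>w. \<Sum>s\<in>S. c s * monomial_vector s w) = (\<lambda>w. 0)"
      using c(2) by (intro V0_determined tensor_subspace_sum[OF V0_sub] monomial_vector_V0) (auto simp: standard_words_def)
    then have "c s = 0" if "s \<in> S" for s
      using independent[OF S, of 0 c s] that by (simp add: fun_eq_iff)
    then show False using c(1) by blast
  qed
  show fin: "finite (FFLV_int n m)"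
  proof (rule ccontr)
    assume "infinite (FFLV_int n m)"
    then obtain S where "finite S" "card S = Suc (card standard_words)" "S \<subseteq> FFLV_int n m"
      using infinite_arbitrarily_large by metis
    then show False using bound[of S] by simp
  qed
  obtain g where "inj_on g standard_words" "g ` standard_words \<subseteq> FFLV_int n m" using standard_words_inj by blast
  then have "card standard_words \<le> card (FFLV_int n m)" using fin by (intro card_inj_on_le[of g]) auto
  then show "card (FFLV_int n m) = card standard_words" using bound[OF fin] by simp
qed

text \<open>With \<open>t\<close> adjoined as \<open>None\<close> there is one vector more than
  there are standard words, so a nontrivial relation exists; \<open>t\<close> must occur in it
  because the monomials are independent.\<close>

lemma V0_combination:
  assumes t: "t \<in> V0"
  shows "\<exists>c. t = (\<lambda>w. \<Sum>s\<in>FFLV_int n m. c s * monomial_vector s w)"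
proof -
  define I where "I = insert None (Some ` FFLV_int n m)"
  define g where "g i = (case i of None \<Rightarrow> t | Some s \<Rightarrow> monomial_vector s)" for i
  have I: "finite I" "card standard_words < card I"
    using finite_FFLV by (simp_all add: I_def card_image card_FFLV)
  obtain d where d: "\<exists>i\<in>I. d i \<noteq> 0" "\<forall>w\<in>standard_words. (\<Sum>i\<in>I. d i * g i w) = 0"
    using nontrivial_relation[OF finite_standard_words I, of g] by blast
  have "(\<lambda>w. \<Sum>i\<in>I. d i * g i w) = (\<lambda>w. 0)"
    using d(2) t by (intro V0_determined tensor_subspace_sum[OF V0_sub])
      (auto simp: standard_words_def g_def monomial_vector_V0 split: option.split)
  moreover have "(\<Sum>i\<in>I. d i * g i w) = d None * t w + (\<Sum>s\<in>FFLV_int n m. d (Some s) * monomial_vector s w)" for w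
    using finite_FFLV by (simp add: I_def g_def sum.reindex)
  ultimately have rel: "d None * t w + (\<Sum>s\<in>FFLV_int n m. d (Some s) * monomial_vector s w) = 0" for w
    by (simp add: fun_eq_iff)
  have "d None \<noteq> 0"
  proof
    assume "d None = 0"
    then have "d (Some s) = 0" if "s \<in> FFLV_int n m" for s
      using independent[OF finite_FFLV order_refl, of 0 "\<lambda>s. d (Some s)" s] rel that by simp
    then show False using d(1) \<open>d None = 0\<close> by (auto simp: I_def)
  qed
  have "t w = (\<Sum>s\<in>FFLV_int n m. (- d (Some s) / d None) * monomial_vector s w)" for w
  proof -
    have "d None * t w = - (\<Sum>s\<in>FFLV_int n m. d (Some s) * monomial_vector s w)" using rel[of w] by (simp add: eq_neg_iff_add_eq_0)
    then have "t w = - (\<Sum>s\<in>FFLV_int n m. d (Some s) * monomial_vector s w) / d None" using \<open>d None \<noteq> 0\<close> by (simp add: field_simps)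
    then show ?thesis by (simp add: sum_divide_distrib sum_negf)
  qed
  then have "t = (\<lambda>w. \<Sum>s\<in>FFLV_int n m. (- d (Some s) / d None) * monomial_vector s w)" by (rule ext)
  then show ?thesis by (rule exI[where x = "\<lambda>s. - d (Some s) / d None"])
qed

lemma monomial_act_expand:
  "monomial_act act f rs s = foldr (\<lambda>\<alpha>. act (f \<alpha>)) (expand rs s)"
proof -
  have rep: "foldr (\<lambda>\<alpha>. act (f \<alpha>)) (replicate k \<alpha>) = act (f \<alpha>) ^^ k" for k \<alpha>
    by (induction k) (auto simp: fun_eq_iff)
  show ?thesis unfolding monomial_act_def expand_def
    by (induction rs) (auto simp: rep)
qed

theorem trace_free_basis:
  "basis_family (trace_free_rep n m) (FFLV_int n m) (\<lambda>s. monomial_act lie f rs s v)"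
proof -
  have vec: "monomial_act lie f rs s v = monomial_vector s" for s
    by (simp add: monomial_act_expand monomial_vector_def apply_roots_def)
  note sum = subspace_finsum[OF V0_sub finite_FFLV monomial_vector_V0]
  show ?thesis
    unfolding vec trace_free_rep_V0
  proof (rule basis_familyI)
    show "Module.module class_ring (L\<lparr>carrier := V0\<rparr>)" by (rule subspace_module[OF V0_sub])
    show "finite (FFLV_int n m)" by (rule finite_FFLV)
    show "monomial_vector s \<in> carrier (L\<lparr>carrier := V0\<rparr>)" for s using monomial_vector_V0 by simp
    show "\<exists>c. (\<Oplus>\<^bsub>L\<lparr>carrier := V0\<rparr>\<^esub>s\<in>FFLV_int n m. c s \<odot>\<^bsub>L\<lparr>carrier := V0\<rparr>\<^esub> monomial_vector s) = t"
      if "t \<in> carrier (L\<lparr>carrier := V0\<rparr>)" for t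
      unfolding sum using V0_combination[of t] that by auto
    show "c s = c' s" if "(\<Oplus>\<^bsub>L\<lparr>carrier := V0\<rparr>\<^esub>s\<in>FFLV_int n m. c s \<odot>\<^bsub>L\<lparr>carrier := V0\<rparr>\<^esub> monomial_vector s) =
       (\<Oplus>\<^bsub>L\<lparr>carrier := V0\<rparr>\<^esub>s\<in>FFLV_int n m. c' s \<odot>\<^bsub>L\<lparr>carrier := V0\<rparr>\<^esub> monomial_vector s)" "s \<in> FFLV_int n m" for c c' s
    proof -
      have "(\<Sum>s\<in>FFLV_int n m. (c s - c' s) * monomial_vector s w) = 0" for w
        using that(1) unfolding sum by (simp add: fun_eq_iff left_diff_distrib sum_subtractf)
      then have "c s - c' s = 0"
        using independent[OF finite_FFLV order_refl, of 0 "\<lambda>s. c s - c' s" s] that(2) by simp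
      then show ?thesis by simp
    qed
  qed
qed

end

section \<open>The associated graded space\<close>

context diagram
begin

lemma carrier_subspace: "tensor_subspace (carrier L)"
  by (auto simp: tensor_subspace_def tensor_space_def)

lemma module_L: "Module.module class_ring L"
  using subspace_module[OF carrier_subspace] by simp

lemma submodule_L_iff: "submodule class_ring W L \<longleftrightarrow> tensor_subspace W \<and> W \<subseteq> carrier L"
proof
  assume W: "submodule class_ring W L"
  have "(\<lambda>w. c * s w + d * t w) \<in> W" if "s \<in> W" "t \<in> W" for s t c d
  proof -
    have "(\<lambda>w. c * s w) \<in> W" "(\<lambda>w. d * t w) \<in> W"
      using submodule.smult_closed[OF W, of c s] submodule.smult_closed[OF W, of d t] that by simp_all
    then show ?thesis using submodule.m_closed[OF W] by fastforce
  qed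
  then show "tensor_subspace W \<and> W \<subseteq> carrier L"
    using submodule.zero_closed[OF W] submodule.subset[OF W] by (simp add: tensor_subspace_def)
next
  assume "tensor_subspace W \<and> W \<subseteq> carrier L"
  then show "submodule class_ring W L"
    using module_L by (auto simp: submodule_def tensor_subspaceD)
qed

text \<open>\<open>n_tilde_minus\<close> is built from spans. Its elements preserve \<omega>, and
  hence keep tensors trace-free, because \<open>sp_odd\<close> is a linear subspace containing the
  generators.\<close>

lemma sp_odd_submodule: "submodule class_ring (sp_odd n) (module_mat TYPE(complex) N N)"
proof -
  interpret M: vectorspace "class_ring :: complex ring" "module_mat TYPE(complex) N N" by (rule matrix_vs)
  have om: "omega n \<in> carrier_mat N N" using N_def by (simp add: omega_def)
  have sp: "X \<in> sp_odd n \<longleftrightarrow> X \<in> carrier_mat N N \<and> transpose_mat X * omega n + omega n * X = 0\<^sub>m N N" for X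
    by (simp add: sp_odd_def N_def)
  have "X + Y \<in> sp_odd n" if X: "X \<in> sp_odd n" and Y: "Y \<in> sp_odd n" for X Y
  proof -
    have c: "X \<in> carrier_mat N N" "Y \<in> carrier_mat N N" using X Y by (auto simp: sp)
    have "transpose_mat (X + Y) * omega n + omega n * (X + Y) =
      (transpose_mat X * omega n + omega n * X) + (transpose_mat Y * omega n + omega n * Y)"
    proof (rule eq_matI)
      fix i j assume "i < dim_row ((transpose_mat X * omega n + omega n * X) + (transpose_mat Y * omega n + omega n * Y))"
        "j < dim_col ((transpose_mat X * omega n + omega n * X) + (transpose_mat Y * omega n + omega n * Y))"
      then have "i < N" "j < N" using c om by auto
      then show "(transpose_mat (X + Y) * omega n + omega n * (X + Y)) $$ (i, j) =
        ((transpose_mat X * omega n + omega n * X) + (transpose_mat Y * omega n + omega n * Y)) $$ (i, j)"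
        using c om by (simp add: scalar_prod_def distrib_left distrib_right sum.distrib)
    qed (use c om in auto)
    then show ?thesis using X Y c by (simp add: sp)
  qed
  moreover have "k \<cdot>\<^sub>m X \<in> sp_odd n" if X: "X \<in> sp_odd n" for k X
  proof -
    have c: "X \<in> carrier_mat N N" using X by (auto simp: sp)
    have "transpose_mat (k \<cdot>\<^sub>m X) * omega n + omega n * (k \<cdot>\<^sub>m X) = k \<cdot>\<^sub>m (transpose_mat X * omega n + omega n * X)"
    proof (rule eq_matI)
      fix i j assume "i < dim_row (k \<cdot>\<^sub>m (transpose_mat X * omega n + omega n * X))"
        "j < dim_col (k \<cdot>\<^sub>m (transpose_mat X * omega n + omega n * X))"
      then have "i < N" "j < N" using c om by auto
      then show "(transpose_mat (k \<cdot>\<^sub>m X) * omega n + omega n * (k \<cdot>\<^sub>m X)) $$ (i, j) =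
        (k \<cdot>\<^sub>m (transpose_mat X * omega n + omega n * X)) $$ (i, j)"
        using c om by (simp add: scalar_prod_def sum_distrib_left distrib_left mult_ac)
    qed (use c om in auto)
    then show ?thesis using X c by (simp add: sp)
  qed
  moreover have "0\<^sub>m N N \<in> sp_odd n" using om by (simp add: sp)
  moreover have "sp_odd n \<subseteq> carrier_mat N N" by (auto simp: sp)
  ultimately show ?thesis
    using M.module_axioms by (simp add: submodule_def module_mat_simps)
qed

lemma mat_span_sp:
  assumes "S \<subseteq> sp_odd n" shows "S \<subseteq> mat_span N S" "mat_span N S \<subseteq> sp_odd n" "0\<^sub>m N N \<in> mat_span N S"
proof -
  interpret M: vectorspace "class_ring :: complex ring" "module_mat TYPE(complex) N N" by (rule matrix_vs)
  have S: "S \<subseteq> carrier (module_mat TYPE(complex) N N)"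
    using assms submodule.subset[OF sp_odd_submodule] by simp
  show "S \<subseteq> mat_span N S" unfolding mat_span_def by (rule M.in_own_span[OF S])
  show "mat_span N S \<subseteq> sp_odd n" unfolding mat_span_def by (rule M.span_is_subset[OF assms sp_odd_submodule])
  show "0\<^sub>m N N \<in> mat_span N S"
    using submodule.zero_closed[OF M.span_is_submodule[OF S]] by (simp add: mat_span_def module_mat_simps)
qed

lemma n_minus_gens: "(\<Union>\<alpha> \<in> pos_roots n. neg_root_space n \<alpha>) \<subseteq> sp_odd n"
  using neg_root_space_sp by blast

end

context root_action
begin

lemma F_minus_gens: "{matrix_unit N N i | i. 1 \<le> i \<and> i \<le> n} \<subseteq> sp_odd n"
  using matrix_unit_sp by blast

lemma n_tilde_minus_sp: "X \<in> n_tilde_minus n \<Longrightarrow> X \<in> sp_odd n"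
proof -
  assume "X \<in> n_tilde_minus n"
  then obtain Y Z where YZ: "X = Y + Z" "Y \<in> n_minus n" "Z \<in> F_minus n" by (auto simp: n_tilde_minus_def)
  have "Y \<in> sp_odd n" using YZ(2) mat_span_sp(2)[OF n_minus_gens] by (auto simp: n_minus_def N_def)
  moreover have "Z \<in> sp_odd n" using YZ(3) mat_span_sp(2)[OF F_minus_gens] by (auto simp: F_minus_def N_def)
  ultimately show ?thesis
    using submodule.m_closed[OF sp_odd_submodule] YZ(1) by (simp add: module_mat_simps)
qed

lemma root_vector_n_tilde: 
  assumes "\<alpha> \<in> poset n" shows "f \<alpha> \<in> n_tilde_minus n"
proof -
  have z: "0\<^sub>m N N \<in> n_minus n" "0\<^sub>m N N \<in> F_minus n"
    using mat_span_sp(3)[OF n_minus_gens] mat_span_sp(3)[OF F_minus_gens] by (auto simp: n_minus_def F_minus_def N_def)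
  have c: "f \<alpha> \<in> carrier_mat N N" using root_vector_sp[OF f assms] by (simp add: sp_odd_def N_def)
  have "f \<alpha> \<in> n_minus n \<or> f \<alpha> \<in> F_minus n"
  proof (cases "\<alpha> \<in> pos_roots n")
    case True
    then have "f \<alpha> \<in> neg_root_space n \<alpha>" using f by (simp add: is_root_vectors_def)
    then have "f \<alpha> \<in> n_minus n"
      using True mat_span_sp(1)[OF n_minus_gens] unfolding n_minus_def N_def by blast
    then show ?thesis ..
  next
    case False
    then obtain i where i: "\<alpha> = Rt i n" "1 \<le> i" "i \<le> n" using assms by (auto simp: poset_def pos_roots_def)
    then have "f \<alpha> = matrix_unit N N i" using f by (simp add: is_root_vectors_def N_def)
    then have "f \<alpha> \<in> F_minus n"
      using i mat_span_sp(1)[OF F_minus_gens] unfolding F_minus_def N_def by blast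
    then show ?thesis ..
  qed
  then show ?thesis
  proof
    assume "f \<alpha> \<in> n_minus n"
    moreover have "f \<alpha> = f \<alpha> + 0\<^sub>m N N" using c by simp
    ultimately show ?thesis using z(2) unfolding n_tilde_minus_def by blast
  next
    assume "f \<alpha> \<in> F_minus n"
    moreover have "f \<alpha> = 0\<^sub>m N N + f \<alpha>" using c by simp
    ultimately show ?thesis using z(1) unfolding n_tilde_minus_def by blast
  qed
qed

section \<open>The filtration steps\<close>

abbreviation U :: "nat \<Rightarrow> tensor set" where "U \<equiv> PBW_filt n m v"
abbreviation P :: "nat \<Rightarrow> tensor set" where "P \<equiv> PBW_filt_pred n m v"

definition U_gens :: "nat \<Rightarrow> tensor set" where
  "U_gens d = {foldr lie Xs v | Xs. length Xs \<le> d \<and> set Xs \<subseteq> n_tilde_minus n}"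

lemma U_span: "U d = LinearCombinations.module.span class_ring L (U_gens d)"
  by (simp add: PBW_filt_def U_gens_def N_def)

lemma foldr_lie_V0: "set Xs \<subseteq> n_tilde_minus n \<Longrightarrow> foldr lie Xs v \<in> V0"
  using v_trace_free by (induction Xs) (auto intro!: V0_lie n_tilde_minus_sp)

lemma U_gens_V0: "U_gens d \<subseteq> V0"
  using foldr_lie_V0 by (auto simp: U_gens_def)

lemma V0_sub_carrier: "V0 \<subseteq> carrier L"
  using V0_carrier by blast

text \<open>Serves as an induction principle for \<open>U d\<close>, with \<open>W\<close> the set
  of tensors having the desired property.\<close>

lemma U_subset:
  assumes "tensor_subspace W" "W \<subseteq> carrier L" "U_gens d \<subseteq> W" shows "U d \<subseteq> W"
  unfolding U_span using assms by (intro LinearCombinations.module.span_is_subset[OF module_L]) (auto simp: submodule_L_iff)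

lemma U_V0: "U d \<subseteq> V0"
  using V0_sub V0_sub_carrier U_gens_V0 by (rule U_subset)

lemma U_subspace: "tensor_subspace (U d)"
proof -
  have "submodule class_ring (U d) L"
    unfolding U_span using U_gens_V0 V0_sub_carrier by (intro LinearCombinations.module.span_is_submodule[OF module_L]) blast
  then show ?thesis by (simp add: submodule_L_iff)
qed

lemma U_gens_U: "U_gens d \<subseteq> U d"
  unfolding U_span using U_gens_V0 V0_sub_carrier by (intro LinearCombinations.module.in_own_span[OF module_L]) blast

lemma U_mono: "d \<le> e \<Longrightarrow> U d \<subseteq> U e"
proof (rule U_subset)
  assume "d \<le> e"
  then have "U_gens d \<subseteq> U_gens e" by (auto simp: U_gens_def)
  then show "U_gens d \<subseteq> U e" using U_gens_U by blast
qed (use U_subspace U_V0 V0_sub_carrier in blast)+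

lemma P_subspace: "tensor_subspace (P d)"
  using U_subspace by (cases d) (auto simp: tensor_subspace_def)

lemma U_vanish:
  assumes "t \<in> U d" "letters x" "d < card (outer_positions x)"
  shows "t (fill x) = 0"
proof -
  have "U d \<subseteq> {t \<in> carrier L. t (fill x) = 0}"
  proof (rule U_subset)
    show "tensor_subspace {t \<in> carrier L. t (fill x) = 0}"
      by (auto simp: tensor_subspace_def tensor_space_def)
    show "U_gens d \<subseteq> {t \<in> carrier L. t (fill x) = 0}"
      using outer_vanish[OF assms(2)] assms(3) U_gens_V0 V0_sub_carrier by (fastforce simp: U_gens_def)
  qed blast
  then show ?thesis using assms(1) by blast
qed

text \<open>\<open>P d\<close> is the step with number d - 1, so a word with exactly d outer letters
  is already out of its reach; for d = 0 the step is zero.\<close>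

lemma P_vanish:
  assumes "t \<in> P d" "letters x" "d \<le> card (outer_positions x)"
  shows "t (fill x) = 0"
  using assms U_vanish by (cases d) auto

lemma lie_U:
  assumes "X \<in> n_tilde_minus n" "t \<in> U d" shows "lie X t \<in> U (Suc d)"
proof -
  have "U d \<subseteq> {t \<in> carrier L. lie X t \<in> U (Suc d)}"
  proof (rule U_subset)
    have "lie X (\<lambda>w. c * s w + d * t w) = (\<lambda>w. c * lie X s w + d * lie X t w)" for s t c d
      using lie_act_add[of X "\<lambda>w. c * s w" "\<lambda>w. d * t w"] by (simp add: lie_act_scale)
    then show "tensor_subspace {t \<in> carrier L. lie X t \<in> U (Suc d)}"
      using tensor_subspaceD(1,2)[OF carrier_subspace] tensor_subspaceD(1,2)[OF U_subspace]
      by (auto simp: tensor_subspace_def lie_act_zero)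
    have "lie X (foldr lie Xs v) \<in> U_gens (Suc d)" if "length Xs \<le> d" "set Xs \<subseteq> n_tilde_minus n" for Xs
      unfolding U_gens_def using that assms(1) by (intro CollectI exI[of _ "X # Xs"]) auto
    then have "lie X t \<in> U_gens (Suc d)" if "t \<in> U_gens d" for t
      using that by (auto simp: U_gens_def[of d])
    then show "U_gens d \<subseteq> {t \<in> carrier L. lie X t \<in> U (Suc d)}"
      using U_gens_U[of "Suc d"] U_gens_V0[of d] V0_sub_carrier by blast
  qed blast
  then show ?thesis using assms(2) by blast
qed

lemma lie_P: 
  assumes "X \<in> n_tilde_minus n" "t \<in> P d" shows "lie X t \<in> P (Suc d)"
  using assms lie_U tensor_subspaceD(1)[OF U_subspace] by (cases d) (auto simp: lie_act_zero)

section \<open>Quotients of the steps and their direct sum\<close>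

definition coset :: "nat \<Rightarrow> tensor \<Rightarrow> tensor set" where
  "coset d t = {\<lambda>w. h w + t w | h. h \<in> P d}"

lemma a_r_coset: "a_r_coset (L\<lparr>carrier := W\<rparr>) (P d) t = coset d t" "a_r_coset L (P d) t = coset d t"
  by (auto simp: a_r_coset_def r_coset_def coset_def)

lemma coset_eq: "coset d s = coset d t \<longleftrightarrow> (\<lambda>w. s w - t w) \<in> P d"
proof
  assume eq: "coset d s = coset d t"
  have "s \<in> coset d s"
    unfolding coset_def using tensor_subspaceD(1)[OF P_subspace] by (intro CollectI exI[of _ "\<lambda>w. 0"]) auto
  then obtain h where "s = (\<lambda>w. h w + t w)" "h \<in> P d" unfolding eq by (auto simp: coset_def)
  then show "(\<lambda>w. s w - t w) \<in> P d" by simp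
next
  have sub: "coset d s \<subseteq> coset d t" if "(\<lambda>w. s w - t w) \<in> P d" for s t
  proof
    fix u assume "u \<in> coset d s"
    then obtain h where h: "u = (\<lambda>w. h w + s w)" "h \<in> P d" by (auto simp: coset_def)
    have "(\<lambda>w. h w + (s w - t w)) \<in> P d" by (rule tensor_subspaceD(3)[OF P_subspace h(2) that])
    then show "u \<in> coset d t"
      unfolding coset_def by (intro CollectI exI[of _ "\<lambda>w. h w + (s w - t w)"]) (auto simp: h)
  qed
  assume st: "(\<lambda>w. s w - t w) \<in> P d"
  then have "(\<lambda>w. - 1 * (s w - t w)) \<in> P d" by (rule tensor_subspaceD(5)[OF P_subspace])
  then have "(\<lambda>w. t w - s w) \<in> P d" by simp
  then show "coset d s = coset d t" using sub st by blast
qed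

lemma coset_zero: "coset d (\<lambda>w. 0) = P d"
  by (auto simp: coset_def)

lemma coset_self: "t \<in> coset d t"
  unfolding coset_def using tensor_subspaceD(1)[OF P_subspace] by (intro CollectI exI[of _ "\<lambda>w. 0"]) auto

lemma coset_memD: "u \<in> coset d t \<Longrightarrow> coset d u = coset d t"
  unfolding coset_eq by (auto simp: coset_def)

lemma coset_add: "set_add (L\<lparr>carrier := W\<rparr>) (coset d s) (coset d t) = coset d (\<lambda>w. s w + t w)"
proof -
  have "set_add (L\<lparr>carrier := W\<rparr>) (coset d s) (coset d t) = {\<lambda>w. x w + y w | x y. x \<in> coset d s \<and> y \<in> coset d t}"
    by (auto simp: set_add_defs)
  also have "\<dots> = coset d (\<lambda>w. s w + t w)"
  proof (intro equalityI subsetI)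
    fix u assume "u \<in> {\<lambda>w. x w + y w | x y. x \<in> coset d s \<and> y \<in> coset d t}"
    then obtain h k where hk: "u = (\<lambda>w. (h w + s w) + (k w + t w))" "h \<in> P d" "k \<in> P d" by (auto simp: coset_def)
    have "(\<lambda>w. h w + k w) \<in> P d" using hk by (intro tensor_subspaceD(3)[OF P_subspace])
    then show "u \<in> coset d (\<lambda>w. s w + t w)"
      unfolding coset_def by (intro CollectI exI[of _ "\<lambda>w. h w + k w"]) (auto simp: hk)
  next
    fix u assume "u \<in> coset d (\<lambda>w. s w + t w)"
    then obtain h where h: "u = (\<lambda>w. (h w + s w) + t w)" "h \<in> P d" by (auto simp: coset_def add.assoc)
    have "(\<lambda>w. h w + s w) \<in> coset d s" using h(2) by (auto simp: coset_def)
    then show "u \<in> {\<lambda>w. x w + y w | x y. x \<in> coset d s \<and> y \<in> coset d t}"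
      using coset_self[of t d] unfolding h(1) by (intro CollectI exI[of _ "\<lambda>w. h w + s w"] exI[of _ t]) simp
  qed
  finally show ?thesis .
qed

lemma coset_scale: "(\<Union>x \<in> coset d t. coset d (\<lambda>w. c * x w)) = coset d (\<lambda>w. c * t w)"
proof -
  have "coset d (\<lambda>w. c * x w) = coset d (\<lambda>w. c * t w)" if "x \<in> coset d t" for x
  proof -
    have "(\<lambda>w. x w - t w) \<in> P d" using coset_memD[OF that] by (simp add: coset_eq)
    then have "(\<lambda>w. c * (x w - t w)) \<in> P d" by (rule tensor_subspaceD(5)[OF P_subspace])
    then show ?thesis by (simp add: coset_eq right_diff_distrib)
  qed
  then show ?thesis using coset_self by blast
qed

abbreviation gr where "gr \<equiv> gr_rep n m v"

definition graded_class :: "(nat \<Rightarrow> tensor) \<Rightarrow> nat \<Rightarrow> tensor set" where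
  "graded_class y = (\<lambda>d. coset d (y d))"

text \<open>Elements of the direct sum are represented by finitely supported families of tensors, so
  that the module laws of \<open>gr\<close> follow from identities of functions.\<close>

definition graded :: "(nat \<Rightarrow> tensor) set" where
  "graded = {y. (\<forall>d. y d \<in> U d) \<and> finite {d. y d \<noteq> (\<lambda>w. 0)}}"

lemma graded_comb:
  assumes "y \<in> graded" "z \<in> graded" shows "(\<lambda>d w. a * y d w + b * z d w) \<in> graded"
proof -
  have "{d. (\<lambda>w. a * y d w + b * z d w) \<noteq> (\<lambda>w. 0)} \<subseteq> {d. y d \<noteq> (\<lambda>w. 0)} \<union> {d. z d \<noteq> (\<lambda>w. 0)}"
    by auto
  moreover have "finite ({d. y d \<noteq> (\<lambda>w. 0)} \<union> {d. z d \<noteq> (\<lambda>w. 0)})"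
    using assms by (simp add: graded_def)
  ultimately have "finite {d. (\<lambda>w. a * y d w + b * z d w) \<noteq> (\<lambda>w. 0)}" by (rule finite_subset)
  then show ?thesis using assms tensor_subspaceD(2)[OF U_subspace] by (simp add: graded_def)
qed

lemma graded_zero: "(\<lambda>d w. 0) \<in> graded"
  using tensor_subspaceD(1)[OF U_subspace] by (simp add: graded_def)

lemma quotient_simps:
  "carrier (quotient_space (L\<lparr>carrier := U d\<rparr>) (P d)) = coset d ` U d"
  "zero (quotient_space (L\<lparr>carrier := U d\<rparr>) (P d)) = P d"
  "add (quotient_space (L\<lparr>carrier := U d\<rparr>) (P d)) = set_add (L\<lparr>carrier := U d\<rparr>)"
  "smult (quotient_space (L\<lparr>carrier := U d\<rparr>) (P d)) = (\<lambda>c A. \<Union>x \<in> A. coset d (\<lambda>w. c * x w))"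
  by (auto simp: quotient_space_def A_RCOSETS_def' a_r_coset)

lemma gr_unfold: "gr = direct_sum_seq (\<lambda>d. quotient_space (L\<lparr>carrier := U d\<rparr>) (P d))"
  by (simp add: gr_rep_def N_def)

lemma gr_zero: "\<zero>\<^bsub>gr\<^esub> = graded_class (\<lambda>d w. 0)"
  by (simp add: gr_unfold direct_sum_seq_def quotient_simps graded_class_def coset_zero)

lemma gr_add: "graded_class y \<oplus>\<^bsub>gr\<^esub> graded_class z = graded_class (\<lambda>d w. y d w + z d w)"
  by (simp add: gr_unfold direct_sum_seq_def quotient_simps graded_class_def coset_add)

lemma gr_smult: "c \<odot>\<^bsub>gr\<^esub> graded_class y = graded_class (\<lambda>d w. c * y d w)"
  by (simp add: gr_unfold direct_sum_seq_def quotient_simps graded_class_def coset_scale)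

lemma gr_carrier: "carrier gr = graded_class ` graded"
proof (intro equalityI subsetI)
  fix G assume "G \<in> carrier gr"
  then have G: "\<And>d. G d \<in> coset d ` U d" "finite {d. G d \<noteq> P d}"
    by (auto simp: gr_unfold direct_sum_seq_def quotient_simps)
  \<comment> \<open>The representative is chosen as 0 wherever the coset is zero; otherwise the
    family of representatives could have infinite support.\<close>
  have "\<exists>t. t \<in> U d \<and> G d = coset d t \<and> (G d = P d \<longrightarrow> t = (\<lambda>w. 0))" for d
  proof (cases "G d = P d")
    case True
    then show ?thesis using tensor_subspaceD(1)[OF U_subspace] coset_zero by auto
  next
    case False
    then show ?thesis using G(1)[of d] by blast
  qed
  then obtain y where y: "\<And>d. y d \<in> U d \<and> G d = coset d (y d) \<and> (G d = P d \<longrightarrow> y d = (\<lambda>w. 0))" by metis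
  then have "{d. y d \<noteq> (\<lambda>w. 0)} \<subseteq> {d. G d \<noteq> P d}" by auto
  then have "y \<in> graded" using y G(2) finite_subset by (auto simp: graded_def)
  moreover have "G = graded_class y" using y by (auto simp: graded_class_def)
  ultimately show "G \<in> graded_class ` graded" by blast
next
  fix G assume "G \<in> graded_class ` graded"
  then obtain y where y: "y \<in> graded" "G = graded_class y" by blast
  have "{d. G d \<noteq> P d} \<subseteq> {d. y d \<noteq> (\<lambda>w. 0)}" using y(2) coset_zero by (auto simp: graded_class_def)
  then have "finite {d. G d \<noteq> P d}" using y(1) finite_subset by (auto simp: graded_def)
  then show "G \<in> carrier gr"
    using y by (auto simp: gr_unfold direct_sum_seq_def quotient_simps graded_class_def graded_def)
qed

lemma gr_module: "Module.module class_ring gr"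
proof (rule module_criteria)
  show "cring (class_ring :: complex ring)" using class_field domain.axioms(1) field.axioms(1) by blast
  have comb: "(\<lambda>d w. y d w + z d w) \<in> graded" "(\<lambda>d w. c * y d w) \<in> graded" if "y \<in> graded" "z \<in> graded" for y z c
    using graded_comb[OF that, of 1 1] graded_comb[OF that, of c 0] by simp_all
  show "\<zero>\<^bsub>gr\<^esub> \<in> carrier gr" using graded_zero by (simp add: gr_zero gr_carrier)
  show "\<forall>G\<in>carrier gr. \<exists>H\<in>carrier gr. G \<oplus>\<^bsub>gr\<^esub> H = \<zero>\<^bsub>gr\<^esub>"
  proof
    fix G assume "G \<in> carrier gr"
    then obtain y where y: "y \<in> graded" "G = graded_class y" by (auto simp: gr_carrier)
    have "G \<oplus>\<^bsub>gr\<^esub> graded_class (\<lambda>d w. - 1 * y d w) = \<zero>\<^bsub>gr\<^esub>" by (simp add: y gr_add gr_zero)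
    moreover have "graded_class (\<lambda>d w. - 1 * y d w) \<in> carrier gr" unfolding gr_carrier by (rule imageI, rule comb(2)[OF y(1) y(1)])
    ultimately show "\<exists>H\<in>carrier gr. G \<oplus>\<^bsub>gr\<^esub> H = \<zero>\<^bsub>gr\<^esub>" by blast
  qed
  show "\<forall>G H. G \<in> carrier gr \<and> H \<in> carrier gr \<longrightarrow> G \<oplus>\<^bsub>gr\<^esub> H \<in> carrier gr"
    using comb(1) by (auto simp: gr_carrier gr_add)
  show "\<forall>c G. c \<in> carrier class_ring \<and> G \<in> carrier gr \<longrightarrow> c \<odot>\<^bsub>gr\<^esub> G \<in> carrier gr"
    using comb(2) by (auto simp: gr_carrier gr_smult)
qed (auto simp: gr_carrier gr_add gr_smult gr_zero algebra_simps)

lemma gr_finsum: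
  assumes "finite I" "\<And>i. i \<in> I \<Longrightarrow> y i \<in> graded"
  shows "(\<Oplus>\<^bsub>gr\<^esub>i\<in>I. c i \<odot>\<^bsub>gr\<^esub> graded_class (y i)) = graded_class (\<lambda>d w. \<Sum>i\<in>I. c i * y i d w)"
proof -
  interpret M: Module.module "class_ring :: complex ring" gr by (rule gr_module)
  show ?thesis using assms
  proof (induction I)
    case empty
    show ?case by (simp add: gr_zero)
  next
    case (insert i I)
    have cl: "c j \<odot>\<^bsub>gr\<^esub> graded_class (y j) \<in> carrier gr" if "j \<in> insert i I" for j
      using insert.prems[OF that] by (intro M.smult_closed) (auto simp: gr_carrier)
    have "(\<Oplus>\<^bsub>gr\<^esub>i\<in>insert i I. c i \<odot>\<^bsub>gr\<^esub> graded_class (y i)) = c i \<odot>\<^bsub>gr\<^esub> graded_class (y i) \<oplus>\<^bsub>gr\<^esub> (\<Oplus>\<^bsub>gr\<^esub>i\<in>I. c i \<odot>\<^bsub>gr\<^esub> graded_class (y i))"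
      using insert.hyps cl by (intro M.finsum_insert) auto
    then show ?case using insert by (simp add: gr_smult gr_add)
  qed
qed

text \<open>All cosets in the union of \<open>gr_act\<close> coincide because \<open>lie X\<close>
  carries \<open>P r\<close> into \<open>P (Suc r)\<close>.\<close>

lemma gr_act_class:
  assumes "X \<in> n_tilde_minus n"
  shows "gr_act n m v X (graded_class y) = graded_class (\<lambda>d. case d of 0 \<Rightarrow> (\<lambda>w. 0) | Suc r \<Rightarrow> lie X (y r))"
proof
  fix d
  show "gr_act n m v X (graded_class y) d = graded_class (\<lambda>d. case d of 0 \<Rightarrow> (\<lambda>w. 0) | Suc r \<Rightarrow> lie X (y r)) d"
  proof (cases d)
    case 0
    then show ?thesis by (simp add: gr_act_def graded_class_def coset_zero)
  next
    case (Suc r)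
    have "coset d (lie X x) = coset d (lie X (y r))" if x: "x \<in> coset r (y r)" for x
    proof -
      obtain h where h: "x = (\<lambda>w. h w + y r w)" "h \<in> P r" using x by (auto simp: coset_def)
      have "lie X h \<in> P d" unfolding Suc by (rule lie_P[OF assms h(2)])
      then show ?thesis by (simp add: coset_eq h lie_act_add)
    qed
    then have "(\<Union>x \<in> coset r (y r). coset d (lie X x)) = coset d (lie X (y r))"
      using coset_self by blast
    moreover have "gr_act n m v X (graded_class y) d = (\<Union>x \<in> coset r (y r). coset d (lie X x))"
      using a_r_coset(2)[of d] by (simp add: gr_act_def graded_class_def Suc N_def)
    ultimately show ?thesis by (simp add: graded_class_def Suc)
  qed
qed

lemma gr_vector_class: "gr_vector n m v = graded_class (\<lambda>d. if d = 0 then v else (\<lambda>w. 0))"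
proof
  fix d show "gr_vector n m v d = graded_class (\<lambda>d. if d = 0 then v else (\<lambda>w. 0)) d"
    using a_r_coset(2)[of 0 v] by (auto simp: gr_vector_def graded_class_def coset_zero N_def)
qed

lemma apply_roots_U: "set \<alpha>s \<subseteq> poset n \<Longrightarrow> apply_roots \<alpha>s \<in> U (length \<alpha>s)"
proof (induction \<alpha>s)
  case Nil
  have "foldr lie [] v \<in> U_gens 0" unfolding U_gens_def by (intro CollectI exI[of _ "[]"]) auto
  then show ?case using U_gens_U[of 0] by (auto simp: apply_roots_def)
next
  case (Cons \<alpha> \<alpha>s)
  then show ?case using lie_U[OF root_vector_n_tilde] by (simp add: apply_roots_def)
qed

lemma foldr_gr_act:
  assumes "set \<alpha>s \<subseteq> poset n"
  shows "foldr (\<lambda>\<alpha>. gr_act n m v (f \<alpha>)) \<alpha>s (gr_vector n m v) = graded_class (\<lambda>d. if d = length \<alpha>s then apply_roots \<alpha>s else (\<lambda>w. 0))"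
  using assms
proof (induction \<alpha>s)
  case Nil
  then show ?case by (simp add: gr_vector_class apply_roots_def cong: if_cong)
next
  case (Cons \<alpha> \<alpha>s)
  have "(\<lambda>d. case d of 0 \<Rightarrow> (\<lambda>w. 0) | Suc r \<Rightarrow> lie (f \<alpha>) (if r = length \<alpha>s then apply_roots \<alpha>s else (\<lambda>w. 0))) =
     (\<lambda>d. if d = length (\<alpha> # \<alpha>s) then apply_roots (\<alpha> # \<alpha>s) else (\<lambda>w. 0))"
    by (auto simp: fun_eq_iff apply_roots_def lie_act_zero split: nat.split)
  moreover have "f \<alpha> \<in> n_tilde_minus n" using Cons.prems by (intro root_vector_n_tilde) simp
  ultimately show ?case using Cons by (simp add: gr_act_class)
qed

end

section \<open>The monomial basis of the graded space\<close>

context root_order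
begin

definition graded_monomial :: "(root \<Rightarrow> nat) \<Rightarrow> nat \<Rightarrow> tensor" where
  "graded_monomial s d = (if d = monomial_degree s then monomial_vector s else (\<lambda>w. 0))"

lemma monomial_vector_U: "monomial_vector s \<in> U (monomial_degree s)"
  unfolding monomial_vector_def monomial_degree_def using set_expand rs(2) by (intro apply_roots_U) blast

lemma graded_monomial_graded: "graded_monomial s \<in> graded"
proof -
  have "{d. graded_monomial s d \<noteq> (\<lambda>w. 0)} \<subseteq> {monomial_degree s}" by (auto simp: graded_monomial_def)
  then have "finite {d. graded_monomial s d \<noteq> (\<lambda>w. 0)}" by (rule finite_subset) simp
  then show ?thesis using monomial_vector_U tensor_subspaceD(1)[OF U_subspace] by (simp add: graded_def graded_monomial_def)
qed

lemma sum_graded_monomial: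
  "(\<Sum>s\<in>FFLV_int n m. c s * graded_monomial s d w) = (\<Sum>s\<in>{s \<in> FFLV_int n m. monomial_degree s = d}. c s * monomial_vector s w)"
  using finite_FFLV by (intro sum.mono_neutral_cong_right) (auto simp: graded_monomial_def)

text \<open>As \<open>t\<close> vanishes at all words with more than d outer letters, independence
  with threshold d + 1 removes the monomials of degree above d from its expansion; those of degree
  below d lie in \<open>P d\<close>.\<close>

lemma U_combination:
  assumes t: "t \<in> U d"
  shows "\<exists>c. (\<lambda>w. t w - (\<Sum>s\<in>{s \<in> FFLV_int n m. monomial_degree s = d}. c s * monomial_vector s w)) \<in> P d"
proof -
  have "t \<in> V0" using t U_V0 by blast
  then obtain c where c: "t = (\<lambda>w. \<Sum>s\<in>FFLV_int n m. c s * monomial_vector s w)" using V0_combination by blast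
  have zero: "c s = 0" if "s \<in> FFLV_int n m" "d < monomial_degree s" for s
  proof (rule independent[OF finite_FFLV order_refl])
    show "s \<in> FFLV_int n m" "Suc d \<le> monomial_degree s" using that by auto
    show "(\<Sum>s\<in>FFLV_int n m. c s * monomial_vector s (fill x)) = 0" if "letters x" "Suc d \<le> card (outer_positions x)" for x
      using U_vanish[OF t that(1)] that(2) by (simp add: c)
  qed
  define S where "S = {s \<in> FFLV_int n m. monomial_degree s = d}"
  define R where "R = {s \<in> FFLV_int n m. monomial_degree s < d}"
  have fin: "finite S" "finite R" "S \<inter> R = {}" using finite_FFLV by (auto simp: S_def R_def)
  have "(\<Sum>s\<in>FFLV_int n m. c s * monomial_vector s w) = (\<Sum>s\<in>S \<union> R. c s * monomial_vector s w)" for w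
  proof (rule sum.mono_neutral_right[OF finite_FFLV])
    have "c s = 0" if "s \<in> FFLV_int n m - (S \<union> R)" for s
      using that by (intro zero) (auto simp: S_def R_def)
    then show "\<forall>s\<in>FFLV_int n m - (S \<union> R). c s * monomial_vector s w = 0" by simp
  qed (auto simp: S_def R_def)
  then have split: "t w - (\<Sum>s\<in>S. c s * monomial_vector s w) = (\<Sum>s\<in>R. c s * monomial_vector s w)" for w
    using fin by (simp add: c sum.union_disjoint)
  have "(\<lambda>w. \<Sum>s\<in>R. c s * monomial_vector s w) \<in> P d"
  proof (rule tensor_subspace_sum[OF P_subspace])
    fix s assume "s \<in> R"
    then obtain e where "d = Suc e" "monomial_degree s \<le> e" by (cases d) (auto simp: R_def)
    then show "monomial_vector s \<in> P d" using monomial_vector_U U_mono by auto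
  qed
  then show ?thesis unfolding S_def[symmetric] split[symmetric] by blast
qed

theorem graded_basis:
  "basis_family gr (FFLV_int n m) (\<lambda>s. monomial_act (gr_act n m v) f rs s (gr_vector n m v))"
proof -
  have vec: "monomial_act (gr_act n m v) f rs s (gr_vector n m v) = graded_class (graded_monomial s)" for s
  proof -
    have "set (expand rs s) \<subseteq> poset n" using set_expand rs(2) by blast
    then show ?thesis
      by (simp add: monomial_act_expand foldr_gr_act graded_monomial_def[abs_def] monomial_vector_def monomial_degree_def cong: if_cong)
  qed
  note sum = gr_finsum[OF finite_FFLV graded_monomial_graded]
  show ?thesis
    unfolding vec
  proof (rule basis_familyI[OF gr_module finite_FFLV])
    show "graded_class (graded_monomial s) \<in> carrier gr" for s using graded_monomial_graded by (auto simp: gr_carrier)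
    show "\<exists>c. (\<Oplus>\<^bsub>gr\<^esub>s\<in>FFLV_int n m. c s \<odot>\<^bsub>gr\<^esub> graded_class (graded_monomial s)) = G" if G: "G \<in> carrier gr" for G
    proof -
      obtain y where y: "y \<in> graded" "G = graded_class y" using G by (auto simp: gr_carrier)
      have "\<forall>d. \<exists>c. (\<lambda>w. y d w - (\<Sum>s\<in>{s \<in> FFLV_int n m. monomial_degree s = d}. c s * monomial_vector s w)) \<in> P d"
        using y(1) by (intro allI U_combination) (simp add: graded_def)
      from choice[OF this] obtain c where c: "\<And>d. (\<lambda>w. y d w - (\<Sum>s\<in>{s \<in> FFLV_int n m. monomial_degree s = d}. c d s * monomial_vector s w)) \<in> P d"
        by (elim exE) (rule that, erule spec)
      \<comment> \<open>Each s contributes only in degree \<open>monomial_degree s\<close>, so the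
        coefficients chosen separately for every degree combine into one function of s.\<close>
      have "(\<Sum>s\<in>{s \<in> FFLV_int n m. monomial_degree s = d}. c (monomial_degree s) s * monomial_vector s w) = (\<Sum>s\<in>{s \<in> FFLV_int n m. monomial_degree s = d}. c d s * monomial_vector s w)" for d w
        by (intro sum.cong refl) auto
      then have "G = graded_class (\<lambda>d w. \<Sum>s\<in>FFLV_int n m. c (monomial_degree s) s * graded_monomial s d w)"
        unfolding y(2) graded_class_def sum_graded_monomial using c by (simp add: coset_eq fun_eq_iff[of "\<lambda>d. coset d (y d)"])
      then show ?thesis unfolding sum by (intro exI[of _ "\<lambda>s. c (monomial_degree s) s"]) (rule sym)
    qed
    show "c s = c' s" if eq: "(\<Oplus>\<^bsub>gr\<^esub>s\<in>FFLV_int n m. c s \<odot>\<^bsub>gr\<^esub> graded_class (graded_monomial s)) =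
      (\<Oplus>\<^bsub>gr\<^esub>s\<in>FFLV_int n m. c' s \<odot>\<^bsub>gr\<^esub> graded_class (graded_monomial s))" and s: "s \<in> FFLV_int n m" for c c' s
    proof -
      define d where "d = monomial_degree s"
      define S where "S = {s \<in> FFLV_int n m. monomial_degree s = d}"
      have "coset d (\<lambda>w. \<Sum>s\<in>S. c s * monomial_vector s w) = coset d (\<lambda>w. \<Sum>s\<in>S. c' s * monomial_vector s w)"
        using fun_cong[OF eq[unfolded sum, unfolded graded_class_def sum_graded_monomial], of d] by (simp add: S_def)
      then have mem: "(\<lambda>w. (\<Sum>s\<in>S. c s * monomial_vector s w) - (\<Sum>s\<in>S. c' s * monomial_vector s w)) \<in> P d" by (simp add: coset_eq)
      have "c s - c' s = 0"
      \<comment> \<open>Threshold d: a tensor in \<open>P d\<close> vanishes at every word with at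
        least d outer letters.\<close>
      proof (rule independent[of S d])
        show "finite S" "S \<subseteq> FFLV_int n m" "s \<in> S" "d \<le> monomial_degree s" using finite_FFLV s by (auto simp: S_def d_def)
        show "(\<Sum>s\<in>S. (c s - c' s) * monomial_vector s (fill x)) = 0" if "letters x" "d \<le> card (outer_positions x)" for x
          using P_vanish[OF mem that] by (simp add: left_diff_distrib sum_subtractf)
      qed
      then show ?thesis by simp
    qed
  qed
qed

end

theorem theorem1p12:
  fixes n :: nat and m :: "nat \<Rightarrow> nat"
    and f :: "root \<Rightarrow> complex mat" and rs :: "root list" and v :: tensor
  assumes "n \<ge> 1"
    and "is_root_vectors n f"
    and "distinct rs" and "set rs = poset n"
    and "is_highest_weight_vector n m v"
  shows "basis_family (trace_free_rep n m) (FFLV_int n m)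
           (\<lambda>s. monomial_act (lie_act (2 * n + 1)) f rs s v) \<and>
         basis_family (gr_rep n m v) (FFLV_int n m)
           (\<lambda>s. monomial_act (gr_act n m v) f rs s (gr_vector n m v))"
proof -
  interpret root_order n m v f rs
    by unfold_locales (use assms in auto)
  show ?thesis using trace_free_basis graded_basis unfolding N_def by blast
qed

end
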